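(* Let $\mathbb{K}=\mathbb{R}$ or $\mathbb{C}$, let $(X,x)\hookrightarrow(\mathbb{K}^n,0)$ be an embedded germ of $\mathbb{K}$-analytic space and $i\in\mathbb{N}^*$. The function $\varphi^i\mapsto\mathcal{N}^i_{X,\varphi^i}$ is upper semicontinuous for the Zariski topology on $\mathcal{A}^i_{(\mathbb{K}^n,0)}$; that is, for every irreducible algebraic subvariety $V$ of $\mathcal{A}^i_{(\mathbb{K}^n,0)}\simeq\mathbb{K}^{ni}$ there exists an algebraic variety $V'$ strictly contained in $V$ such that: 1) for all $\varphi^i,\theta^i\in V-V'$, $\mathcal{N}^i_{X,\varphi^i}=\mathcal{N}^i_{X,\theta^i}$; 2) for all $\varphi^i\in V-V'$ and all $\theta^i\in V'$, $\mathcal{N}^i_{X,\varphi^i}<\mathcal{N}^i_{X,\theta^i}$.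
   Context: $\mathcal{A}^i_{(\mathbb{K}^n,0)}$ is the set of local $\mathbb{K}$-algebra morphisms $\mathbb{K}\{X_1,\dots,X_n\}\to\mathbb{K}\{t\}/(t)^{i+1}$; writing such a morphism as $\varphi^i=\sum_{k=1}^iA_kt^k$ with $A_k\in\mathbb{K}^n$ identifies $\mathcal{A}^i_{(\mathbb{K}^n,0)}$ with $\mathbb{K}^{ni}$. Algebraic subvarieties are Zariski closed subsets of $\mathbb{K}^{ni}$ (possibly empty). Nash sequences of diagrams. Let $X=(X_1,\dots,X_n)$ be coordinates on $\mathbb{K}^n$, and let $\varphi(t)=\sum_{k\ge1}A_kt^k$ be an arc in $(\mathbb{K}^n,0)$. Put $(E_0,O_0)=(\mathbb{K},0)\times(\mathbb{K}^n,0)$, $(Z_0,O_0)=(\mathbb{K},0)\times(X,x)$, $\Gamma_0(t)=(t,\varphi(t))$, and inductively for $j\ge1$ let $\Pi_j:E_j\to E_{j-1}$ be the blowing-up of center the point $O_{j-1}$, $\Gamma_j$ the lifting of $\Gamma_{j-1}$ through $\Pi_j$, $O_j=\Gamma_j(0)$, $Z_j$ the strict transform of $Z_{j-1}$. There are local isomorphisms $\theta_j:(\mathbb{K},0)\times(\mathbb{K}^n,0)\to(E_j,O_j)$, $\theta_0=\mathrm{id}$, in which $\Pi_j$ becomes $(t,X)\mapsto(t,t(A_j+X))$ and $\Gamma_j$ becomes $t\mapsto(t,\sum_{k>j}A_kt^{k-j})$. Let $(Z'_j,0)=\theta_j^{-1}(Z_j,O_j)$, with defining ideal $I_{j,A^j}\subset\mathbb{K}\{t,X_1,\dots,X_n\}$,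 $A^j=(A_1,\dots,A_j)$ ($I_{j,A^j}=\mathbb{K}\{t,X\}$ if $O_j\notin Z_j$). Set $N_{j,\varphi}=N(I_{j,A^j})\subset\mathbb{N}^{n+1}$ (so $N_{j,\varphi}=\mathbb{N}^{n+1}$ if $O_j\notin Z_j$). The truncated sequence $\mathcal{N}^i_{X,\varphi^i}=(N_{0,\varphi},\dots,N_{i,\varphi})$ depends only on the truncation $\varphi^i=\sum_{k=1}^iA_kt^k$. Diagram of initial exponents. $\mathbb{N}^{n+1}$, with elements $\alpha=(\alpha_0,\alpha_1,\dots,\alpha_n)$ ($\alpha_0$ is the exponent of $t$), is totally ordered by the lexicographic order on $(|\alpha|,\alpha_0,\dots,\alpha_n)$, $|\alpha|=\alpha_0+\dots+\alpha_n$. For a nonzero power series $f=\sum a_\alpha (t,X)^\alpha$, $\nu(f)=\min\{\alpha: a_\alpha\ne0\}$; for an ideal $I$, $N(I)=\{\nu(g): g\in I,\ g\neq0\}$. Order. $\mathcal{D}(n+1)$ is the set of $N\subset\mathbb{N}^{n+1}$ with $N+\mathbb{N}^{n+1}=N$. Each such $N$ has a unique finite set of vertices $\beta^1<\dots<\beta^s$ (the minimal finite set with $N=\bigcup_k(\beta^k+\mathbb{N}^{n+1})$). $\mathcal{D}(n+1)$ is totally ordered by comparing lexicographically the sequences $(\beta^1,\dots,\beta^s,\infty,\infty,\dots)$, with $\beta<\infty$ for all $\beta\in\mathbb{N}^{n+1}$. Sequences of elements of $\mathcal{D}(n+1)$ are ordered lexicographically. *)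

theory Defs
  imports
    "HOL-Analysis.Analysis"
    "HOL-Algebra.Ideal"
    "HOL-Library.Poly_Mapping"
begin

section \<open>Exponents\<close>

text \<open>
  An exponent is a finitely supported function from variable indices to natural numbers.
  Index 0 stands for the variable \<open>t\<close> and the indices \<open>1, ..., n\<close> for \<open>X\<^sub>1, ..., X\<^sub>n\<close>.
\<close>

type_synonym expo = "nat \<Rightarrow>\<^sub>0 nat"

definition expos :: "nat set \<Rightarrow> expo set"
  where "expos V = {\<alpha>. Poly_Mapping.keys \<alpha> \<subseteq> V}"

definition tdeg :: "expo \<Rightarrow> nat"
  where "tdeg \<alpha> = (\<Sum>k\<in>Poly_Mapping.keys \<alpha>. Poly_Mapping.lookup \<alpha> k)"

text \<open>
  The library order on \<^typ>\<open>expo\<close> is lexicographic with the smallest index first, so this is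
  the lexicographic order on \<open>(|\<alpha>|, \<alpha>\<^sub>0, \<alpha>\<^sub>1, ..., \<alpha>\<^sub>n)\<close>.
\<close>

definition expo_less :: "expo \<Rightarrow> expo \<Rightarrow> bool"
  where "expo_less \<alpha> \<beta> \<longleftrightarrow> tdeg \<alpha> < tdeg \<beta> \<or> tdeg \<alpha> = tdeg \<beta> \<and> \<alpha> < \<beta>"

lemma finite_expo_splits: "finite {(\<beta>, \<gamma>). \<beta> + \<gamma> = (\<alpha> :: expo)}"
proof -
  let ?S = "{\<beta>. \<exists>\<gamma>. \<beta> + \<gamma> = \<alpha>}"
  let ?f = "\<lambda>\<beta>. restrict (Poly_Mapping.lookup \<beta>) (Poly_Mapping.keys \<alpha>)"
  have le: "Poly_Mapping.lookup \<beta> k \<le> Poly_Mapping.lookup \<alpha> k" if "\<beta> \<in> ?S" for \<beta> k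
    using that by (auto simp: lookup_add)
  have "?f ` ?S \<subseteq> PiE (Poly_Mapping.keys \<alpha>) (\<lambda>k. {..Poly_Mapping.lookup \<alpha> k})"
    using le by auto
  then have fin: "finite (?f ` ?S)"
    by (rule finite_subset) (intro finite_PiE; simp)
  have "inj_on ?f ?S"
  proof (rule inj_onI)
    fix \<beta> \<gamma> assume b: "\<beta> \<in> ?S" and g: "\<gamma> \<in> ?S" and eq: "?f \<beta> = ?f \<gamma>"
    have "Poly_Mapping.lookup \<beta> k = Poly_Mapping.lookup \<gamma> k" for k
    proof (cases "k \<in> Poly_Mapping.keys \<alpha>")
      case True
      then show ?thesis using fun_cong[OF eq, of k] by simp
    next
      case False
      then have "Poly_Mapping.lookup \<alpha> k = 0" by (simp add: in_keys_iff)
      then show ?thesis using le[OF b, of k] le[OF g, of k] by simp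
    qed
    then show "\<beta> = \<gamma>" by (intro poly_mapping_eqI) simp
  qed
  then have S: "finite ?S" using fin by (rule finite_imageD[rotated])
  have T: "{(\<beta>, \<gamma>). \<beta> + \<gamma> = \<alpha>} \<subseteq> ?S \<times> ?S"
    by (auto, metis add.commute)
  show ?thesis
    by (rule finite_subset[OF T]) (use S in simp)
qed


section \<open>Power series\<close>

typedef 'a mseries = "UNIV :: (expo \<Rightarrow> 'a) set"
  morphisms coeff MSeries by simp

setup_lifting type_definition_mseries

lemma mseries_eqI: "(\<And>\<alpha>. coeff f \<alpha> = coeff g \<alpha>) \<Longrightarrow> f = g"
  by transfer auto

instantiation mseries :: (comm_ring_1) comm_ring_1
begin

lift_definition zero_mseries :: "'a mseries" is "\<lambda>_. 0" .
lift_definition one_mseries :: "'a mseries" is "\<lambda>\<alpha>. if \<alpha> = 0 then 1 else 0" .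
lift_definition plus_mseries :: "'a mseries \<Rightarrow> 'a mseries \<Rightarrow> 'a mseries"
  is "\<lambda>f g \<alpha>. f \<alpha> + g \<alpha>" .
lift_definition minus_mseries :: "'a mseries \<Rightarrow> 'a mseries \<Rightarrow> 'a mseries"
  is "\<lambda>f g \<alpha>. f \<alpha> - g \<alpha>" .
lift_definition uminus_mseries :: "'a mseries \<Rightarrow> 'a mseries"
  is "\<lambda>f \<alpha>. - f \<alpha>" .
lift_definition times_mseries :: "'a mseries \<Rightarrow> 'a mseries \<Rightarrow> 'a mseries"
  is "\<lambda>f g \<alpha>. \<Sum>(\<beta>, \<gamma>)\<in>{(\<beta>, \<gamma>). \<beta> + \<gamma> = \<alpha>}. f \<beta> * g \<gamma>" .

instance
proof
  fix f g h :: "'a mseries"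
  show "f + g + h = f + (g + h)" "f + g = g + f" "0 + f = f" "- f + f = 0" "f - g = f + - g"
    by (transfer; simp add: add.assoc add.commute fun_eq_iff)+
  show "(0::'a mseries) \<noteq> 1"
    by transfer (auto simp: fun_eq_iff)
  show "(f + g) * h = f * h + g * h"
    by transfer (simp add: distrib_right split_def sum.distrib)
  show "f * g = g * f"
  proof (transfer, rule ext)
    fix f g :: "expo \<Rightarrow> 'a" and \<alpha> :: expo
    show "(\<Sum>(\<beta>, \<gamma>)\<in>{(\<beta>, \<gamma>). \<beta> + \<gamma> = \<alpha>}. f \<beta> * g \<gamma>) =
          (\<Sum>(\<beta>, \<gamma>)\<in>{(\<beta>, \<gamma>). \<beta> + \<gamma> = \<alpha>}. g \<beta> * f \<gamma>)"
      by (rule sum.reindex_bij_witness[where i = prod.swap and j = prod.swap])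
        (auto simp: mult.commute add.commute)
  qed
  show "1 * f = f"
  proof (transfer, rule ext)
    fix f :: "expo \<Rightarrow> 'a" and \<alpha> :: expo
    have "(\<Sum>(\<beta>, \<gamma>)\<in>{(\<beta>, \<gamma>). \<beta> + \<gamma> = \<alpha>}. (if \<beta> = 0 then 1 else 0) * f \<gamma>) =
          (\<Sum>(\<beta>, \<gamma>)\<in>{(0::expo, \<alpha>)}. (if \<beta> = 0 then 1 else 0) * f \<gamma>)"
      by (rule sum.mono_neutral_right[OF finite_expo_splits]) (auto split: if_split_asm, (metis mult_zero_left)?)
    then show "(\<Sum>(\<beta>, \<gamma>)\<in>{(\<beta>, \<gamma>). \<beta> + \<gamma> = \<alpha>}. (if \<beta> = 0 then 1 else 0) * f \<gamma>) = f \<alpha>"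
      by simp
  qed
  show "f * g * h = f * (g * h)"
  proof (transfer, rule ext)
    fix f g h :: "expo \<Rightarrow> 'a" and \<alpha> :: expo
    let ?D = "\<lambda>\<alpha>::expo. {(\<beta>, \<gamma>). \<beta> + \<gamma> = \<alpha>}"
    have "(\<Sum>(\<beta>, \<gamma>)\<in>?D \<alpha>. (\<Sum>(\<delta>, \<epsilon>)\<in>?D \<beta>. f \<delta> * g \<epsilon>) * h \<gamma>) =
          (\<Sum>p\<in>?D \<alpha>. \<Sum>q\<in>?D (fst p). f (fst q) * g (snd q) * h (snd p))"
      by (simp add: split_def sum_distrib_right)
    also have "\<dots> = (\<Sum>(p, q)\<in>(SIGMA p:?D \<alpha>. ?D (fst p)). f (fst q) * g (snd q) * h (snd p))"
      by (rule sum.Sigma) (auto simp: finite_expo_splits)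
    also have "\<dots> = (\<Sum>(p, q)\<in>(SIGMA p:?D \<alpha>. ?D (snd p)). f (fst p) * g (fst q) * h (snd q))"
      by (rule sum.reindex_bij_witness
          [where i = "\<lambda>(p, q). ((fst p + fst q, snd q), (fst p, fst q))"
            and j = "\<lambda>(p, q). ((fst q, snd q + snd p), (snd q, snd p))"])
        (auto simp: add.assoc)
    also have "\<dots> = (\<Sum>p\<in>?D \<alpha>. \<Sum>q\<in>?D (snd p). f (fst p) * g (fst q) * h (snd q))"
      by (rule sum.Sigma[symmetric]) (auto simp: finite_expo_splits)
    also have "\<dots> = (\<Sum>(\<beta>, \<gamma>)\<in>?D \<alpha>. f \<beta> * (\<Sum>(\<delta>, \<epsilon>)\<in>?D \<gamma>. g \<delta> * h \<epsilon>))"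
      by (simp add: split_def sum_distrib_left mult.assoc)
    finally show "(\<Sum>(\<beta>, \<gamma>)\<in>?D \<alpha>. (\<Sum>(\<delta>, \<epsilon>)\<in>?D \<beta>. f \<delta> * g \<epsilon>) * h \<gamma>) =
      (\<Sum>(\<beta>, \<gamma>)\<in>?D \<alpha>. f \<beta> * (\<Sum>(\<delta>, \<epsilon>)\<in>?D \<gamma>. g \<delta> * h \<epsilon>))" .
  qed
qed

end

definition ms_const :: "'a::comm_ring_1 \<Rightarrow> 'a mseries"
  where "ms_const c = MSeries (\<lambda>\<alpha>. if \<alpha> = 0 then c else 0)"

definition ms_var :: "nat \<Rightarrow> 'a::comm_ring_1 mseries"
  where "ms_var k = MSeries (\<lambda>\<alpha>. if \<alpha> = Poly_Mapping.single k 1 then 1 else 0)"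

text \<open>
  Substitution \<open>f(g\<^sub>0, ..., g\<^sub>n)\<close> into a series in the variables \<open>0, ..., n\<close>, for series \<open>g\<^sub>k\<close>
  without constant term: then monomials of degree above \<open>|\<beta>|\<close> do not contribute to the
  coefficient of exponent \<open>\<beta>\<close>, and the sum is finite.
\<close>

definition ms_subst :: "nat \<Rightarrow> (nat \<Rightarrow> 'a::comm_ring_1 mseries) \<Rightarrow> 'a mseries \<Rightarrow> 'a mseries"
  where "ms_subst n g f = MSeries (\<lambda>\<beta>.
    \<Sum>\<alpha> | \<alpha> \<in> expos {0..n} \<and> tdeg \<alpha> \<le> tdeg \<beta>.
      coeff f \<alpha> * coeff (\<Prod>k\<in>{0..n}. g k ^ Poly_Mapping.lookup \<alpha> k) \<beta>)"


section \<open>Convergent power series and their ideals\<close>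

text \<open>
  \<open>conv_ring {1..n}\<close> is \<open>\<bbbK>{X\<^sub>1, ..., X\<^sub>n}\<close> and \<open>conv_ring {0..n}\<close> is \<open>\<bbbK>{t, X\<^sub>1, ..., X\<^sub>n}\<close>;
  the former is a subring of the latter.
\<close>

definition conv_series :: "nat set \<Rightarrow> 'a::real_normed_field mseries set"
  where "conv_series V = {f. (\<forall>\<alpha>. coeff f \<alpha> \<noteq> 0 \<longrightarrow> \<alpha> \<in> expos V) \<and>
    (\<exists>r>0. (\<lambda>\<alpha>. norm (coeff f \<alpha>) * r ^ tdeg \<alpha>) summable_on expos V)}"

definition conv_ring :: "nat set \<Rightarrow> 'a::real_normed_field mseries ring"
  where "conv_ring V = \<lparr>carrier = conv_series V, mult = (*), one = 1, ring.zero = 0, ring.add = (+)\<rparr>"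

lemma tdeg_alt: "finite S \<Longrightarrow> Poly_Mapping.keys \<alpha> \<subseteq> S \<Longrightarrow> tdeg \<alpha> = (\<Sum>k\<in>S. Poly_Mapping.lookup \<alpha> k)"
  unfolding tdeg_def by (rule sum.mono_neutral_left) (auto simp: in_keys_iff)

lemma tdeg_add: "tdeg (\<alpha> + \<beta>) = tdeg \<alpha> + tdeg \<beta>"
proof -
  let ?S = "Poly_Mapping.keys \<alpha> \<union> Poly_Mapping.keys \<beta>"
  have "tdeg (\<alpha> + \<beta>) = (\<Sum>k\<in>?S. Poly_Mapping.lookup (\<alpha> + \<beta>) k)"
    by (rule tdeg_alt) (use Poly_Mapping.keys_add[of \<alpha> \<beta>] in auto)
  also have "\<dots> = tdeg \<alpha> + tdeg \<beta>"
    by (simp add: lookup_add sum.distrib tdeg_alt[of ?S])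
  finally show ?thesis .
qed

lemma expos_add_iff: "\<beta> + \<gamma> \<in> expos V \<longleftrightarrow> \<beta> \<in> expos V \<and> \<gamma> \<in> expos V"
  unfolding expos_def by (auto simp: in_keys_iff lookup_add subset_iff)

lemma conv_series_radius_mono:
  fixes f :: "'a::real_normed_field mseries"
  assumes "(\<lambda>\<alpha>. norm (coeff f \<alpha>) * r ^ tdeg \<alpha>) summable_on A" "0 < s" "s \<le> r"
  shows "(\<lambda>\<alpha>. norm (coeff f \<alpha>) * s ^ tdeg \<alpha>) summable_on A"
  using assms(1)
  by (rule summable_on_comparison_test)
     (use assms(2,3) in \<open>auto intro!: mult_left_mono power_mono\<close>)

lemma conv_series_common:
  assumes "f \<in> conv_series V" "g \<in> conv_series V"
  obtains r where "r > 0" "(\<lambda>\<alpha>. norm (coeff f \<alpha>) * r ^ tdeg \<alpha>) summable_on expos V"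
    "(\<lambda>\<alpha>. norm (coeff g \<alpha>) * r ^ tdeg \<alpha>) summable_on expos V"
proof -
  obtain r s where "r > 0" "s > 0" "(\<lambda>\<alpha>. norm (coeff f \<alpha>) * r ^ tdeg \<alpha>) summable_on expos V"
    "(\<lambda>\<alpha>. norm (coeff g \<alpha>) * s ^ tdeg \<alpha>) summable_on expos V"
    using assms unfolding conv_series_def by auto
  then show ?thesis
    by (intro that[of "min r s"]) (auto intro: conv_series_radius_mono)
qed

lemma coeff_simps [simp]:
  "coeff (f + g) \<alpha> = coeff f \<alpha> + coeff g \<alpha>" "coeff (- f) \<alpha> = - coeff f \<alpha>" "coeff 0 \<alpha> = 0"
  by (transfer; simp)+

lemma coeff_one: "coeff 1 \<alpha> = (if \<alpha> = 0 then 1 else 0)"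
  by transfer simp

lemma coeff_mult: "coeff (f * g) \<alpha> = (\<Sum>(\<beta>, \<gamma>)\<in>{(\<beta>, \<gamma>). \<beta> + \<gamma> = \<alpha>}. coeff f \<beta> * coeff g \<gamma>)"
  by (simp only: times_mseries.rep_eq)

lemma conv_series_add: "f \<in> conv_series V \<Longrightarrow> g \<in> conv_series V \<Longrightarrow> f + g \<in> conv_series V"
proof -
  assume f: "f \<in> conv_series V" and g: "g \<in> conv_series V"
  obtain r where r: "r > 0" "(\<lambda>\<alpha>. norm (coeff f \<alpha>) * r ^ tdeg \<alpha>) summable_on expos V"
    "(\<lambda>\<alpha>. norm (coeff g \<alpha>) * r ^ tdeg \<alpha>) summable_on expos V"
    using conv_series_common[OF f g] .
  have "(\<lambda>\<alpha>. norm (coeff (f + g) \<alpha>) * r ^ tdeg \<alpha>) summable_on expos V"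
    by (rule summable_on_comparison_test[OF summable_on_add[OF r(2,3)]])
       (use r(1) in \<open>auto simp flip: distrib_right intro!: mult_right_mono norm_triangle_ineq\<close>)
  moreover have "coeff (f + g) \<alpha> \<noteq> 0 \<Longrightarrow> \<alpha> \<in> expos V" for \<alpha>
    using f g unfolding conv_series_def by (cases "coeff f \<alpha> = 0") auto
  ultimately show ?thesis using r(1) unfolding conv_series_def by blast
qed

lemma conv_series_uminus: "f \<in> conv_series V \<Longrightarrow> - f \<in> conv_series V"
  unfolding conv_series_def by simp

lemma conv_series_finite:
  assumes "finite F" "F \<subseteq> expos V" "\<And>\<alpha>. coeff f \<alpha> \<noteq> 0 \<Longrightarrow> \<alpha> \<in> F"
  shows "f \<in> conv_series V"
proof -
  have "(\<lambda>\<alpha>. norm (coeff f \<alpha>) * 1 ^ tdeg \<alpha>) summable_on expos V"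
    by (subst summable_on_cong_neutral[where T = F and g = "\<lambda>\<alpha>. norm (coeff f \<alpha>)"])
       (use assms in auto)
  then show ?thesis using assms unfolding conv_series_def
    by (auto intro!: exI[of _ 1])
qed

lemma conv_series_mult: "f \<in> conv_series V \<Longrightarrow> g \<in> conv_series V \<Longrightarrow> f * g \<in> conv_series V"
proof -
  assume f: "f \<in> conv_series V" and g: "g \<in> conv_series V"
  obtain r where r: "r > 0" "(\<lambda>\<alpha>. norm (coeff f \<alpha>) * r ^ tdeg \<alpha>) summable_on expos V"
    "(\<lambda>\<alpha>. norm (coeff g \<alpha>) * r ^ tdeg \<alpha>) summable_on expos V"
    using conv_series_common[OF f g] .
  define F where "F = (\<lambda>\<alpha>. norm (coeff f \<alpha>) * r ^ tdeg \<alpha>)"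
  define G where "G = (\<lambda>\<alpha>. norm (coeff g \<alpha>) * r ^ tdeg \<alpha>)"
  have nn: "F \<alpha> \<ge> 0" "G \<alpha> \<ge> 0" for \<alpha> using r(1) by (auto simp: F_def G_def)
  let ?D = "\<lambda>\<alpha>::expo. {(\<beta>, \<gamma>). \<beta> + \<gamma> = \<alpha>}"
  have "(\<lambda>(\<beta>, \<gamma>). F \<beta> * G \<gamma>) summable_on expos V \<times> expos V"
  proof (rule summable_on_SigmaI[where g = "\<lambda>\<beta>. F \<beta> * infsum G (expos V)"])
    show "((\<lambda>\<gamma>. case (\<beta>, \<gamma>) of (\<beta>, \<gamma>) \<Rightarrow> F \<beta> * G \<gamma>) has_sum F \<beta> * infsum G (expos V)) (expos V)" for \<beta>
      using r(3) unfolding prod.case G_def[symmetric]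
      by (intro has_sum_cmult_right has_sum_infsum) simp
    show "(\<lambda>\<beta>. F \<beta> * infsum G (expos V)) summable_on expos V"
      using r(2) unfolding F_def[symmetric] by (intro summable_on_cmult_left)
  qed (use nn in auto)
  also have "?this \<longleftrightarrow> (\<lambda>(\<alpha>, (\<beta>, \<gamma>)). F \<beta> * G \<gamma>) summable_on (SIGMA \<alpha>:expos V. ?D \<alpha>)"
    by (rule summable_on_reindex_bij_witness[where i = "\<lambda>(\<alpha>, p). p" and j = "\<lambda>(\<beta>, \<gamma>). (\<beta> + \<gamma>, (\<beta>, \<gamma>))"])
       (auto simp: expos_add_iff)
  finally have "(\<lambda>\<alpha>. infsum (\<lambda>p. (\<lambda>(\<alpha>, (\<beta>, \<gamma>)). F \<beta> * G \<gamma>) (\<alpha>, p)) (?D \<alpha>)) summable_on expos V"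
    by (rule summable_on_SigmaD) (simp add: finite_expo_splits summable_on_finite)
  then have *: "(\<lambda>\<alpha>. \<Sum>(\<beta>, \<gamma>)\<in>?D \<alpha>. F \<beta> * G \<gamma>) summable_on expos V"
    by (simp add: finite_expo_splits)
  have "(\<lambda>\<alpha>. norm (coeff (f * g) \<alpha>) * r ^ tdeg \<alpha>) summable_on expos V"
  proof (rule summable_on_comparison_test[OF *])
    fix \<alpha>
    have "norm (coeff (f * g) \<alpha>) * r ^ tdeg \<alpha> \<le>
      (\<Sum>(\<beta>, \<gamma>)\<in>?D \<alpha>. norm (coeff f \<beta> * coeff g \<gamma>)) * r ^ tdeg \<alpha>"
      unfolding coeff_mult split_def by (intro mult_right_mono norm_sum) (use r(1) in auto)
    also have "\<dots> = (\<Sum>(\<beta>, \<gamma>)\<in>?D \<alpha>. F \<beta> * G \<gamma>)"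
      unfolding sum_distrib_right F_def G_def
      by (intro sum.cong) (auto simp: tdeg_add power_add norm_mult mult_ac)
    finally show "norm (coeff (f * g) \<alpha>) * r ^ tdeg \<alpha> \<le> (\<Sum>(\<beta>, \<gamma>)\<in>?D \<alpha>. F \<beta> * G \<gamma>)" .
  qed (use r(1) in auto)
  moreover have "\<alpha> \<in> expos V" if nz: "coeff (f * g) \<alpha> \<noteq> 0" for \<alpha>
  proof -
    obtain p where "p \<in> {(\<beta>, \<gamma>). \<beta> + \<gamma> = \<alpha>}"
        "(case p of (\<beta>, \<gamma>) \<Rightarrow> coeff f \<beta> * coeff g \<gamma>) \<noteq> 0"
      using nz unfolding coeff_mult by (rule sum.not_neutral_contains_not_neutral)
    then obtain \<beta> \<gamma> where "\<beta> + \<gamma> = \<alpha>" "coeff f \<beta> \<noteq> 0" "coeff g \<gamma> \<noteq> 0"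
      by (cases p) auto
    then show ?thesis using f g unfolding conv_series_def by (auto simp: expos_add_iff)
  qed
  ultimately show ?thesis using r(1) unfolding conv_series_def by blast
qed

lemma conv_series_zero: "0 \<in> conv_series V"
  by (rule conv_series_finite[of "{}"]) auto

lemma conv_series_one: "1 \<in> conv_series V"
  by (rule conv_series_finite[of "{0}"]) (auto simp: expos_def coeff_one split: if_splits)

lemma cring_conv_ring: "cring (conv_ring V)"
proof (rule cringI)
  show "abelian_group (conv_ring V)"
  proof (rule abelian_groupI)
    fix f assume "f \<in> carrier (conv_ring V)"
    then show "\<exists>g\<in>carrier (conv_ring V). g \<oplus>\<^bsub>conv_ring V\<^esub> f = \<zero>\<^bsub>conv_ring V\<^esub>"
      by (intro bexI[of _ "- f"]) (simp_all add: conv_ring_def conv_series_uminus)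
  qed (simp_all add: conv_ring_def conv_series_add conv_series_zero algebra_simps)
  show "Group.comm_monoid (conv_ring V)"
    by (rule comm_monoidI)
      (simp_all add: conv_ring_def conv_series_mult conv_series_one algebra_simps)
  show "(f \<oplus>\<^bsub>conv_ring V\<^esub> g) \<otimes>\<^bsub>conv_ring V\<^esub> h =
      f \<otimes>\<^bsub>conv_ring V\<^esub> h \<oplus>\<^bsub>conv_ring V\<^esub> g \<otimes>\<^bsub>conv_ring V\<^esub> h" for f g h
    by (simp add: conv_ring_def algebra_simps)
qed

text \<open>An embedded germ of analytic space in \<open>(\<bbbK>\<^sup>n, 0)\<close>, possibly non-reduced, is given by
  a proper ideal of \<open>\<bbbK>{X\<^sub>1, ..., X\<^sub>n}\<close>.\<close>

definition germ_ideal :: "nat \<Rightarrow> 'a::real_normed_field mseries set \<Rightarrow> bool"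
  where "germ_ideal n I \<longleftrightarrow> ideal I (conv_ring {1..n}) \<and> I \<noteq> carrier (conv_ring {1..n})"


section \<open>Strict transforms along an arc\<close>

text \<open>The components of \<open>(t, X) \<mapsto> (t, t (a + X))\<close>, the expression of a point blowing-up in the
  chart centred at the point of the exceptional divisor \<open>{t = 0}\<close> with coordinates \<open>a\<close>.\<close>

definition blowup_chart :: "(nat \<Rightarrow> 'a::comm_ring_1) \<Rightarrow> nat \<Rightarrow> 'a mseries"
  where "blowup_chart a k =
    (if k = 0 then ms_var 0 else ms_var 0 * (ms_const (a k) + ms_var k))"

text \<open>The strict transform is the total transform with its components in the exceptional
  divisor removed: its ideal is the saturation of the pulled-back ideal with respect to \<open>t\<close>.
  It is the unit ideal exactly when the origin of the chart is not in the strict transform.\<close>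

definition strict_transform ::
    "nat \<Rightarrow> (nat \<Rightarrow> 'a::real_normed_field) \<Rightarrow> 'a mseries set \<Rightarrow> 'a mseries set"
  where "strict_transform n a J =
    {g \<in> conv_series {0..n}. \<exists>m. ms_var 0 ^ m * g
       \<in> Idl\<^bsub>conv_ring {0..n}\<^esub> (ms_subst n (blowup_chart a) ` J)}"

text \<open>The vector \<open>A\<^sub>k\<close> of a truncated arc has the coordinates \<open>A (k, 1), ..., A (k, n)\<close>.
  \<open>nash_ideal n I A j\<close> is the ideal \<open>I\<close> with index \<open>j, A\<^sup>j\<close>; it only involves \<open>A\<^sub>1, ..., A\<^sub>j\<close>.\<close>

primrec nash_ideal ::
    "nat \<Rightarrow> 'a::real_normed_field mseries set \<Rightarrow> (nat \<times> nat \<Rightarrow> 'a) \<Rightarrow> nat \<Rightarrow> 'a mseries set"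
  where
    "nash_ideal n I A 0 = Idl\<^bsub>conv_ring {0..n}\<^esub> I"
  | "nash_ideal n I A (Suc j) = strict_transform n (\<lambda>l. A (Suc j, l)) (nash_ideal n I A j)"


section \<open>Diagrams of initial exponents\<close>

definition initial_expo :: "'a::comm_ring_1 mseries \<Rightarrow> expo"
  where "initial_expo f =
    (THE \<alpha>. coeff f \<alpha> \<noteq> 0 \<and> (\<forall>\<beta>. coeff f \<beta> \<noteq> 0 \<longrightarrow> \<beta> = \<alpha> \<or> expo_less \<alpha> \<beta>))"

definition diagram :: "'a::comm_ring_1 mseries set \<Rightarrow> expo set"
  where "diagram I = {initial_expo g | g. g \<in> I \<and> g \<noteq> 0}"

definition vertices :: "nat \<Rightarrow> expo set \<Rightarrow> expo set"
  where "vertices n N =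
    (LEAST B. finite B \<and> N = (\<Union>\<beta>\<in>B. {\<beta> + \<gamma> | \<gamma>. \<gamma> \<in> expos {0..n}}))"

definition vertex_list :: "nat \<Rightarrow> expo set \<Rightarrow> expo list"
  where "vertex_list n N = (THE bs. sorted_wrt expo_less bs \<and> set bs = vertices n N)"

text \<open>The sequence \<open>(\<beta>\<^sup>1, ..., \<beta>\<^sup>s, \<infinity>, \<infinity>, ...)\<close>, with \<^term>\<open>None\<close> for \<open>\<infinity>\<close>.\<close>

definition vertex_seq :: "nat \<Rightarrow> expo set \<Rightarrow> nat \<Rightarrow> expo option"
  where "vertex_seq n N k =
    (if k < length (vertex_list n N) then Some (vertex_list n N ! k) else None)"

fun ext_expo_less :: "expo option \<Rightarrow> expo option \<Rightarrow> bool"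
  where
    "ext_expo_less (Some \<alpha>) (Some \<beta>) = expo_less \<alpha> \<beta>"
  | "ext_expo_less (Some \<alpha>) None = True"
  | "ext_expo_less None _ = False"

definition diagram_less :: "nat \<Rightarrow> expo set \<Rightarrow> expo set \<Rightarrow> bool"
  where "diagram_less n N M \<longleftrightarrow>
    (\<exists>k. (\<forall>j<k. vertex_seq n N j = vertex_seq n M j) \<and>
         ext_expo_less (vertex_seq n N k) (vertex_seq n M k))"

definition nash_seq ::
    "nat \<Rightarrow> 'a::real_normed_field mseries set \<Rightarrow> nat \<Rightarrow> (nat \<times> nat \<Rightarrow> 'a) \<Rightarrow> expo set list"
  where "nash_seq n I i A = map (\<lambda>j. diagram (nash_ideal n I A j)) [0..<Suc i]"

definition nash_seq_less :: "nat \<Rightarrow> expo set list \<Rightarrow> expo set list \<Rightarrow> bool"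
  where "nash_seq_less n Ns Ms \<longleftrightarrow> (Ns, Ms) \<in> lexord {(N, M). diagram_less n N M}"


section \<open>Zariski topology\<close>

text \<open>The affine space over a finite index set \<open>S\<close> consists of the extensional functions on \<open>S\<close>,
  and \<^typ>\<open>('v \<Rightarrow>\<^sub>0 nat) \<Rightarrow>\<^sub>0 'a\<close> is the library's type of polynomials in variables from \<^typ>\<open>'v\<close>.\<close>

definition affine_space :: "'v set \<Rightarrow> ('v \<Rightarrow> 'a) set"
  where "affine_space S = S \<rightarrow>\<^sub>E UNIV"

definition polys :: "'v set \<Rightarrow> (('v \<Rightarrow>\<^sub>0 nat) \<Rightarrow>\<^sub>0 'a::comm_ring_1) set"
  where "polys S = {p. \<forall>m\<in>Poly_Mapping.keys p. Poly_Mapping.keys m \<subseteq> S}"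

definition poly_eval :: "(('v \<Rightarrow>\<^sub>0 nat) \<Rightarrow>\<^sub>0 'a::comm_ring_1) \<Rightarrow> ('v \<Rightarrow> 'a) \<Rightarrow> 'a"
  where "poly_eval p x =
    (\<Sum>m\<in>Poly_Mapping.keys p. Poly_Mapping.lookup p m *
      (\<Prod>v\<in>Poly_Mapping.keys m. x v ^ Poly_Mapping.lookup m v))"

definition algebraic_set :: "'v set \<Rightarrow> ('v \<Rightarrow> 'a::comm_ring_1) set \<Rightarrow> bool"
  where "algebraic_set S V \<longleftrightarrow>
    (\<exists>P\<subseteq>polys S. V = {x \<in> affine_space S. \<forall>p\<in>P. poly_eval p x = 0})"

definition irreducible_algebraic_set :: "'v set \<Rightarrow> ('v \<Rightarrow> 'a::comm_ring_1) set \<Rightarrow> bool"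
  where "irreducible_algebraic_set S V \<longleftrightarrow> algebraic_set S V \<and> V \<noteq> {} \<and>
    (\<forall>V1 V2. algebraic_set S V1 \<and> algebraic_set S V2 \<and> V = V1 \<union> V2 \<longrightarrow> V = V1 \<or> V = V2)"

definition zariski_usc ::
    "'v set \<Rightarrow> ('b \<Rightarrow> 'b \<Rightarrow> bool) \<Rightarrow> (('v \<Rightarrow> 'a::comm_ring_1) \<Rightarrow> 'b) \<Rightarrow> bool"
  where "zariski_usc S lt F \<longleftrightarrow>
    (\<forall>V. irreducible_algebraic_set S V \<longrightarrow>
      (\<exists>V'. algebraic_set S V' \<and> V' \<subset> V \<and>
        (\<forall>\<phi>\<in>V - V'. \<forall>\<theta>\<in>V - V'. F \<phi> = F \<theta>) \<and>
        (\<forall>\<phi>\<in>V - V'. \<forall>\<theta>\<in>V'. lt (F \<phi>) (F \<theta>))))"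

end

theory Submission
  imports Defs
begin

text \<open>
  For diagrams, \<open>N < M\<close> holds iff the first exponent at which they differ lies in \<open>N\<close>, and every
  nonempty set of diagrams has a minimum. So one restricts, step by step, to the locus in \<open>V\<close> where
  \<open>N\<^sub>0, ..., N\<^sub>j\<close> are all minimal, and it suffices that each step cuts out a nonempty set that is open
  in the previous one. This holds as long as the ideals \<open>I\<^sub>j\<close> are spanned, up to arbitrarily high order,
  by sections whose coefficients are polynomials in the arc: elimination at one point yields sections
  that realize the diagram at that point and whose pivots are nonzero on a neighbourhood.

  The spanning property passes from \<open>J\<close> to its strict transform where the diagram of \<open>J\<close> is constant.
  There, elements of order \<open>d\<close> extend to sections of order \<open>d\<close>, and \<open>f(t, t(a + X)) / t\<^sup>d\<close> is
  again a polynomial section. These quotients are dense in the strict transform. Indeed, they form a module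
  over the polynomials that is stable under possible divisions by \<open>t\<close>, and so is its closure in the
  power series, by the Artin--Rees lemma for the polynomial ideal obtained at \<open>t = 0\<close>.
\<close>

subsection \<open>Dickson's lemma\<close>

text \<open>A diagram is decided by finitely many coefficients, because it has finitely many
  vertices. Hence it is enough to approximate elements by sections to any finite order: no ideal is
  handled through generators, no division theorem for convergent series enters, and convergence
  never has to be uniform in the arc. The obstacle is saturation. The power of \<open>t\<close> that
  can be cancelled from a pulled-back element may jump with the arc, and a combination of
  pulled-back elements may become divisible by \<open>t\<close> through cancellation. Constancy of
  the diagram meets the first difficulty: a section can keep order at least \<open>d\<close> at all
  points, so the same \<open>t^d\<close> is cancelled everywhere. For the second, note that at
  \<open>t = 0\<close> the quotient \<open>f(t, t(a + X)) / t^d\<close> is the form of degree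
  \<open>d\<close> of \<open>f\<close> evaluated at \<open>(1, a + X)\<close>, a polynomial in
  \<open>X\<close>. So leading terms exist there and Dickson's lemma bounds the cancellation,
  whereas an element of the strict transform restricts in general only to a convergent
  series.\<close>

lemma nat_seq_incseq_subseq:
  fixes s :: "nat \<Rightarrow> nat"
  obtains g :: "nat \<Rightarrow> nat" where "strict_mono g" "\<And>i j. i \<le> j \<Longrightarrow> s (g i) \<le> s (g j)"
proof -
  obtain g :: "nat \<Rightarrow> nat" where g: "strict_mono g" "monoseq (\<lambda>i. s (g i))"
    using seq_monosub[of s] by blast
  show ?thesis
  proof (cases "\<forall>m n. m \<le> n \<longrightarrow> s (g m) \<le> s (g n)")
    case True
    then show ?thesis using g(1) by (intro that[of g]) simp_all
  next
    case False
    with g(2) have dec: "\<And>m n. m \<le> n \<Longrightarrow> s (g n) \<le> s (g m)"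
      unfolding monoseq_def by blast
    \<comment> \<open>An antitone sequence of naturals is constant from the point where it attains
      its minimum.\<close>
    obtain i0 where i0: "\<And>i. s (g i0) \<le> s (g i)"
      using ex_has_least_nat[of "\<lambda>_. True" 0 "\<lambda>i. s (g i)"] by auto
    show ?thesis
    proof (rule that)
      show "strict_mono (\<lambda>i. g (i0 + i))"
        using g(1) by (simp add: strict_mono_def)
      show "s (g (i0 + i)) \<le> s (g (i0 + j))" if "i \<le> j" for i j
        using dec[of i0 "i0 + i"] i0[of "i0 + j"] by simp
    qed
  qed
qed

lemma dickson_seq:
  fixes s :: "nat \<Rightarrow> 'k \<Rightarrow> nat"
  assumes "finite S"
  shows "\<exists>f :: nat \<Rightarrow> nat. strict_mono f \<and> (\<forall>k\<in>S. \<forall>i j. i \<le> j \<longrightarrow> s (f i) k \<le> s (f j) k)"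
  using assms
proof induction
  case empty
  show ?case by (rule exI[where x = "\<lambda>i. i"]) (simp add: strict_mono_def)
next
  case (insert k S)
  then obtain f :: "nat \<Rightarrow> nat" where f: "strict_mono f" "\<forall>k\<in>S. \<forall>i j. i \<le> j \<longrightarrow> s (f i) k \<le> s (f j) k"
    by blast
  obtain g :: "nat \<Rightarrow> nat" where g: "strict_mono g" "\<And>i j. i \<le> j \<Longrightarrow> s (f (g i)) k \<le> s (f (g j)) k"
    using nat_seq_incseq_subseq[of "\<lambda>i. s (f i) k"] by blast
  have "strict_mono (f \<circ> g)" using f(1) g(1) by (simp add: strict_mono_def comp_def)
  moreover have "i \<le> j \<Longrightarrow> g i \<le> g j" for i j
    using g(1) by (simp add: strict_mono_less_eq)
  ultimately show ?case using f(2) g(2) by (intro exI[of _ "f \<circ> g"]) (auto simp: comp_def)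
qed

text \<open>If no finite set worked, dependent choice would give a sequence in which no term
  dominates an earlier one, against \<open>dickson_seq\<close>. The weight \<open>w\<close> on an
  arbitrary type lets the same lemma serve for exponents and for the triples of the Artin--Rees
  argument.\<close>

lemma dickson_finite_basis:
  fixes w :: "'x \<Rightarrow> 'k \<Rightarrow> nat"
  assumes S: "finite S"
  obtains B where "finite B" "B \<subseteq> L" "\<And>x. x \<in> L \<Longrightarrow> \<exists>b\<in>B. \<forall>k\<in>S. w b k \<le> w x k"
proof -
  have "\<exists>B. finite B \<and> B \<subseteq> L \<and> (\<forall>x\<in>L. \<exists>b\<in>B. \<forall>k\<in>S. w b k \<le> w x k)"
  proof (rule ccontr)
    assume no: "\<nexists>B. finite B \<and> B \<subseteq> L \<and> (\<forall>x\<in>L. \<exists>b\<in>B. \<forall>k\<in>S. w b k \<le> w x k)"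
    let ?P = "\<lambda>f n r. r \<in> L \<and> (\<forall>m<n. \<not> (\<forall>k\<in>S. w (f m) k \<le> w r k))"
    have "\<exists>f. \<forall>n::nat. ?P f n (f n)"
    proof (rule dependent_wf_choice[of less_than ?P, OF wf_less_than])
      fix f g :: "nat \<Rightarrow> 'x" and n r
      assume "\<And>z. (z, n) \<in> less_than \<Longrightarrow> f z = g z"
      then show "?P f n r = ?P g n r" by simp
    next
      fix n :: nat and f :: "nat \<Rightarrow> 'x"
      assume "\<And>y. (y, n) \<in> less_than \<Longrightarrow> ?P f y (f y)"
      then have "finite (f ` {..<n}) \<and> f ` {..<n} \<subseteq> L" by auto
      with no have "\<not> (\<forall>x\<in>L. \<exists>b\<in>f ` {..<n}. \<forall>k\<in>S. w b k \<le> w x k)" by blast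
      then show "\<exists>r. ?P f n r" by auto
    qed
    then obtain f :: "nat \<Rightarrow> 'x" where f: "\<And>n. ?P f n (f n)" by blast
    obtain g :: "nat \<Rightarrow> nat" where g: "strict_mono g" "\<forall>k\<in>S. \<forall>i j. i \<le> j \<longrightarrow> w (f (g i)) k \<le> w (f (g j)) k"
      using dickson_seq[OF S, of "\<lambda>i. w (f i)"] by blast
    have "g 0 < g 1" using g(1) by (simp add: strict_mono_def)
    with f[of "g 1"] g(2) show False by auto
  qed
  then show ?thesis using that by blast
qed


subsection \<open>The order on exponents\<close>

lemma tdeg_zero [simp]: "tdeg 0 = 0"
  by (simp add: tdeg_def)

lemma tdeg_single [simp]: "tdeg (Poly_Mapping.single k m) = m"
  by (simp add: tdeg_def)

lemma lookup_le_tdeg: "Poly_Mapping.lookup \<alpha> k \<le> tdeg \<alpha>"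
  unfolding tdeg_def
  by (cases "k \<in> Poly_Mapping.keys \<alpha>") (auto intro: member_le_sum simp: in_keys_iff)

lemma tdeg_eq_0_iff: "tdeg \<alpha> = 0 \<longleftrightarrow> \<alpha> = 0"
proof
  assume "tdeg \<alpha> = 0"
  then show "\<alpha> = 0" using lookup_le_tdeg[of \<alpha>] by (intro poly_mapping_eqI) simp
qed simp

lemma zero_in_expos [simp]: "0 \<in> expos V"
  by (simp add: expos_def)

lemma single_in_expos: "k \<in> V \<Longrightarrow> Poly_Mapping.single k m \<in> expos V"
  by (simp add: expos_def)

lemma expos_mono: "V \<subseteq> W \<Longrightarrow> expos V \<subseteq> expos W"
  by (auto simp: expos_def)

lemma expo_le_iff:
  fixes \<alpha> \<beta> :: expo
  assumes "\<beta> \<in> expos V"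
  shows "(\<exists>\<gamma>\<in>expos V. \<beta> = \<alpha> + \<gamma>) \<longleftrightarrow> (\<forall>k. Poly_Mapping.lookup \<alpha> k \<le> Poly_Mapping.lookup \<beta> k)"
proof
  assume le: "\<forall>k. Poly_Mapping.lookup \<alpha> k \<le> Poly_Mapping.lookup \<beta> k"
  have "\<beta> = \<alpha> + (\<beta> - \<alpha>)"
    using le by (intro poly_mapping_eqI) (simp add: lookup_add lookup_minus)
  then show "\<exists>\<gamma>\<in>expos V. \<beta> = \<alpha> + \<gamma>" using assms by (metis expos_add_iff)
qed (auto simp: lookup_add)

lemma expo_le_iff_fin:
  fixes \<alpha> \<beta> :: expo
  assumes "\<alpha> \<in> expos V" "\<beta> \<in> expos V"
  shows "(\<exists>\<gamma>\<in>expos V. \<beta> = \<alpha> + \<gamma>) \<longleftrightarrow> (\<forall>k\<in>V. Poly_Mapping.lookup \<alpha> k \<le> Poly_Mapping.lookup \<beta> k)"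
proof -
  have "Poly_Mapping.lookup \<alpha> k = 0" if "k \<notin> V" for k
    using assms(1) that by (auto simp: expos_def in_keys_iff subset_iff)
  then show ?thesis unfolding expo_le_iff[OF assms(2)] by (metis le0)
qed

lemma finite_expos_tdeg:
  assumes "finite V"
  shows "finite {\<alpha> \<in> expos V. tdeg \<alpha> \<le> d}"
proof -
  let ?S = "{\<alpha> \<in> expos V. tdeg \<alpha> \<le> d}"
  let ?f = "\<lambda>\<beta>. restrict (Poly_Mapping.lookup \<beta>) V"
  have "?f ` ?S \<subseteq> PiE V (\<lambda>k. {..d})"
    using lookup_le_tdeg order_trans by fastforce
  then have fin: "finite (?f ` ?S)"
    by (rule finite_subset) (intro finite_PiE; simp add: assms)
  have "inj_on ?f ?S"
  proof (rule inj_onI)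
    fix \<beta> \<gamma> :: expo assume b: "\<beta> \<in> ?S" and g: "\<gamma> \<in> ?S" and eq: "?f \<beta> = ?f \<gamma>"
    have "Poly_Mapping.lookup \<beta> k = Poly_Mapping.lookup \<gamma> k" for k
    proof (cases "k \<in> V")
      case True
      then show ?thesis using fun_cong[OF eq, of k] by simp
    next
      case False
      then have "k \<notin> Poly_Mapping.keys \<beta>" "k \<notin> Poly_Mapping.keys \<gamma>"
        using b g by (auto simp: expos_def)
      then show ?thesis by (simp add: in_keys_iff)
    qed
    then show "\<beta> = \<gamma>" by (intro poly_mapping_eqI) simp
  qed
  then show ?thesis using fin by (rule finite_imageD[rotated])
qed

lemma expo_less_irrefl [simp]: "\<not> expo_less \<alpha> \<alpha>"
  by (simp add: expo_less_def)

lemma expo_less_trans: "expo_less \<alpha> \<beta> \<Longrightarrow> expo_less \<beta> \<gamma> \<Longrightarrow> expo_less \<alpha> \<gamma>"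
  by (auto simp: expo_less_def)

lemma expo_less_linear: "expo_less \<alpha> \<beta> \<or> \<alpha> = \<beta> \<or> expo_less \<beta> \<alpha>"
  by (auto simp: expo_less_def)

lemma expo_less_tdeg: "expo_less \<alpha> \<beta> \<Longrightarrow> tdeg \<alpha> \<le> tdeg \<beta>"
  by (auto simp: expo_less_def)

lemma expo_less_add_left: "expo_less \<alpha> \<beta> \<Longrightarrow> expo_less (\<gamma> + \<alpha>) (\<gamma> + \<beta>)"
  by (auto simp: expo_less_def tdeg_add)

lemma expo_less_add_pos:
  assumes "\<gamma> \<noteq> 0"
  shows "expo_less \<beta> (\<beta> + \<gamma>)"
proof -
  have "tdeg \<gamma> > 0" using assms by (metis tdeg_eq_0_iff gr0I)
  then show ?thesis by (simp add: expo_less_def tdeg_add)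
qed

lemma finite_expo_less: "finite V \<Longrightarrow> finite {\<beta> \<in> expos V. expo_less \<beta> \<alpha>}"
  by (rule finite_subset[OF _ finite_expos_tdeg[of V "tdeg \<alpha>"]]) (auto dest: expo_less_tdeg)

text \<open>Total degree is compared first, so only finitely many exponents precede a given one and
  the order on \<open>expos V\<close> embeds into the naturals. Minima, inductions and the greedy
  construction of a diagram all run along this rank.\<close>

definition expo_rank :: "nat set \<Rightarrow> expo \<Rightarrow> nat"
  where "expo_rank V \<alpha> = card {\<beta> \<in> expos V. expo_less \<beta> \<alpha>}"

lemma expo_rank_less:
  assumes "finite V" "\<alpha> \<in> expos V" "expo_less \<alpha> \<beta>"
  shows "expo_rank V \<alpha> < expo_rank V \<beta>"
  unfolding expo_rank_def
proof (rule psubset_card_mono)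
  have "\<alpha> \<in> {\<gamma> \<in> expos V. expo_less \<gamma> \<beta>} - {\<gamma> \<in> expos V. expo_less \<gamma> \<alpha>}"
    using assms by simp
  moreover have "{\<gamma> \<in> expos V. expo_less \<gamma> \<alpha>} \<subseteq> {\<gamma> \<in> expos V. expo_less \<gamma> \<beta>}"
    using assms(3) expo_less_trans by blast
  ultimately show "{\<gamma> \<in> expos V. expo_less \<gamma> \<alpha>} \<subset> {\<gamma> \<in> expos V. expo_less \<gamma> \<beta>}"
    by blast
qed (use assms(1) in \<open>rule finite_expo_less\<close>)

lemma expo_rank_less_iff:
  assumes "finite V" "\<alpha> \<in> expos V" "\<beta> \<in> expos V"
  shows "expo_rank V \<alpha> < expo_rank V \<beta> \<longleftrightarrow> expo_less \<alpha> \<beta>"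
  using expo_rank_less assms expo_less_linear by (metis less_asym less_irrefl)

lemma expo_rank_inj:
  assumes "finite V" "\<alpha> \<in> expos V" "\<beta> \<in> expos V" "expo_rank V \<alpha> = expo_rank V \<beta>"
  shows "\<alpha> = \<beta>"
  using assms expo_rank_less_iff expo_less_linear by (metis less_irrefl)

lemma ex_expo_min:
  assumes "D \<subseteq> expos V" "finite V" "D \<noteq> {}"
  obtains \<alpha> where "\<alpha> \<in> D" "\<And>\<beta>. \<beta> \<in> D \<Longrightarrow> \<beta> = \<alpha> \<or> expo_less \<alpha> \<beta>"
proof -
  obtain \<alpha> where a: "\<alpha> \<in> D" "\<And>\<beta>. \<beta> \<in> D \<Longrightarrow> expo_rank V \<alpha> \<le> expo_rank V \<beta>"
    using ex_has_least_nat[of "\<lambda>\<alpha>. \<alpha> \<in> D" _ "expo_rank V"] assms(3) by blast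
  show ?thesis
  proof (rule that[OF a(1)])
    fix \<beta> assume "\<beta> \<in> D"
    then show "\<beta> = \<alpha> \<or> expo_less \<alpha> \<beta>"
      using a assms expo_less_linear[of \<alpha> \<beta>] expo_rank_less[of V \<beta> \<alpha>] by fastforce
  qed
qed

lemma ex_expo_max:
  assumes "D \<subseteq> expos V" "finite V" "finite D" "D \<noteq> {}"
  obtains \<alpha> where "\<alpha> \<in> D" "\<And>\<beta>. \<beta> \<in> D \<Longrightarrow> \<beta> = \<alpha> \<or> expo_less \<beta> \<alpha>"
proof -
  obtain \<alpha> where a: "\<alpha> \<in> D" "\<And>\<beta>. \<beta> \<in> D \<Longrightarrow> expo_rank V \<beta> \<le> expo_rank V \<alpha>"
    using Max_in[of "expo_rank V ` D"] Max_ge[of "expo_rank V ` D"] assms(3,4)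
    by (metis (no_types, lifting) finite_imageI imageE image_eqI image_is_empty)
  show ?thesis
  proof (rule that[OF a(1)])
    fix \<beta> assume "\<beta> \<in> D"
    then show "\<beta> = \<alpha> \<or> expo_less \<beta> \<alpha>"
      using a assms expo_less_linear[of \<alpha> \<beta>] expo_rank_less[of V \<alpha> \<beta>] by fastforce
  qed
qed


subsection \<open>Diagrams\<close>

definition up_closed :: "nat set \<Rightarrow> expo set \<Rightarrow> bool"
  where "up_closed V N \<longleftrightarrow> N \<subseteq> expos V \<and> (\<forall>\<alpha>\<in>N. \<forall>\<gamma>\<in>expos V. \<alpha> + \<gamma> \<in> N)"

definition first_diff_less :: "expo set \<Rightarrow> expo set \<Rightarrow> bool"
  where "first_diff_less N M \<longleftrightarrow>
    (\<exists>\<alpha>. \<alpha> \<in> N \<and> \<alpha> \<notin> M \<and> (\<forall>\<beta>. expo_less \<beta> \<alpha> \<longrightarrow> (\<beta> \<in> N \<longleftrightarrow> \<beta> \<in> M)))"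

lemma first_diff_linear:
  assumes "N \<subseteq> expos V" "M \<subseteq> expos V" "finite V" "N \<noteq> M"
  shows "first_diff_less N M \<or> first_diff_less M N"
proof -
  have "(N - M) \<union> (M - N) \<noteq> {}" "(N - M) \<union> (M - N) \<subseteq> expos V" using assms by auto
  then obtain \<alpha> where a: "\<alpha> \<in> (N - M) \<union> (M - N)"
    "\<And>\<beta>. \<beta> \<in> (N - M) \<union> (M - N) \<Longrightarrow> \<beta> = \<alpha> \<or> expo_less \<alpha> \<beta>"
    using ex_expo_min[of _ V] assms(3) by metis
  have "\<beta> \<in> N \<longleftrightarrow> \<beta> \<in> M" if "expo_less \<beta> \<alpha>" for \<beta>
    using a(2)[of \<beta>] that expo_less_trans expo_less_irrefl by blast
  then show ?thesis using a(1) unfolding first_diff_less_def by blast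
qed

section \<open>Vertices, and the order by vertex sequences\<close>

definition min_expos :: "nat set \<Rightarrow> expo set \<Rightarrow> expo set"
  where "min_expos V N = {\<alpha> \<in> N. \<forall>\<beta>\<in>N. \<forall>\<gamma>\<in>expos V. \<alpha> = \<beta> + \<gamma> \<longrightarrow> \<beta> = \<alpha>}"

lemma up_closed_generated:
  assumes "up_closed V N" "\<alpha> \<in> N"
  shows "\<exists>\<beta>\<in>min_expos V N. \<exists>\<gamma>\<in>expos V. \<alpha> = \<beta> + \<gamma>"
  using assms(2)
proof (induction "tdeg \<alpha>" arbitrary: \<alpha> rule: less_induct)
  case less
  show ?case
  proof (cases "\<alpha> \<in> min_expos V N")
    case True
    then show ?thesis by (intro bexI[of _ \<alpha>] bexI[of _ 0]) auto
  next
    case False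
    then obtain \<beta> \<gamma> where b: "\<beta> \<in> N" "\<gamma> \<in> expos V" "\<alpha> = \<beta> + \<gamma>" "\<beta> \<noteq> \<alpha>"
      using less.prems unfolding min_expos_def by blast
    then have "\<gamma> \<noteq> 0" by auto
    then have "tdeg \<gamma> > 0" by (metis tdeg_eq_0_iff gr0I)
    then have "tdeg \<beta> < tdeg \<alpha>" using b by (simp add: tdeg_add)
    from less.hyps[OF this b(1)] obtain \<beta>' \<gamma>' where "\<beta>' \<in> min_expos V N" "\<gamma>' \<in> expos V" "\<beta> = \<beta>' + \<gamma>'"
      by blast
    then show ?thesis using b by (intro bexI[of _ \<beta>'] bexI[of _ "\<gamma>' + \<gamma>"]) (auto simp: expos_add_iff add.assoc)
  qed
qed

text \<open>Minimal exponents are pairwise incomparable for divisibility, so a Dickson basis of this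
  set is the whole set.\<close>

lemma finite_min_expos:
  assumes "up_closed V N" "finite V"
  shows "finite (min_expos V N)"
proof -
  obtain B where B: "finite B" "B \<subseteq> min_expos V N"
    "\<And>x. x \<in> min_expos V N \<Longrightarrow> \<exists>b\<in>B. \<forall>k\<in>V. Poly_Mapping.lookup b k \<le> Poly_Mapping.lookup x k"
    using dickson_finite_basis[OF assms(2), of "min_expos V N" Poly_Mapping.lookup] by blast
  have "min_expos V N \<subseteq> B"
  proof
    fix \<alpha> assume a: "\<alpha> \<in> min_expos V N"
    with B(3) obtain b where b: "b \<in> B" "\<forall>k\<in>V. Poly_Mapping.lookup b k \<le> Poly_Mapping.lookup \<alpha> k" by blast
    have "b \<in> N" "\<alpha> \<in> N" using a b B(2) unfolding min_expos_def by auto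
    moreover then have "b \<in> expos V" "\<alpha> \<in> expos V" using assms(1) by (auto simp: up_closed_def)
    ultimately have "b = \<alpha>" using a expo_le_iff_fin[of b V \<alpha>] b(2) unfolding min_expos_def by blast
    then show "\<alpha> \<in> B" using b by simp
  qed
  then show ?thesis using B(1) finite_subset by blast
qed

text \<open>The \<open>LEAST\<close> refers to inclusion. A minimal exponent written as
  \<open>b + \<gamma>\<close> with \<open>b\<close> from a generating set equals \<open>b\<close>,
  so the minimal exponents lie in every generating set, and they generate by
  \<open>up_closed_generated\<close>.\<close>

lemma vertices_eq_min_expos:
  assumes "up_closed {0..n} N"
  shows "vertices n N = min_expos {0..n} N"
  unfolding vertices_def
proof (rule Least_equality)
  let ?V = "{0..n}"
  show "finite (min_expos ?V N) \<and>
    N = (\<Union>\<beta>\<in>min_expos ?V N. {\<beta> + \<gamma> |\<gamma>. \<gamma> \<in> expos ?V})"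
    using finite_min_expos[OF assms] up_closed_generated[OF assms] assms
    by (auto simp: up_closed_def min_expos_def) blast
  fix B assume B: "finite B \<and> N = (\<Union>\<beta>\<in>B. {\<beta> + \<gamma> |\<gamma>. \<gamma> \<in> expos ?V})"
  show "min_expos ?V N \<subseteq> B"
  proof
    fix \<alpha> assume a: "\<alpha> \<in> min_expos ?V N"
    then have "\<alpha> \<in> N" by (simp add: min_expos_def)
    then obtain b \<gamma> where b: "b \<in> B" "\<gamma> \<in> expos ?V" "\<alpha> = b + \<gamma>" using B by auto
    have "b + 0 \<in> N" using B b(1) zero_in_expos by blast
    then have "b = \<alpha>" using a b unfolding min_expos_def by auto
    then show "\<alpha> \<in> B" using b by simp
  qed
qed

lemma sorted_wrt_expo_unique:
  assumes "sorted_wrt expo_less xs" "sorted_wrt expo_less ys" "set xs = set ys"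
  shows "xs = ys"
  using assms
proof (induction xs arbitrary: ys)
  case (Cons x xs)
  then obtain y ys' where ys: "ys = y # ys'" by (cases ys) auto
  have "x = y"
  proof (rule ccontr)
    assume "x \<noteq> y"
    moreover have "x \<in> set (y # ys')" "y \<in> set (x # xs)" using Cons.prems(3) unfolding ys by auto
    ultimately have "expo_less y x" "expo_less x y" using Cons.prems(1,2) unfolding ys by auto
    then show False using expo_less_trans expo_less_irrefl by blast
  qed
  moreover have "x \<notin> set xs" "y \<notin> set ys'" using Cons.prems unfolding ys by auto
  then have "set xs = set ys'" using Cons.prems(3) \<open>x = y\<close> unfolding ys by auto
  ultimately show ?case using Cons unfolding ys by simp
qed simp

lemma ex_sorted_wrt_expo:
  assumes "finite B"
  shows "\<exists>xs. sorted_wrt expo_less xs \<and> set xs = B"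
proof -
  have V: "B \<subseteq> expos (\<Union>(Poly_Mapping.keys ` B))" "finite (\<Union>(Poly_Mapping.keys ` B))"
    using assms by (auto simp: expos_def)
  define V where "V = \<Union>(Poly_Mapping.keys ` B)"
  have BV: "B \<subseteq> expos V" "finite V" using V by (auto simp: V_def)
  have "\<exists>xs. sorted_wrt expo_less xs \<and> set xs = B" using assms BV(1)
  proof (induction B rule: finite_psubset_induct)
    case (psubset B)
    show ?case
    proof (cases "B = {}")
      case False
      then obtain \<alpha> where a: "\<alpha> \<in> B" "\<And>\<beta>. \<beta> \<in> B \<Longrightarrow> \<beta> = \<alpha> \<or> expo_less \<alpha> \<beta>"
        using ex_expo_min[OF psubset.prems BV(2)] by blast
      then have "B - {\<alpha>} \<subset> B" by auto
      from psubset.IH[OF this] psubset.prems obtain xs where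
        "sorted_wrt expo_less xs" "set xs = B - {\<alpha>}" by blast
      then show ?thesis using a by (intro exI[of _ "\<alpha> # xs"]) auto
    qed auto
  qed
  then show ?thesis .
qed

lemma vertex_list_props:
  assumes "up_closed {0..n} N"
  shows "sorted_wrt expo_less (vertex_list n N)" "set (vertex_list n N) = min_expos {0..n} N"
proof -
  have "\<exists>!bs. sorted_wrt expo_less bs \<and> set bs = vertices n N"
    using ex_sorted_wrt_expo[of "vertices n N"] finite_min_expos[OF assms] sorted_wrt_expo_unique
    unfolding vertices_eq_min_expos[OF assms] by fastforce
  from theI'[OF this] show "sorted_wrt expo_less (vertex_list n N)"
    "set (vertex_list n N) = min_expos {0..n} N"
    unfolding vertex_list_def vertices_eq_min_expos[OF assms] by auto
qed

lemma sorted_wrt_expo_filter: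
  assumes "sorted_wrt expo_less xs"
  shows "xs = filter (\<lambda>x. expo_less x \<alpha>) xs @ filter (\<lambda>x. \<not> expo_less x \<alpha>) xs"
  using assms
proof (induction xs)
  case (Cons x xs)
  show ?case
  proof (cases "expo_less x \<alpha>")
    case False
    then have "\<forall>y\<in>set xs. \<not> expo_less y \<alpha>"
      using Cons.prems expo_less_trans by auto
    then show ?thesis using False by (auto simp: filter_empty_conv intro!: filter_True[symmetric])
  qed (use Cons in auto)
qed simp

text \<open>Proper divisors of an exponent precede it in the order. So being minimal is decided by
  the part of the diagram below the exponent, where \<open>M\<close> and \<open>N\<close>
  agree.\<close>

lemma min_expos_below:
  assumes "up_closed V M" "up_closed V N"
    and "\<And>\<beta>. expo_less \<beta> \<alpha> \<Longrightarrow> \<beta> \<in> N \<longleftrightarrow> \<beta> \<in> M" "\<beta> = \<alpha> \<or> expo_less \<beta> \<alpha>" "\<beta> \<in> min_expos V M" "\<beta> \<in> N"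
  shows "\<beta> \<in> min_expos V N"
proof -
  have "\<beta>' = \<beta>" if "\<beta>' \<in> N" "\<gamma> \<in> expos V" "\<beta> = \<beta>' + \<gamma>" for \<beta>' \<gamma>
  proof (cases "\<gamma> = 0")
    case False
    then have "expo_less \<beta>' \<beta>" using that by (simp add: expo_less_add_pos)
    then have "\<beta>' \<in> M" using assms(3,4) that(1) expo_less_trans by blast
    then show ?thesis using assms(5) that unfolding min_expos_def by blast
  qed (use that in simp)
  then show ?thesis using assms(6) unfolding min_expos_def by blast
qed

text \<open>Let \<open>\<alpha>\<close> be the first exponent where the diagrams differ. Vertices
  before \<open>\<alpha>\<close> are common to both. A proper divisor of \<open>\<alpha>\<close> in
  \<open>N\<close> would lie in \<open>M\<close> and force \<open>\<alpha>\<close> into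
  \<open>M\<close>, so \<open>\<alpha>\<close> is the next vertex of \<open>N\<close>. The next
  entry for \<open>M\<close> is a later exponent, or \<open>None\<close> if its vertices are
  exhausted.\<close>

lemma diagram_less_first_diff:
  assumes N: "up_closed {0..n} N" and M: "up_closed {0..n} M" and "first_diff_less N M"
  shows "diagram_less n N M"
proof -
  let ?V = "{0..n}"
  obtain \<alpha> where a: "\<alpha> \<in> N" "\<alpha> \<notin> M" "\<And>\<beta>. expo_less \<beta> \<alpha> \<Longrightarrow> \<beta> \<in> N \<longleftrightarrow> \<beta> \<in> M"
    using assms(3) unfolding first_diff_less_def by blast
  let ?bs = "vertex_list n N" and ?cs = "vertex_list n M"
  let ?f = "filter (\<lambda>x. expo_less x \<alpha>)" and ?g = "filter (\<lambda>x. \<not> expo_less x \<alpha>)"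
  note b = vertex_list_props[OF N] and c = vertex_list_props[OF M]
  have "set (?f ?bs) = set (?f ?cs)"
  proof -
    have "\<beta> \<in> min_expos ?V N \<longleftrightarrow> \<beta> \<in> min_expos ?V M" if l: "expo_less \<beta> \<alpha>" for \<beta>
    proof
      assume m: "\<beta> \<in> min_expos ?V N"
      then have "\<beta> \<in> M" using a(3)[OF l] by (simp add: min_expos_def)
      then show "\<beta> \<in> min_expos ?V M"
        using min_expos_below[OF N M _ _ m, of \<alpha>] a(3) l by blast
    next
      assume m: "\<beta> \<in> min_expos ?V M"
      then have "\<beta> \<in> N" using a(3)[OF l] by (simp add: min_expos_def)
      then show "\<beta> \<in> min_expos ?V N"
        using min_expos_below[OF M N _ _ m, of \<alpha>] a(3) l by blast
    qed
    then show ?thesis unfolding set_filter b(2) c(2) by blast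
  qed
  then have f: "?f ?bs = ?f ?cs"
    by (intro sorted_wrt_expo_unique sorted_wrt_filter b c)
  have "\<alpha> \<in> min_expos ?V N"
  proof -
    have "\<beta> = \<alpha>" if "\<beta> \<in> N" "\<gamma> \<in> expos ?V" "\<alpha> = \<beta> + \<gamma>" for \<beta> \<gamma>
    proof (cases "\<gamma> = 0")
      case False
      then have "expo_less \<beta> \<alpha>" using that by (simp add: expo_less_add_pos)
      then have "\<beta> \<in> M" using a(3) that(1) by blast
      then show ?thesis using a(2) M that unfolding up_closed_def by blast
    qed (use that in simp)
    then show ?thesis using a(1) unfolding min_expos_def by blast
  qed
  then have mem: "\<alpha> \<in> set (?g ?bs)" using b by simp
  have srt: "sorted_wrt expo_less (?g ?bs)" using b(1) by (rule sorted_wrt_filter)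
  then obtain rest where rest: "?g ?bs = \<alpha> # rest"
  proof (cases "?g ?bs")
    case (Cons x xs)
    have "x \<in> set (?g ?bs)" unfolding Cons by simp
    then have "\<not> expo_less x \<alpha>" by simp
    moreover have "\<alpha> = x \<or> expo_less x \<alpha>" using mem srt unfolding Cons by auto
    ultimately show ?thesis using that Cons by blast
  qed (use mem in simp)
  let ?k = "length (?f ?bs)"
  have bs: "?bs = ?f ?bs @ \<alpha> # rest"
    using sorted_wrt_expo_filter[OF b(1), of \<alpha>] unfolding rest .
  have cs: "?cs = ?f ?bs @ ?g ?cs"
    using sorted_wrt_expo_filter[OF c(1), of \<alpha>] unfolding f .
  have eq: "vertex_seq n N j = vertex_seq n M j" if "j < ?k" for j
  proof -
    have "length ?bs > j" by (subst bs) (use that in simp)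
    moreover have "length ?cs > j" by (subst cs) (use that in simp)
    moreover have "?bs ! j = ?cs ! j"
      using that by (subst bs, subst cs) (simp add: nth_append)
    ultimately show ?thesis by (simp add: vertex_seq_def)
  qed
  have "length ?bs > ?k" by (subst bs) simp
  moreover have "?bs ! ?k = \<alpha>" by (subst (1) bs) simp
  ultimately have vN: "vertex_seq n N ?k = Some \<alpha>" by (simp add: vertex_seq_def)
  have "ext_expo_less (vertex_seq n N ?k) (vertex_seq n M ?k)"
  proof (cases "?k < length ?cs")
    case True
    then have "?g ?cs \<noteq> []" using cs by (metis append_Nil2 less_irrefl)
    then have "?g ?cs ! 0 \<in> set (?g ?cs)" by (intro nth_mem) simp
    moreover have "?cs ! ?k = ?g ?cs ! 0" by (subst (1) cs) (simp add: nth_append)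
    ultimately have mem: "?cs ! ?k \<in> set (?g ?cs)" by metis
    then have "?cs ! ?k \<in> M" using c(2) by (auto simp: min_expos_def)
    then have "?cs ! ?k \<noteq> \<alpha>" using a by metis
    then have "expo_less \<alpha> (?cs ! ?k)" using mem expo_less_linear[of \<alpha> "?cs ! ?k"] by auto
    then show ?thesis using True unfolding vN by (simp add: vertex_seq_def)
  next
    case False
    then show ?thesis unfolding vN by (simp add: vertex_seq_def)
  qed
  then show ?thesis using eq unfolding diagram_less_def by blast
qed

text \<open>The minimum is built greedily along the exponents, and the Dickson basis of the result shows
  that it is attained after finitely many steps.\<close>

lemma ex_min_diagram:
  assumes V: "finite V" and D: "\<And>N. N \<in> \<D> \<Longrightarrow> up_closed V N" "\<D> \<noteq> {}"
  shows "\<exists>N\<in>\<D>. \<forall>M\<in>\<D>. M \<noteq> N \<longrightarrow> first_diff_less N M"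
proof -
  define has where "has r N \<longleftrightarrow> (\<exists>\<alpha>\<in>N. expo_rank V \<alpha> = r)" for r and N :: "expo set"
  \<comment> \<open>\<open>C r\<close> holds the diagrams that survive after the exponents of rank
    below \<open>r\<close> have been decided: each time, an exponent is required as soon as some
    survivor contains it. The set \<open>L\<close> below collects the exponents accepted in this
    way, and survivors agree with \<open>L\<close> on all ranks already decided.\<close>
  define C where "C = rec_nat \<D> (\<lambda>r C. if \<exists>N\<in>C. has r N then {N \<in> C. has r N} else C)"
  have C0: "C 0 = \<D>" and CS: "C (Suc r) = (if \<exists>N\<in>C r. has r N then {N \<in> C r. has r N} else C r)" for r
    by (simp_all add: C_def)
  have sub: "C (Suc r) \<subseteq> C r" for r by (auto simp: CS)
  have anti: "C s \<subseteq> C r" if "r \<le> s" for r s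
    using that by (rule lift_Suc_antimono_le[of C, OF sub])
  have ne: "C r \<noteq> {}" for r
  proof (induction r)
    case 0
    show ?case using D(2) by (simp add: C0)
  next
    case (Suc r)
    then show ?case by (auto simp: CS)
  qed
  have CD: "C r \<subseteq> \<D>" for r using anti[of 0 r] by (simp add: C0)
  have Csub: "N \<in> C r \<Longrightarrow> N \<subseteq> expos V" for N r using CD D(1) by (fastforce simp: up_closed_def)
  define L where "L = {\<alpha> \<in> expos V. \<exists>N\<in>C (expo_rank V \<alpha>). \<alpha> \<in> N}"
  have agree: "\<alpha> \<in> N \<longleftrightarrow> \<alpha> \<in> L" if "N \<in> C r" "\<alpha> \<in> expos V" "expo_rank V \<alpha> < r" for N r \<alpha>
  proof -
    let ?s = "expo_rank V \<alpha>"
    have N: "N \<in> C (Suc ?s)" "N \<in> C ?s" using that anti[of "Suc ?s" r] anti[of ?s r] by auto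
    have has: "has ?s M \<longleftrightarrow> \<alpha> \<in> M" if "M \<in> C ?s" for M
      using expo_rank_inj[OF V] Csub[OF that] \<open>\<alpha> \<in> expos V\<close> unfolding has_def by blast
    show ?thesis using N has that(2) unfolding L_def CS by (auto split: if_splits)
  qed
  have "up_closed V L" unfolding up_closed_def
  proof (intro conjI ballI)
    fix \<alpha> \<gamma> assume a: "\<alpha> \<in> L" "\<gamma> \<in> expos V"
    let ?r = "Suc (max (expo_rank V \<alpha>) (expo_rank V (\<alpha> + \<gamma>)))"
    obtain N where N: "N \<in> C ?r" using ne by blast
    have aV: "\<alpha> \<in> expos V" "\<alpha> + \<gamma> \<in> expos V" using a by (auto simp: L_def expos_add_iff)
    have "\<alpha> \<in> N" using agree[OF N aV(1)] a by simp
    then have "\<alpha> + \<gamma> \<in> N" using D(1) CD N a(2) unfolding up_closed_def by blast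
    then show "\<alpha> + \<gamma> \<in> L" using agree[OF N aV(2)] by simp
  qed (auto simp: L_def)
  note upL = this
  \<comment> \<open>Past the ranks of all vertices of \<open>L\<close>, so every survivor contains
    the vertices of \<open>L\<close> and hence \<open>L\<close> itself.\<close>
  define r where "r = Suc (Max (insert 0 (expo_rank V ` min_expos V L)))"
  have fin: "finite (insert 0 (expo_rank V ` min_expos V L))"
    using finite_min_expos[OF upL V] by simp
  obtain N where N: "N \<in> C r" using ne by blast
  have "L \<subseteq> N"
  proof
    fix \<alpha> assume "\<alpha> \<in> L"
    then obtain \<beta> \<gamma> where b: "\<beta> \<in> min_expos V L" "\<gamma> \<in> expos V" "\<alpha> = \<beta> + \<gamma>"
      using up_closed_generated[OF upL] by blast
    then have "expo_rank V \<beta> < r" using fin unfolding r_def by (intro le_imp_less_Suc Max_ge) auto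
    moreover have "\<beta> \<in> L" using b(1) by (simp add: min_expos_def)
    ultimately have "\<beta> \<in> N" using agree[OF N, of \<beta>] by (auto simp: L_def)
    then show "\<alpha> \<in> N" using D(1) CD N b unfolding up_closed_def by blast
  qed
  have greater: "first_diff_less L M" if "M \<in> \<D>" "M \<noteq> L" for M
  proof (rule ccontr)
    assume "\<not> first_diff_less L M"
    then have "first_diff_less M L"
      using first_diff_linear[of M V L] V that D(1) upL by (auto simp: up_closed_def)
    then obtain \<alpha> where a: "\<alpha> \<in> M" "\<alpha> \<notin> L" "\<And>\<beta>. expo_less \<beta> \<alpha> \<Longrightarrow> \<beta> \<in> M \<longleftrightarrow> \<beta> \<in> L"
      unfolding first_diff_less_def by blast
    have aV: "\<alpha> \<in> expos V" using a D(1)[OF that(1)] by (auto simp: up_closed_def)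
    \<comment> \<open>\<open>M\<close> agrees with \<open>L\<close> before \<open>\<alpha>\<close>,
      so it meets every requirement imposed up to the rank of \<open>\<alpha>\<close>. Being a
      survivor that contains \<open>\<alpha>\<close>, it would have put \<open>\<alpha>\<close> into
      \<open>L\<close>.\<close>
    have "M \<in> C s" if "s \<le> expo_rank V \<alpha>" for s
      using that
    proof (induction s)
      case 0
      then show ?case using \<open>M \<in> \<D>\<close> by (simp add: C0)
    next
      case (Suc s)
      then have M: "M \<in> C s" by simp
      show ?case
      proof (cases "\<exists>N\<in>C s. has s N")
        case True
        then obtain N \<beta> where b: "N \<in> C s" "\<beta> \<in> N" "expo_rank V \<beta> = s" unfolding has_def by blast
        have bV: "\<beta> \<in> expos V" using Csub b by blast
        then have "\<beta> \<in> L" using b by (auto simp: L_def)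
        moreover have "expo_less \<beta> \<alpha>" using Suc.prems b bV aV expo_rank_less_iff[OF V bV aV] by simp
        ultimately have "has s M" using a(3) b unfolding has_def by blast
        then show ?thesis using M True by (simp add: CS)
      qed (use M in \<open>simp add: CS\<close>)
    qed
    then have "\<alpha> \<in> L" using a(1) aV by (auto simp: L_def)
    then show False using a by simp
  qed
  have "N = L"
  proof (rule ccontr)
    assume "N \<noteq> L"
    then obtain \<alpha> where "\<alpha> \<in> L" "\<alpha> \<notin> N"
      using greater[of N] CD N unfolding first_diff_less_def by blast
    then show False using \<open>L \<subseteq> N\<close> by blast
  qed
  then show ?thesis using N CD greater by blast
qed


subsection \<open>Monomials, orders and initial exponents\<close>

lemma coeff_MSeries [simp]: "coeff (MSeries f) = f"
  by (simp add: MSeries_inverse)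

lemma coeff_minus [simp]: "coeff (f - g) \<alpha> = coeff f \<alpha> - coeff g \<alpha>"
  by transfer simp

lemma coeff_sum [simp]: "coeff (sum f A) \<alpha> = (\<Sum>x\<in>A. coeff (f x) \<alpha>)"
  by (induction A rule: infinite_finite_induct) auto

text \<open>Constants, variables and powers of \<open>t\<close> are all of this form, so one
  coefficient formula for products covers multiplication by each of them.\<close>

definition ms_monom :: "'a::comm_ring_1 \<Rightarrow> expo \<Rightarrow> 'a mseries"
  where "ms_monom c \<gamma> = MSeries (\<lambda>\<alpha>. if \<alpha> = \<gamma> then c else 0)"

lemma coeff_monom: "coeff (ms_monom c \<gamma>) \<alpha> = (if \<alpha> = \<gamma> then c else 0)"
  by (simp add: ms_monom_def)

lemma coeff_monom_mult:
  "coeff (ms_monom c \<gamma> * f) \<alpha> = (if \<exists>\<beta>. \<alpha> = \<gamma> + \<beta> then c * coeff f (\<alpha> - \<gamma>) else 0)"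
proof -
  let ?D = "{(\<beta>, \<delta>). \<beta> + \<delta> = \<alpha>}"
  have *: "coeff (ms_monom c \<gamma> * f) \<alpha> =
    (\<Sum>p\<in>?D. if fst p = \<gamma> then c * coeff f (\<alpha> - \<gamma>) else 0)"
    unfolding coeff_mult coeff_monom by (rule sum.cong) auto
  show ?thesis
  proof (cases "\<exists>\<beta>. \<alpha> = \<gamma> + \<beta>")
    case True
    then obtain \<beta> where b: "\<alpha> = \<gamma> + \<beta>" by blast
    have "{p \<in> ?D. fst p = \<gamma>} = {(\<gamma>, \<beta>)}" using b by auto
    then show ?thesis unfolding * using True
      by (simp add: sum.If_cases finite_expo_splits Int_def Collect_conj_eq[symmetric])
  next
    case False
    then have "fst p \<noteq> \<gamma>" if "p \<in> ?D" for p using that by auto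
    then show ?thesis unfolding * using False by (simp add: sum.neutral)
  qed
qed

lemma coeff_monom_mult_add [simp]: "coeff (ms_monom c \<gamma> * f) (\<gamma> + \<beta>) = c * coeff f \<beta>"
  by (simp add: coeff_monom_mult)

lemma ms_monom_mult: "ms_monom a \<alpha> * ms_monom b \<beta> = ms_monom (a * b) (\<alpha> + \<beta>)"
  by (rule mseries_eqI) (auto simp: coeff_monom_mult coeff_monom)

lemma ms_const_eq_monom: "ms_const c = ms_monom c 0"
  by (simp add: ms_const_def ms_monom_def)

lemma ms_var_eq_monom: "ms_var k = ms_monom 1 (Poly_Mapping.single k 1)"
  by (simp add: ms_var_def ms_monom_def)

lemma ms_one_eq_monom: "1 = ms_monom 1 0"
  by (rule mseries_eqI) (simp add: coeff_one coeff_monom)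

lemma ms_var_power: "ms_var k ^ m = ms_monom 1 (Poly_Mapping.single k m)"
  by (induction m)
    (auto simp: ms_one_eq_monom ms_var_eq_monom ms_monom_mult single_add[symmetric])

lemma coeff_const_mult [simp]: "coeff (ms_const c * f) \<alpha> = c * coeff f \<alpha>"
  using coeff_monom_mult_add[of c 0 f \<alpha>] by (simp add: ms_const_eq_monom)

definition ord_ge :: "'a::comm_ring_1 mseries \<Rightarrow> nat \<Rightarrow> bool"
  where "ord_ge f k \<longleftrightarrow> (\<forall>\<alpha>. tdeg \<alpha> < k \<longrightarrow> coeff f \<alpha> = 0)"

lemma ord_ge_mono: "ord_ge f k \<Longrightarrow> l \<le> k \<Longrightarrow> ord_ge f l"
  by (simp add: ord_ge_def)

lemma ord_ge_0 [simp]: "ord_ge f 0"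
  by (simp add: ord_ge_def)

lemma ord_ge_zero [simp]: "ord_ge 0 k"
  by (simp add: ord_ge_def)

lemma ord_ge_add: "ord_ge f k \<Longrightarrow> ord_ge g k \<Longrightarrow> ord_ge (f + g) k"
  by (simp add: ord_ge_def)

lemma ord_ge_diff: "ord_ge f k \<Longrightarrow> ord_ge g k \<Longrightarrow> ord_ge (f - g) k"
  by (simp add: ord_ge_def)

lemma ord_ge_mult:
  assumes "ord_ge f k" "ord_ge g l"
  shows "ord_ge (f * g) (k + l)"
  unfolding ord_ge_def coeff_mult
proof (intro allI impI sum.neutral ballI)
  fix \<alpha> p assume a: "tdeg \<alpha> < k + l" "p \<in> {(\<beta>, \<gamma>). \<beta> + \<gamma> = \<alpha>}"
  then have "tdeg (fst p) < k \<or> tdeg (snd p) < l" by (auto simp: tdeg_add)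
  then show "(case p of (\<beta>, \<gamma>) \<Rightarrow> coeff f \<beta> * coeff g \<gamma>) = 0"
    using assms by (auto simp: ord_ge_def split_def)
qed

lemma ord_ge_mult_right: "ord_ge g l \<Longrightarrow> ord_ge (f * g) l"
  using ord_ge_mult[of f 0 g l] by simp

lemma ord_ge_monom: "tdeg \<gamma> \<ge> k \<Longrightarrow> ord_ge (ms_monom c \<gamma>) k"
  by (auto simp: ord_ge_def coeff_monom)

lemma initial_expo_eqI:
  assumes "coeff f \<alpha> \<noteq> 0" "\<And>\<beta>. coeff f \<beta> \<noteq> 0 \<Longrightarrow> \<beta> = \<alpha> \<or> expo_less \<alpha> \<beta>"
  shows "initial_expo f = \<alpha>"
  unfolding initial_expo_def
proof (rule the_equality)
  fix \<beta> assume "coeff f \<beta> \<noteq> 0 \<and> (\<forall>\<gamma>. coeff f \<gamma> \<noteq> 0 \<longrightarrow> \<gamma> = \<beta> \<or> expo_less \<beta> \<gamma>)"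
  then show "\<beta> = \<alpha>" using assms expo_less_trans[of \<alpha> \<beta> \<alpha>] by auto
qed (use assms in blast)

definition supp_in :: "nat set \<Rightarrow> 'a::zero mseries \<Rightarrow> bool"
  where "supp_in V f \<longleftrightarrow> (\<forall>\<alpha>. coeff f \<alpha> \<noteq> 0 \<longrightarrow> \<alpha> \<in> expos V)"

lemma initial_expo_props:
  assumes "supp_in V f" "finite V" "f \<noteq> 0"
  shows "coeff f (initial_expo f) \<noteq> 0"
    "coeff f \<beta> \<noteq> 0 \<Longrightarrow> \<beta> = initial_expo f \<or> expo_less (initial_expo f) \<beta>"
    "initial_expo f \<in> expos V"
proof -
  have "{\<alpha>. coeff f \<alpha> \<noteq> 0} \<noteq> {}" using assms(3) mseries_eqI[of f 0] by auto
  moreover have "{\<alpha>. coeff f \<alpha> \<noteq> 0} \<subseteq> expos V" using assms(1) by (auto simp: supp_in_def)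
  ultimately obtain \<alpha> where a: "coeff f \<alpha> \<noteq> 0"
    "\<And>\<beta>. coeff f \<beta> \<noteq> 0 \<Longrightarrow> \<beta> = \<alpha> \<or> expo_less \<alpha> \<beta>"
    using ex_expo_min[of "{\<alpha>. coeff f \<alpha> \<noteq> 0}" V] assms(2) by auto
  moreover have "initial_expo f = \<alpha>" using a by (rule initial_expo_eqI)
  ultimately show "coeff f (initial_expo f) \<noteq> 0" "initial_expo f \<in> expos V"
    "coeff f \<beta> \<noteq> 0 \<Longrightarrow> \<beta> = initial_expo f \<or> expo_less (initial_expo f) \<beta>"
    using assms(1) by (auto simp: supp_in_def)
qed

lemma initial_expo_monom_mult:
  fixes f :: "'a::field mseries"
  assumes "supp_in V f" "finite V" "f \<noteq> 0"
  shows "initial_expo (ms_monom 1 \<gamma> * f) = \<gamma> + initial_expo f"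
proof (rule initial_expo_eqI)
  show "coeff (ms_monom 1 \<gamma> * f) (\<gamma> + initial_expo f) \<noteq> 0"
    using initial_expo_props(1)[OF assms] by simp
  fix \<beta> assume b: "coeff (ms_monom 1 \<gamma> * f) \<beta> \<noteq> 0"
  then obtain \<delta> where d: "\<beta> = \<gamma> + \<delta>" by (auto simp: coeff_monom_mult split: if_splits)
  with b have "coeff f \<delta> \<noteq> 0" by simp
  then show "\<beta> = \<gamma> + initial_expo f \<or> expo_less (\<gamma> + initial_expo f) \<beta>"
    using initial_expo_props(2)[OF assms] expo_less_add_left unfolding d by blast
qed


subsection \<open>Ideals of convergent series\<close>

lemma conv_ring_simps [simp]:
  "carrier (conv_ring V) = conv_series V" "mult (conv_ring V) = (*)" "one (conv_ring V) = 1"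
  "ring.zero (conv_ring V) = 0" "ring.add (conv_ring V) = (+)"
  by (simp_all add: conv_ring_def)

lemma supp_in_conv: "f \<in> conv_series V \<Longrightarrow> supp_in V f"
  by (simp add: conv_series_def supp_in_def)

lemma conv_series_monom: "\<gamma> \<in> expos V \<Longrightarrow> ms_monom c \<gamma> \<in> conv_series V"
  by (rule conv_series_finite[of "{\<gamma>}"]) (auto simp: coeff_monom split: if_splits)

lemma conv_series_const: "ms_const c \<in> conv_series V"
  by (simp add: ms_const_eq_monom conv_series_monom)

lemma conv_series_mono: 
  assumes "V \<subseteq> W"
  shows "conv_series V \<subseteq> conv_series W"
proof
  fix f assume f: "f \<in> conv_series V"
  then obtain r where r: "r > 0" "(\<lambda>\<alpha>. norm (coeff f \<alpha>) * r ^ tdeg \<alpha>) summable_on expos V"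
    and s: "\<And>\<alpha>. coeff f \<alpha> \<noteq> 0 \<Longrightarrow> \<alpha> \<in> expos V"
    by (auto simp: conv_series_def)
  have "(\<lambda>\<alpha>. norm (coeff f \<alpha>) * r ^ tdeg \<alpha>) summable_on expos W"
    using r(2) by (subst summable_on_cong_neutral[where T = "expos V"
        and g = "\<lambda>\<alpha>. norm (coeff f \<alpha>) * r ^ tdeg \<alpha>"]) (use s expos_mono[OF assms] in auto)
  then show "f \<in> conv_series W" using r(1) s expos_mono[OF assms] by (auto simp: conv_series_def)
qed

text \<open>Ideals in terms of the operations of the series type, so that later arguments avoid the
  ring record. Negation comes from multiplication by the constant \<open>-1\<close>.\<close>

definition conv_ideal :: "nat set \<Rightarrow> 'a::real_normed_field mseries set \<Rightarrow> bool"
  where "conv_ideal V J \<longleftrightarrow> J \<subseteq> conv_series V \<and> 0 \<in> J \<and> (\<forall>f\<in>J. \<forall>g\<in>J. f + g \<in> J) \<and>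
    (\<forall>f\<in>J. \<forall>h\<in>conv_series V. h * f \<in> J)"

lemma conv_idealD:
  assumes "conv_ideal V J"
  shows "f \<in> J \<Longrightarrow> f \<in> conv_series V" "0 \<in> J" "f \<in> J \<Longrightarrow> g \<in> J \<Longrightarrow> f + g \<in> J"
    "f \<in> J \<Longrightarrow> h \<in> conv_series V \<Longrightarrow> h * f \<in> J"
  using assms by (auto simp: conv_ideal_def)

lemma conv_ideal_monom: "conv_ideal V J \<Longrightarrow> f \<in> J \<Longrightarrow> \<gamma> \<in> expos V \<Longrightarrow> ms_monom c \<gamma> * f \<in> J"
  by (simp add: conv_idealD conv_series_monom)

lemma conv_ideal_const: "conv_ideal V J \<Longrightarrow> f \<in> J \<Longrightarrow> ms_const c * f \<in> J"
  by (simp add: conv_idealD conv_series_const)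

lemma conv_ideal_uminus:
  assumes "conv_ideal V J" "f \<in> J"
  shows "- f \<in> J"
proof -
  have "- f = ms_const (- 1) * f" by (rule mseries_eqI) simp
  then show ?thesis using conv_ideal_const[OF assms] by simp
qed

lemma conv_ideal_diff: "conv_ideal V J \<Longrightarrow> f \<in> J \<Longrightarrow> g \<in> J \<Longrightarrow> f - g \<in> J"
  using conv_ideal_uminus[of V J g] conv_idealD(3)[of V J f "- g"] by simp

lemma conv_ideal_sum: "conv_ideal V J \<Longrightarrow> (\<And>x. x \<in> A \<Longrightarrow> f x \<in> J) \<Longrightarrow> sum f A \<in> J"
  by (induction A rule: infinite_finite_induct) (auto simp: conv_idealD)

lemma ideal_iff_conv_ideal: "ideal J (conv_ring V) \<longleftrightarrow> conv_ideal V J"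
proof
  assume "ideal J (conv_ring V)"
  then interpret ideal J "conv_ring V" .
  show "conv_ideal V J" unfolding conv_ideal_def
    using a_subset additive_subgroup.a_closed[OF is_additive_subgroup] I_l_closed additive_subgroup.zero_closed[OF is_additive_subgroup]
    by auto
next
  assume J: "conv_ideal V J"
  interpret cring "conv_ring V" by (rule cring_conv_ring)
  show "ideal J (conv_ring V)"
  proof (rule idealI)
    show "subgroup J (add_monoid (conv_ring V))"
    proof (rule add.subgroupI)
      fix f assume f: "f \<in> J"
      have "\<ominus>\<^bsub>conv_ring V\<^esub> f = - f"
        by (rule minus_equality) (use conv_idealD(1)[OF J f] in \<open>auto simp: conv_series_uminus\<close>)
      then show "\<ominus>\<^bsub>conv_ring V\<^esub> f \<in> J" using conv_ideal_uminus[OF J f] by simp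
    qed (use conv_idealD[OF J] in auto)
  qed (use conv_idealD[OF J] ring_axioms in \<open>auto simp: mult.commute\<close>)
qed

lemma conv_ideal_Idl: "S \<subseteq> conv_series V \<Longrightarrow> conv_ideal V (Idl\<^bsub>conv_ring V\<^esub> S)"
  using ring.genideal_ideal[OF cring.axioms(1)[OF cring_conv_ring]]
  by (simp flip: ideal_iff_conv_ideal)

lemma Idl_self: "S \<subseteq> conv_series V \<Longrightarrow> S \<subseteq> Idl\<^bsub>conv_ring V\<^esub> S"
  using ring.genideal_self[OF cring.axioms(1)[OF cring_conv_ring]] by simp

lemma Idl_minimal: "conv_ideal V J \<Longrightarrow> S \<subseteq> J \<Longrightarrow> Idl\<^bsub>conv_ring V\<^esub> S \<subseteq> J"
  using ring.genideal_minimal[OF cring.axioms(1)[OF cring_conv_ring]]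
  by (simp flip: ideal_iff_conv_ideal)

lemma diagram_memI: "f \<in> J \<Longrightarrow> f \<noteq> 0 \<Longrightarrow> initial_expo f \<in> diagram J"
  by (auto simp: diagram_def)

lemma up_closed_diagram:
  assumes J: "conv_ideal V J" and V: "finite V"
  shows "up_closed V (diagram J)"
  unfolding up_closed_def
proof (intro conjI ballI subsetI)
  fix \<alpha> assume "\<alpha> \<in> diagram J"
  then obtain f where f: "f \<in> J" "f \<noteq> 0" "\<alpha> = initial_expo f" by (auto simp: diagram_def)
  note s = supp_in_conv[OF conv_idealD(1)[OF J f(1)]]
  show "\<alpha> \<in> expos V" using initial_expo_props(3)[OF s V f(2)] f(3) by simp
  fix \<gamma> assume g: "\<gamma> \<in> expos V"
  have "ms_monom 1 \<gamma> * f \<noteq> 0"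
    using initial_expo_props(1)[OF s V f(2)] coeff_monom_mult_add[of 1 \<gamma> f "initial_expo f"]
    by (metis coeff_simps(3) mult_1)
  then show "\<alpha> + \<gamma> \<in> diagram J"
    using diagram_memI[OF conv_ideal_monom[OF J f(1) g, of 1]] initial_expo_monom_mult[OF s V f(2)]
    unfolding f(3) by (simp add: add.commute)
qed


subsection \<open>Weighted norms\<close>

text \<open>A bound for the weighted l1-norm at radius \<open>s\<close>, through finite partial
  sums. This norm is submultiplicative, and bounds can be composed without carrying summability
  along.\<close>

definition wnorm_le :: "real \<Rightarrow> 'a::real_normed_field mseries \<Rightarrow> real \<Rightarrow> bool"
  where "wnorm_le s f M \<longleftrightarrow>
    (\<forall>F. finite F \<longrightarrow> (\<Sum>\<gamma>\<in>F. norm (coeff f \<gamma>) * s ^ tdeg \<gamma>) \<le> M)"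

lemma wnorm_le_mono: "wnorm_le s f M \<Longrightarrow> M \<le> M' \<Longrightarrow> wnorm_le s f M'"
  by (force simp: wnorm_le_def)

lemma wnorm_le_nonneg: "wnorm_le s f M \<Longrightarrow> 0 \<le> M"
  unfolding wnorm_le_def by (metis finite.emptyI sum.empty)

lemma conv_series_iff_wnorm:
  "f \<in> conv_series V \<longleftrightarrow> supp_in V f \<and> (\<exists>s>0. \<exists>M. wnorm_le s f M)"
proof
  assume f: "f \<in> conv_series V"
  then obtain s where s: "s > 0" "(\<lambda>\<alpha>. norm (coeff f \<alpha>) * s ^ tdeg \<alpha>) summable_on expos V"
    by (auto simp: conv_series_def)
  have supp: "supp_in V f" by (rule supp_in_conv[OF f])
  have "wnorm_le s f (infsum (\<lambda>\<alpha>. norm (coeff f \<alpha>) * s ^ tdeg \<alpha>) (expos V))"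
    unfolding wnorm_le_def
  proof (intro allI impI)
    fix F :: "expo set" assume F: "finite F"
    have "(\<Sum>\<gamma>\<in>F. norm (coeff f \<gamma>) * s ^ tdeg \<gamma>) =
        (\<Sum>\<gamma>\<in>F \<inter> expos V. norm (coeff f \<gamma>) * s ^ tdeg \<gamma>)"
      by (rule sum.mono_neutral_right) (use F supp in \<open>auto simp: supp_in_def\<close>)
    also have "\<dots> \<le> infsum (\<lambda>\<alpha>. norm (coeff f \<alpha>) * s ^ tdeg \<alpha>) (expos V)"
      by (rule finite_sum_le_infsum) (use F s in auto)
    finally show "(\<Sum>\<gamma>\<in>F. norm (coeff f \<gamma>) * s ^ tdeg \<gamma>) \<le> \<dots>" .
  qed
  then show "supp_in V f \<and> (\<exists>s>0. \<exists>M. wnorm_le s f M)" using s(1) supp by blast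
next
  assume "supp_in V f \<and> (\<exists>s>0. \<exists>M. wnorm_le s f M)"
  then obtain s M where s: "s > 0" "wnorm_le s f M" and supp: "supp_in V f" by blast
  have "(\<lambda>\<alpha>. norm (coeff f \<alpha>) * s ^ tdeg \<alpha>) summable_on expos V"
    by (rule nonneg_bdd_above_summable_on)
      (use s in \<open>auto intro!: bdd_aboveI[of _ M] simp: wnorm_le_def\<close>)
  then show "f \<in> conv_series V" using s(1) supp by (auto simp: conv_series_def supp_in_def)
qed

lemma wnorm_le_monom: "s \<ge> 0 \<Longrightarrow> wnorm_le s (ms_monom c \<gamma>) (norm c * s ^ tdeg \<gamma>)"
  unfolding wnorm_le_def coeff_monom
proof (intro allI impI)
  fix F :: "expo set" assume s: "s \<ge> 0" and F: "finite F"
  have "(\<Sum>\<alpha>\<in>F. norm (if \<alpha> = \<gamma> then c else 0) * s ^ tdeg \<alpha>) =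
      (\<Sum>\<alpha>\<in>F. if \<alpha> = \<gamma> then norm c * s ^ tdeg \<gamma> else 0)"
    by (rule sum.cong) auto
  then show "(\<Sum>\<alpha>\<in>F. norm (if \<alpha> = \<gamma> then c else 0) * s ^ tdeg \<alpha>) \<le> norm c * s ^ tdeg \<gamma>"
    using F s by simp
qed

lemma wnorm_le_add:
  assumes "s \<ge> 0" "wnorm_le s f M" "wnorm_le s g M'"
  shows "wnorm_le s (f + g) (M + M')"
  unfolding wnorm_le_def
proof (intro allI impI)
  fix F :: "expo set" assume F: "finite F"
  have "(\<Sum>\<gamma>\<in>F. norm (coeff (f + g) \<gamma>) * s ^ tdeg \<gamma>) \<le>
      (\<Sum>\<gamma>\<in>F. norm (coeff f \<gamma>) * s ^ tdeg \<gamma> + norm (coeff g \<gamma>) * s ^ tdeg \<gamma>)"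
    by (rule sum_mono)
      (use assms(1) in \<open>auto simp flip: distrib_right intro!: mult_right_mono norm_triangle_ineq\<close>)
  also have "\<dots> \<le> M + M'"
    using assms(2,3) F unfolding wnorm_le_def sum.distrib by (intro add_mono) auto
  finally show "(\<Sum>\<gamma>\<in>F. norm (coeff (f + g) \<gamma>) * s ^ tdeg \<gamma>) \<le> M + M'" .
qed

lemma wnorm_le_mult:
  assumes s: "s \<ge> 0" and "wnorm_le s f M" "wnorm_le s g M'"
  shows "wnorm_le s (f * g) (M * M')"
  unfolding wnorm_le_def
proof (intro allI impI)
  fix F :: "expo set" assume F: "finite F"
  define f' where "f' \<beta> = norm (coeff f \<beta>) * s ^ tdeg \<beta>" for \<beta>
  define g' where "g' \<beta> = norm (coeff g \<beta>) * s ^ tdeg \<beta>" for \<beta>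
  have nn: "f' \<beta> \<ge> 0" "g' \<beta> \<ge> 0" for \<beta> using s by (auto simp: f'_def g'_def)
  let ?D = "\<lambda>\<alpha>::expo. {(\<beta>, \<gamma>). \<beta> + \<gamma> = \<alpha>}"
  let ?P = "\<Union>\<alpha>\<in>F. ?D \<alpha>"
  have P: "finite ?P" using F finite_expo_splits by blast
  have "(\<Sum>\<alpha>\<in>F. norm (coeff (f * g) \<alpha>) * s ^ tdeg \<alpha>) \<le> (\<Sum>\<alpha>\<in>F. \<Sum>p\<in>?D \<alpha>. f' (fst p) * g' (snd p))"
  proof (rule sum_mono)
    fix \<alpha>
    have "norm (coeff (f * g) \<alpha>) * s ^ tdeg \<alpha> \<le>
        (\<Sum>p\<in>?D \<alpha>. norm (coeff f (fst p) * coeff g (snd p))) * s ^ tdeg \<alpha>"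
      unfolding coeff_mult split_def by (intro mult_right_mono norm_sum) (use s in auto)
    also have "\<dots> = (\<Sum>p\<in>?D \<alpha>. f' (fst p) * g' (snd p))"
      unfolding sum_distrib_right f'_def g'_def
      by (intro sum.cong) (auto simp: tdeg_add power_add norm_mult mult_ac)
    finally show "norm (coeff (f * g) \<alpha>) * s ^ tdeg \<alpha> \<le> (\<Sum>p\<in>?D \<alpha>. f' (fst p) * g' (snd p))" .
  qed
  also have "\<dots> = (\<Sum>p\<in>?P. f' (fst p) * g' (snd p))"
    by (rule sum.UNION_disjoint[symmetric]) (use F finite_expo_splits in auto)
  \<comment> \<open>The pairs summing to an element of \<open>F\<close> lie in a finite rectangle,
    over which the sum factors.\<close>
  also have "\<dots> \<le> (\<Sum>p\<in>(fst ` ?P) \<times> (snd ` ?P). f' (fst p) * g' (snd p))"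
    using P nn by (intro sum_mono2 subset_fst_snd) auto
  also have "\<dots> = (\<Sum>\<beta>\<in>fst ` ?P. f' \<beta>) * (\<Sum>\<gamma>\<in>snd ` ?P. g' \<gamma>)"
    by (simp add: sum_product sum.cartesian_product split_def)
  also have "\<dots> \<le> M * M'"
    using assms(2,3) P wnorm_le_nonneg[OF assms(2)] unfolding wnorm_le_def f'_def g'_def
    by (intro mult_mono sum_nonneg) (use s in auto)
  finally show "(\<Sum>\<alpha>\<in>F. norm (coeff (f * g) \<alpha>) * s ^ tdeg \<alpha>) \<le> M * M'" .
qed

lemma wnorm_le_one: "s \<ge> 0 \<Longrightarrow> wnorm_le s 1 1"
  using wnorm_le_monom[of s 1 0] by (simp add: ms_one_eq_monom)

lemma wnorm_le_power: "s \<ge> 0 \<Longrightarrow> wnorm_le s f M \<Longrightarrow> wnorm_le s (f ^ m) (M ^ m)"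
  by (induction m) (auto simp: wnorm_le_one wnorm_le_mult)

lemma wnorm_le_prod:
  assumes "s \<ge> 0" "finite A" "\<And>k. k \<in> A \<Longrightarrow> wnorm_le s (f k) (M k)"
  shows "wnorm_le s (prod f A) (prod M A)"
  using assms(2,3) by (induction A rule: finite_induct) (auto simp: wnorm_le_one wnorm_le_mult assms(1))


subsection \<open>Division by powers of \<open>t\<close>\<close>

text \<open>Terms whose \<open>t\<close>-exponent is below \<open>d\<close> are dropped, which makes
  this total and additive. It is a true quotient when \<open>t^d\<close> divides, see
  \<open>t_power_mult_divt\<close>.\<close>

definition ms_divt :: "nat \<Rightarrow> 'a mseries \<Rightarrow> 'a mseries"
  where "ms_divt d f = MSeries (\<lambda>\<alpha>. coeff f (\<alpha> + Poly_Mapping.single 0 d))"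

lemma coeff_divt [simp]: "coeff (ms_divt d f) \<alpha> = coeff f (\<alpha> + Poly_Mapping.single 0 d)"
  by (simp add: ms_divt_def)

lemma ms_divt_add: "ms_divt d (f + g) = ms_divt d f + ms_divt d g"
  by (rule mseries_eqI) simp

lemma ms_divt_diff: "ms_divt d (f - g) = ms_divt d f - ms_divt d g"
  by (rule mseries_eqI) simp

lemma ms_divt_monom_mult:
  "Poly_Mapping.lookup \<gamma> 0 = 0 \<Longrightarrow> ms_divt d (ms_monom c \<gamma> * f) = ms_monom c \<gamma> * ms_divt d f"
proof (rule mseries_eqI)
  fix \<alpha> assume g: "Poly_Mapping.lookup \<gamma> 0 = 0"
  let ?e = "Poly_Mapping.single 0 d :: expo"
  show "coeff (ms_divt d (ms_monom c \<gamma> * f)) \<alpha> = coeff (ms_monom c \<gamma> * ms_divt d f) \<alpha>"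
  proof (cases "\<exists>\<beta>. \<alpha> = \<gamma> + \<beta>")
    case True
    then show ?thesis by (auto simp: add.assoc)
  next
    case False
    have "\<not> (\<exists>\<beta>. \<alpha> + ?e = \<gamma> + \<beta>)"
    proof
      assume "\<exists>\<beta>. \<alpha> + ?e = \<gamma> + \<beta>"
      then obtain \<beta> where b: "\<alpha> + ?e = \<gamma> + \<beta>" by blast
      have "\<forall>k. Poly_Mapping.lookup \<gamma> k \<le> Poly_Mapping.lookup (\<alpha> + ?e) k" unfolding b by (simp add: lookup_add)
      then have "\<forall>k. Poly_Mapping.lookup \<gamma> k \<le> Poly_Mapping.lookup \<alpha> k" using g
        by (metis add.right_neutral le0 lookup_add lookup_single_not_eq)
      then show False using False expo_le_iff[of \<alpha> UNIV \<gamma>] by (auto simp: expos_def)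
    qed
    then show ?thesis using False by (simp add: coeff_monom_mult)
  qed
qed

lemma ms_divt_var_mult: "ms_divt (d + e) (ms_var 0 ^ e * f) = ms_divt d f"
proof (rule mseries_eqI)
  fix \<alpha> :: expo
  have "\<alpha> + Poly_Mapping.single 0 (d + e) = Poly_Mapping.single 0 e + (\<alpha> + Poly_Mapping.single 0 d)"
    by (simp add: single_add ac_simps)
  then show "coeff (ms_divt (d + e) (ms_var 0 ^ e * f)) \<alpha> = coeff (ms_divt d f) \<alpha>"
    unfolding coeff_divt ms_var_power by (metis coeff_monom_mult_add mult_1)
qed

lemma ms_divt_divt: "ms_divt d (ms_divt e f) = ms_divt (d + e) f"
  by (rule mseries_eqI) (simp add: single_add ac_simps)

definition t_ord_ge :: "'a::zero mseries \<Rightarrow> nat \<Rightarrow> bool"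
  where "t_ord_ge f d \<longleftrightarrow> (\<forall>\<alpha>. Poly_Mapping.lookup \<alpha> 0 < d \<longrightarrow> coeff f \<alpha> = 0)"

lemma t_power_mult_divt:
  assumes "t_ord_ge f d"
  shows "ms_var 0 ^ d * ms_divt d f = f"
proof (rule mseries_eqI)
  fix \<alpha>
  let ?e = "Poly_Mapping.single 0 d :: expo"
  show "coeff (ms_var 0 ^ d * ms_divt d f) \<alpha> = coeff f \<alpha>"
  proof (cases "\<exists>\<beta>. \<alpha> = ?e + \<beta>")
    case True
    then obtain \<beta> where b: "\<alpha> = ?e + \<beta>" by blast
    show ?thesis unfolding ms_var_power b coeff_monom_mult_add by (simp add: add.commute)
  next
    case False
    then have "\<not> (\<forall>k. Poly_Mapping.lookup ?e k \<le> Poly_Mapping.lookup \<alpha> k)"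
      using expo_le_iff[of \<alpha> UNIV ?e] by (auto simp: expos_def)
    then have "Poly_Mapping.lookup \<alpha> 0 < d" by (metis le0 lookup_single_eq lookup_single_not_eq not_less)
    then show ?thesis using False assms unfolding ms_var_power
      by (simp add: coeff_monom_mult t_ord_ge_def)
  qed
qed

lemma conv_series_divt:
  assumes "f \<in> conv_series V"
  shows "ms_divt d f \<in> conv_series V"
proof -
  let ?e = "Poly_Mapping.single 0 d :: expo"
  obtain s M where s: "s > 0" "wnorm_le s f M" and supp: "supp_in V f"
    using assms by (auto simp: conv_series_iff_wnorm)
  have "wnorm_le s (ms_divt d f) (M / s ^ d)" unfolding wnorm_le_def
  proof (intro allI impI)
    fix F :: "expo set" assume F: "finite F"
    have "(\<Sum>\<gamma>\<in>F. norm (coeff (ms_divt d f) \<gamma>) * s ^ tdeg \<gamma>) * s ^ d =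
        (\<Sum>\<gamma>\<in>F. norm (coeff f (\<gamma> + ?e)) * s ^ tdeg (\<gamma> + ?e))"
      unfolding sum_distrib_right by (rule sum.cong) (auto simp: tdeg_add power_add)
    also have "\<dots> = (\<Sum>\<gamma>\<in>(\<lambda>\<gamma>. \<gamma> + ?e) ` F. norm (coeff f \<gamma>) * s ^ tdeg \<gamma>)"
      by (subst sum.reindex) (auto simp: inj_on_def)
    also have "\<dots> \<le> M" using s(2) F by (simp add: wnorm_le_def)
    finally show "(\<Sum>\<gamma>\<in>F. norm (coeff (ms_divt d f) \<gamma>) * s ^ tdeg \<gamma>) \<le> M / s ^ d"
      using s(1) by (simp add: pos_le_divide_eq)
  qed
  moreover have "supp_in V (ms_divt d f)" using supp by (auto simp: supp_in_def expos_add_iff)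
  ultimately show ?thesis using s(1) by (auto simp: conv_series_iff_wnorm)
qed


subsection \<open>The blowing-up charts\<close>

text \<open>The pull-back of a monomial: \<open>t\<close> to its total degree times
  \<open>(a + X)\<close> to its \<open>X\<close>-part. Thus the form of degree \<open>d\<close> of a
  series goes to \<open>t^d\<close> times a polynomial in \<open>X\<close>, and total degree becomes
  the exponent of \<open>t\<close>.\<close>

definition chart_monom :: "nat \<Rightarrow> (nat \<Rightarrow> 'a::comm_ring_1) \<Rightarrow> expo \<Rightarrow> 'a mseries"
  where "chart_monom n a \<alpha> = (\<Prod>k\<in>{0..n}. blowup_chart a k ^ Poly_Mapping.lookup \<alpha> k)"

abbreviation chart_subst :: "nat \<Rightarrow> (nat \<Rightarrow> 'a::comm_ring_1) \<Rightarrow> 'a mseries \<Rightarrow> 'a mseries"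
  where "chart_subst n a \<equiv> ms_subst n (blowup_chart a)"

definition x_part :: "expo \<Rightarrow> expo"
  where "x_part \<alpha> = \<alpha> - Poly_Mapping.single 0 (Poly_Mapping.lookup \<alpha> 0)"

lemma lookup_x_part: "Poly_Mapping.lookup (x_part \<alpha>) k = (if k = 0 then 0 else Poly_Mapping.lookup \<alpha> k)"
  by (simp add: x_part_def lookup_minus lookup_single when_def)

text \<open>The shape of \<open>t\<^sup>m (a + X)\<^sup>b\<close>: divisible by \<open>t\<^sup>m\<close> and no higher power, with \<open>X\<close>-exponents
  bounded by \<open>b\<close> and monic top term.\<close>

definition chart_shape :: "'a::comm_ring_1 mseries \<Rightarrow> nat \<Rightarrow> expo \<Rightarrow> bool"
  where "chart_shape f m b \<longleftrightarrow> Poly_Mapping.lookup b 0 = 0 \<and> coeff f (Poly_Mapping.single 0 m + b) = 1 \<and>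
    (\<forall>\<gamma>. coeff f \<gamma> \<noteq> 0 \<longrightarrow> Poly_Mapping.lookup \<gamma> 0 = m \<and> (\<forall>k. k \<noteq> 0 \<longrightarrow> Poly_Mapping.lookup \<gamma> k \<le> Poly_Mapping.lookup b k))"

text \<open>Exponents of each factor are bounded coordinatewise by its top exponent. A sum of two of
  them can equal the sum of the tops only if both are tops, so the top coefficient of the product is
  \<open>1 * 1\<close>.\<close>

lemma chart_shape_mult:
  assumes f: "chart_shape f m b" and g: "chart_shape g m' b'"
  shows "chart_shape (f * g) (m + m') (b + b')"
  unfolding chart_shape_def
proof (intro conjI)
  let ?D = "\<lambda>\<alpha>::expo. {(\<beta>, \<gamma>). \<beta> + \<gamma> = \<alpha>}"
  show "Poly_Mapping.lookup (b + b') 0 = 0" using f g by (simp add: chart_shape_def lookup_add)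
  let ?\<beta> = "Poly_Mapping.single 0 m + b" and ?\<gamma> = "Poly_Mapping.single 0 m' + b'"
  have eq: "Poly_Mapping.single 0 (m + m') + (b + b') = ?\<beta> + ?\<gamma>"
    by (simp add: single_add ac_simps)
  have "coeff (f * g) (?\<beta> + ?\<gamma>) = (\<Sum>(\<beta>, \<gamma>)\<in>{(?\<beta>, ?\<gamma>)}. coeff f \<beta> * coeff g \<gamma>)"
    unfolding coeff_mult
  proof (rule sum.mono_neutral_right[OF finite_expo_splits])
    show "\<forall>p\<in>?D (?\<beta> + ?\<gamma>) - {(?\<beta>, ?\<gamma>)}. (case p of (\<beta>, \<gamma>) \<Rightarrow> coeff f \<beta> * coeff g \<gamma>) = 0"
    proof (intro ballI, rule ccontr)
      fix p assume p: "p \<in> ?D (?\<beta> + ?\<gamma>) - {(?\<beta>, ?\<gamma>)}"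
        "(case p of (\<beta>, \<gamma>) \<Rightarrow> coeff f \<beta> * coeff g \<gamma>) \<noteq> 0"
      obtain \<beta> \<gamma> where pe: "p = (\<beta>, \<gamma>)" by (cases p)
      have s: "\<beta> + \<gamma> = ?\<beta> + ?\<gamma>" "\<beta> = ?\<beta> \<longrightarrow> \<gamma> \<noteq> ?\<gamma>" using p(1) unfolding pe by auto
      have "coeff f \<beta> \<noteq> 0" "coeff g \<gamma> \<noteq> 0" using p(2) unfolding pe by auto
      then have l: "Poly_Mapping.lookup \<beta> 0 = m" "Poly_Mapping.lookup \<gamma> 0 = m'"
        "\<And>k. k \<noteq> 0 \<Longrightarrow> Poly_Mapping.lookup \<beta> k \<le> Poly_Mapping.lookup b k" "\<And>k. k \<noteq> 0 \<Longrightarrow> Poly_Mapping.lookup \<gamma> k \<le> Poly_Mapping.lookup b' k"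
        using f g by (auto simp: chart_shape_def)
      have "Poly_Mapping.lookup \<beta> k = Poly_Mapping.lookup ?\<beta> k" for k
      proof (cases "k = 0")
        case True
        then show ?thesis using l f by (simp add: chart_shape_def lookup_add)
      next
        case False
        have "Poly_Mapping.lookup \<beta> k + Poly_Mapping.lookup \<gamma> k = Poly_Mapping.lookup b k + Poly_Mapping.lookup b' k"
          using arg_cong[OF s(1), of "\<lambda>x. Poly_Mapping.lookup x k"] False
          by (simp add: lookup_add lookup_single)
        then show ?thesis using l(3,4)[OF False] False by (simp add: lookup_add lookup_single)
      qed
      then have "\<beta> = ?\<beta>" by (intro poly_mapping_eqI)
      then show False using s by simp
    qed
  qed auto
  also have "\<dots> = 1" using f g by (simp add: chart_shape_def)
  finally show "coeff (f * g) (Poly_Mapping.single 0 (m + m') + (b + b')) = 1" unfolding eq .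
  show "\<forall>\<gamma>. coeff (f * g) \<gamma> \<noteq> 0 \<longrightarrow>
    Poly_Mapping.lookup \<gamma> 0 = m + m' \<and> (\<forall>k. k \<noteq> 0 \<longrightarrow> Poly_Mapping.lookup \<gamma> k \<le> Poly_Mapping.lookup (b + b') k)"
  proof (intro allI impI)
    fix \<gamma> assume "coeff (f * g) \<gamma> \<noteq> 0"
    then obtain p where "p \<in> ?D \<gamma>" "(case p of (\<beta>, \<gamma>) \<Rightarrow> coeff f \<beta> * coeff g \<gamma>) \<noteq> 0"
      unfolding coeff_mult by (rule sum.not_neutral_contains_not_neutral)
    then obtain \<beta> \<delta> where p: "\<gamma> = \<beta> + \<delta>" "coeff f \<beta> * coeff g \<delta> \<noteq> 0" by auto
    then have "coeff f \<beta> \<noteq> 0" "coeff g \<delta> \<noteq> 0" by auto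
    then show "Poly_Mapping.lookup \<gamma> 0 = m + m' \<and> (\<forall>k. k \<noteq> 0 \<longrightarrow> Poly_Mapping.lookup \<gamma> k \<le> Poly_Mapping.lookup (b + b') k)"
      using f g unfolding chart_shape_def p(1) lookup_add by (auto intro: add_mono)
  qed
qed

lemma chart_shape_one: "chart_shape 1 0 0"
  by (auto simp: chart_shape_def coeff_one split: if_splits)

lemma blowup_chart_eq:
  "k \<noteq> 0 \<Longrightarrow> blowup_chart a k =
    ms_monom (a k) (Poly_Mapping.single 0 1) + ms_monom 1 (Poly_Mapping.single 0 1 + Poly_Mapping.single k 1)"
  by (simp add: blowup_chart_def ms_const_eq_monom ms_var_eq_monom distrib_left ms_monom_mult)

lemma chart_shape_blowup_chart:
  "chart_shape (blowup_chart a k) 1 (if k = 0 then 0 else Poly_Mapping.single k 1)"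
proof (cases "k = 0")
  case True
  then show ?thesis
    by (auto simp: chart_shape_def blowup_chart_def ms_var_eq_monom coeff_monom lookup_single split: if_splits)
next
  case False
  then have "Poly_Mapping.single k (1::nat) \<noteq> 0" by (metis lookup_single_eq lookup_zero one_neq_zero)
  then show ?thesis using False
    by (auto simp: chart_shape_def blowup_chart_eq coeff_monom lookup_single lookup_add when_def split: if_splits)
qed

lemma chart_shape_blowup_chart_power:
  "chart_shape (blowup_chart a k ^ j) j (if k = 0 then 0 else Poly_Mapping.single k j)"
proof (induction j)
  case (Suc j)
  from chart_shape_mult[OF chart_shape_blowup_chart[of a k] this] show ?case
    by (cases "k = 0") (simp_all add: single_add[symmetric])
qed (simp add: chart_shape_one)

lemma chart_shape_prod:
  assumes "finite A" "\<And>k. k \<in> A \<Longrightarrow> chart_shape (f k) (m k) (b k)"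
  shows "chart_shape (prod f A) (sum m A) (sum b A)"
  using assms by (induction A rule: finite_induct) (auto simp: chart_shape_one chart_shape_mult)

lemma chart_shape_chart_monom:
  assumes "\<alpha> \<in> expos {0..n}"
  shows "chart_shape (chart_monom n a \<alpha>) (tdeg \<alpha>) (x_part \<alpha>)"
proof -
  let ?b = "\<lambda>k. if k = 0 then 0 else Poly_Mapping.single k (Poly_Mapping.lookup \<alpha> k) :: expo"
  have "chart_shape (chart_monom n a \<alpha>) (\<Sum>k\<in>{0..n}. Poly_Mapping.lookup \<alpha> k) (\<Sum>k\<in>{0..n}. ?b k)"
    unfolding chart_monom_def
    by (rule chart_shape_prod[OF _ chart_shape_blowup_chart_power]) simp
  moreover have "tdeg \<alpha> = (\<Sum>k\<in>{0..n}. Poly_Mapping.lookup \<alpha> k)"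
    using assms tdeg_alt[of "{0..n}" \<alpha>] by (simp add: expos_def)
  moreover have "x_part \<alpha> = (\<Sum>k\<in>{0..n}. ?b k)"
  proof (rule poly_mapping_eqI)
    fix l
    have b: "Poly_Mapping.lookup (?b k) l = (if l = k then Poly_Mapping.lookup (x_part \<alpha>) l else 0)" for k
      by (auto simp: lookup_x_part lookup_single when_def)
    have "Poly_Mapping.lookup \<alpha> l = 0" if "\<not> l \<le> n"
      using assms that by (auto simp: expos_def in_keys_iff subset_iff)
    then show "Poly_Mapping.lookup (x_part \<alpha>) l = Poly_Mapping.lookup (\<Sum>k\<in>{0..n}. ?b k) l"
      unfolding lookup_sum b by (subst sum.delta') (auto simp: lookup_x_part)
  qed
  ultimately show ?thesis by simp
qed

lemma chart_monom_props:
  assumes "\<alpha> \<in> expos {0..n}" "coeff (chart_monom n a \<alpha>) \<gamma> \<noteq> 0"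
  shows "Poly_Mapping.lookup \<gamma> 0 = tdeg \<alpha>" "k \<noteq> 0 \<Longrightarrow> Poly_Mapping.lookup \<gamma> k \<le> Poly_Mapping.lookup \<alpha> k" "\<gamma> \<in> expos {0..n}"
proof -
  from chart_shape_chart_monom[OF assms(1), of a] assms(2)
  have *: "Poly_Mapping.lookup \<gamma> 0 = tdeg \<alpha>" "\<And>k. k \<noteq> 0 \<Longrightarrow> Poly_Mapping.lookup \<gamma> k \<le> Poly_Mapping.lookup \<alpha> k"
    by (auto simp: chart_shape_def lookup_x_part)
  then show "Poly_Mapping.lookup \<gamma> 0 = tdeg \<alpha>" "k \<noteq> 0 \<Longrightarrow> Poly_Mapping.lookup \<gamma> k \<le> Poly_Mapping.lookup \<alpha> k" by auto
  show "\<gamma> \<in> expos {0..n}" unfolding expos_def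
  proof (clarsimp simp: in_keys_iff)
    fix k assume k: "0 < Poly_Mapping.lookup \<gamma> k"
    show "k \<le> n"
    proof (cases "k = 0")
      case False
      then have "0 < Poly_Mapping.lookup \<alpha> k" using *(2)[of k] k by simp
      then show ?thesis using assms(1) by (auto simp: expos_def in_keys_iff subset_iff)
    qed simp
  qed
qed

lemma tdeg_x_part_le: "tdeg (x_part \<alpha>) \<le> tdeg \<alpha>"
proof -
  have "\<alpha> = x_part \<alpha> + Poly_Mapping.single 0 (Poly_Mapping.lookup \<alpha> 0)"
    by (rule poly_mapping_eqI) (simp add: lookup_add lookup_x_part lookup_single when_def)
  then show ?thesis by (metis le_add1 tdeg_add)
qed

lemma expo_eq_of_x_part:
  assumes "x_part \<alpha> = x_part \<beta>" "tdeg \<alpha> = tdeg \<beta>"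
  shows "\<alpha> = \<beta>"
proof -
  have *: "\<alpha> = x_part \<alpha> + Poly_Mapping.single 0 (Poly_Mapping.lookup \<alpha> 0)" for \<alpha>
    by (rule poly_mapping_eqI) (simp add: lookup_add lookup_x_part lookup_single when_def)
  have "tdeg \<alpha> = tdeg (x_part \<alpha>) + Poly_Mapping.lookup \<alpha> 0" for \<alpha>
    by (subst *) (simp add: tdeg_add)
  then have "Poly_Mapping.lookup \<alpha> 0 = Poly_Mapping.lookup \<beta> 0" using assms by (metis add_left_cancel)
  then show ?thesis using *[of \<alpha>] *[of \<beta>] assms(1) by simp
qed

lemma finite_expos_tdeg_eq: "finite {\<alpha> \<in> expos {0..n}. tdeg \<alpha> = d}"
  by (rule finite_subset[OF _ finite_expos_tdeg[of "{0..n}" d]]) auto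

text \<open>A monomial of degree \<open>d\<close> pulls back to terms with \<open>t\<close>-exponent
  exactly \<open>d\<close>. So the cut-off by degree in \<open>ms_subst\<close> can be sharpened to
  the single degree given by the \<open>t\<close>-exponent of \<open>\<gamma>\<close>.\<close>

lemma coeff_chart_subst:
  "coeff (chart_subst n a f) \<gamma> =
    (\<Sum>\<alpha> | \<alpha> \<in> expos {0..n} \<and> tdeg \<alpha> = Poly_Mapping.lookup \<gamma> 0. coeff f \<alpha> * coeff (chart_monom n a \<alpha>) \<gamma>)"
  unfolding ms_subst_def coeff_MSeries chart_monom_def[symmetric]
proof (rule sum.mono_neutral_right)
  show "finite {\<alpha> \<in> expos {0..n}. tdeg \<alpha> \<le> tdeg \<gamma>}" by (rule finite_expos_tdeg) simp
  show "{\<alpha> \<in> expos {0..n}. tdeg \<alpha> = Poly_Mapping.lookup \<gamma> 0} \<subseteq> {\<alpha> \<in> expos {0..n}. tdeg \<alpha> \<le> tdeg \<gamma>}"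
    using lookup_le_tdeg[of \<gamma> 0] by auto
  show "\<forall>\<alpha>\<in>{\<alpha> \<in> expos {0..n}. tdeg \<alpha> \<le> tdeg \<gamma>} - {\<alpha> \<in> expos {0..n}. tdeg \<alpha> = Poly_Mapping.lookup \<gamma> 0}.
      coeff f \<alpha> * coeff (chart_monom n a \<alpha>) \<gamma> = 0"
  proof
    fix \<alpha> assume a: "\<alpha> \<in> {\<alpha> \<in> expos {0..n}. tdeg \<alpha> \<le> tdeg \<gamma>} - {\<alpha> \<in> expos {0..n}. tdeg \<alpha> = Poly_Mapping.lookup \<gamma> 0}"
    have "coeff (chart_monom n a \<alpha>) \<gamma> = 0"
    proof (rule ccontr)
      assume "coeff (chart_monom n a \<alpha>) \<gamma> \<noteq> 0"
      then show False using chart_monom_props(1)[of \<alpha> n a \<gamma>] a by auto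
    qed
    then show "coeff f \<alpha> * coeff (chart_monom n a \<alpha>) \<gamma> = 0" by simp
  qed
qed

lemma chart_subst_add: "chart_subst n a (f + g) = chart_subst n a f + chart_subst n a g"
  by (rule mseries_eqI) (simp add: coeff_chart_subst distrib_right sum.distrib)

lemma chart_subst_diff: "chart_subst n a (f - g) = chart_subst n a f - chart_subst n a g"
  by (rule mseries_eqI) (simp add: coeff_chart_subst left_diff_distrib sum_subtractf)

lemma chart_monom_add: "chart_monom n a (\<alpha> + \<beta>) = chart_monom n a \<alpha> * chart_monom n a \<beta>"
  by (simp add: chart_monom_def lookup_add power_add prod.distrib)

text \<open>For a monomial factor the sum in \<open>coeff_chart_subst\<close> is reindexed by
  \<open>\<alpha> = \<delta> + \<beta>\<close>. The factor uses up \<open>tdeg \<delta>\<close> of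
  the \<open>t\<close>-exponent, which leaves for \<open>\<beta>\<close> the degree prescribed by
  the other half of the splitting.\<close>

lemma chart_subst_monom_mult:
  assumes \<delta>: "\<delta> \<in> expos {0..n}"
  shows "chart_subst n a (ms_monom c \<delta> * f) = ms_const c * (chart_monom n a \<delta> * chart_subst n a f)"
proof (rule mseries_eqI)
  fix \<gamma> :: expo
  let ?E = "expos {0..n}" and ?G = "chart_monom n a" and ?D = "{(\<mu>, \<nu>). \<mu> + \<nu> = \<gamma>}"
  let ?B = "{\<beta> \<in> ?E. tdeg \<delta> + tdeg \<beta> = Poly_Mapping.lookup \<gamma> 0}"
  have finB: "finite ?B"
    by (rule finite_subset[OF _ finite_expos_tdeg[of "{0..n}" "Poly_Mapping.lookup \<gamma> 0"]]) auto
  have "coeff (chart_subst n a (ms_monom c \<delta> * f)) \<gamma> =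
      (\<Sum>\<alpha>\<in>(\<lambda>\<beta>. \<delta> + \<beta>) ` ?B. coeff (ms_monom c \<delta> * f) \<alpha> * coeff (?G \<alpha>) \<gamma>)"
    unfolding coeff_chart_subst
  proof (rule sum.mono_neutral_right[OF finite_expos_tdeg_eq])
    show "(\<lambda>\<beta>. \<delta> + \<beta>) ` ?B \<subseteq> {\<alpha> \<in> ?E. tdeg \<alpha> = Poly_Mapping.lookup \<gamma> 0}"
      using \<delta> by (auto simp: tdeg_add expos_add_iff)
    show "\<forall>\<alpha>\<in>{\<alpha> \<in> ?E. tdeg \<alpha> = Poly_Mapping.lookup \<gamma> 0} - (\<lambda>\<beta>. \<delta> + \<beta>) ` ?B.
        coeff (ms_monom c \<delta> * f) \<alpha> * coeff (?G \<alpha>) \<gamma> = 0"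
    proof
      fix \<alpha> assume a: "\<alpha> \<in> {\<alpha> \<in> ?E. tdeg \<alpha> = Poly_Mapping.lookup \<gamma> 0} - (\<lambda>\<beta>. \<delta> + \<beta>) ` ?B"
      have "\<not> (\<exists>\<beta>. \<alpha> = \<delta> + \<beta>)"
      proof
        assume "\<exists>\<beta>. \<alpha> = \<delta> + \<beta>"
        then obtain \<beta> where "\<alpha> = \<delta> + \<beta>" by blast
        moreover from this have "\<beta> \<in> ?B" using a by (auto simp: tdeg_add expos_add_iff)
        ultimately show False using a by blast
      qed
      then show "coeff (ms_monom c \<delta> * f) \<alpha> * coeff (?G \<alpha>) \<gamma> = 0" by (simp add: coeff_monom_mult)
    qed
  qed
  also have "\<dots> = (\<Sum>\<beta>\<in>?B. c * coeff f \<beta> * coeff (?G \<delta> * ?G \<beta>) \<gamma>)"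
    by (subst sum.reindex) (auto simp: inj_on_def chart_monom_add)
  also have "\<dots> = (\<Sum>\<beta>\<in>?B. \<Sum>p\<in>?D. c * coeff f \<beta> * (coeff (?G \<delta>) (fst p) * coeff (?G \<beta>) (snd p)))"
    by (simp add: coeff_mult sum_distrib_left split_def)
  also have "\<dots> = (\<Sum>p\<in>?D. \<Sum>\<beta>\<in>?B. c * coeff f \<beta> * (coeff (?G \<delta>) (fst p) * coeff (?G \<beta>) (snd p)))"
    by (rule sum.swap)
  also have "\<dots> = (\<Sum>p\<in>?D. c * (coeff (?G \<delta>) (fst p) * coeff (chart_subst n a f) (snd p)))"
  proof (rule sum.cong[OF refl])
    fix p assume p: "p \<in> ?D"
    show "(\<Sum>\<beta>\<in>?B. c * coeff f \<beta> * (coeff (?G \<delta>) (fst p) * coeff (?G \<beta>) (snd p))) =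
        c * (coeff (?G \<delta>) (fst p) * coeff (chart_subst n a f) (snd p))"
    proof (cases "coeff (?G \<delta>) (fst p) = 0")
      case False
      then have "Poly_Mapping.lookup (fst p) 0 = tdeg \<delta>" using chart_monom_props(1)[OF \<delta>] by blast
      moreover have "Poly_Mapping.lookup \<gamma> 0 = Poly_Mapping.lookup (fst p) 0 + Poly_Mapping.lookup (snd p) 0" using p by (auto simp: lookup_add)
      ultimately have "?B = {\<beta> \<in> ?E. tdeg \<beta> = Poly_Mapping.lookup (snd p) 0}" by auto
      then show ?thesis unfolding coeff_chart_subst by (simp add: sum_distrib_left mult_ac)
    qed simp
  qed
  also have "\<dots> = coeff (ms_const c * (?G \<delta> * chart_subst n a f)) \<gamma>"
    by (simp add: coeff_mult[of "?G \<delta>"] sum_distrib_left split_def)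
  finally show "coeff (chart_subst n a (ms_monom c \<delta> * f)) \<gamma> =
      coeff (ms_const c * (?G \<delta> * chart_subst n a f)) \<gamma>" .
qed

lemma chart_monom_single:
  assumes "k \<le> n"
  shows "chart_monom n a (Poly_Mapping.single k j) = blowup_chart a k ^ j"
proof -
  have "chart_monom n a (Poly_Mapping.single k j) = (\<Prod>l\<in>{0..n}. if l = k then blowup_chart a k ^ j else 1)"
    unfolding chart_monom_def by (rule prod.cong) (auto simp: lookup_single)
  then show ?thesis using assms by (simp add: prod.delta)
qed

lemma chart_subst_t_mult: "chart_subst n a (ms_var 0 ^ e * f) = ms_var 0 ^ e * chart_subst n a f"
  unfolding ms_var_power
  by (subst chart_subst_monom_mult)
    (simp_all add: single_in_expos chart_monom_single ms_const_eq_monom ms_one_eq_monom[symmetric]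
      blowup_chart_def ms_var_power)

lemma chart_subst_const_mult: "chart_subst n a (ms_const c * f) = ms_const c * chart_subst n a f"
  unfolding ms_const_eq_monom
  by (subst chart_subst_monom_mult) (simp_all add: chart_monom_def ms_const_eq_monom)

text \<open>The pull-back of \<open>X_l - a_l t\<close> is
  \<open>t (a_l + X_l) - a_l t = t X_l\<close>. This lifts multiplication by \<open>X_l\<close> in
  the chart to multiplication in the original ideal, at the price of one factor
  \<open>t\<close>.\<close>

lemma chart_subst_x_mult:
  assumes "1 \<le> l" "l \<le> n"
  shows "chart_subst n a ((ms_var l - ms_const (a l) * ms_var 0) * f) = ms_var 0 * (ms_var l * chart_subst n a f)"
proof -
  have l: "chart_subst n a (ms_var l * f) = blowup_chart a l * chart_subst n a f"
    unfolding ms_var_eq_monom using assms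
    by (subst chart_subst_monom_mult)
      (simp_all add: single_in_expos chart_monom_single ms_const_eq_monom ms_one_eq_monom[symmetric])
  have t: "chart_subst n a (ms_var 0 * f) = ms_var 0 * chart_subst n a f"
    using chart_subst_t_mult[of n a 1 f] by simp
  show ?thesis using assms
    by (simp add: left_diff_distrib chart_subst_diff l mult.assoc chart_subst_const_mult t
        blowup_chart_def) (simp add: algebra_simps)
qed

lemma t_ord_ge_chart_subst:
  assumes "ord_ge f d"
  shows "t_ord_ge (chart_subst n a f) d"
  unfolding t_ord_ge_def coeff_chart_subst
  using assms by (auto simp: ord_ge_def intro!: sum.neutral)

text \<open>Dehomogenizing a form of fixed degree is injective. Among the exponents of that degree
  in \<open>f\<close>, take one of largest \<open>X\<close>-degree. Its top exponent divides the
  \<open>X\<close>-part of any other exponent that could contribute there; by maximality the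
  \<open>X\<close>-parts agree, and with equal total degree so do the exponents. Hence its
  coefficient survives in the pull-back.\<close>

lemma ord_ge_of_chart_subst:
  assumes supp: "supp_in {0..n} f" and t: "t_ord_ge (chart_subst n a f) d"
  shows "ord_ge f d"
  unfolding ord_ge_def
proof (intro allI impI, rule ccontr)
  fix \<alpha>\<^sub>0 assume a0: "tdeg \<alpha>\<^sub>0 < d" "coeff f \<alpha>\<^sub>0 \<noteq> 0"
  let ?E = "expos {0..n}" and ?G = "chart_monom n a"
  let ?P = "\<lambda>\<alpha>. \<alpha> \<in> ?E \<and> tdeg \<alpha> = tdeg \<alpha>\<^sub>0 \<and> coeff f \<alpha> \<noteq> 0"
  have "?P \<alpha>\<^sub>0" using a0 supp by (auto simp: supp_in_def)
  moreover have "\<forall>\<alpha>. ?P \<alpha> \<longrightarrow> tdeg (x_part \<alpha>) \<le> tdeg \<alpha>\<^sub>0" using tdeg_x_part_le by metis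
  ultimately have "\<exists>\<alpha>. ?P \<alpha> \<and> (\<forall>\<beta>. ?P \<beta> \<longrightarrow> tdeg (x_part \<beta>) \<le> tdeg (x_part \<alpha>))"
    by (intro ex_has_greatest_nat[where k = "\<alpha>\<^sub>0" and b = "Suc (tdeg \<alpha>\<^sub>0)"]) (auto simp: less_Suc_eq_le)
  then obtain \<alpha> where a: "?P \<alpha>" "\<And>\<beta>. ?P \<beta> \<Longrightarrow> tdeg (x_part \<beta>) \<le> tdeg (x_part \<alpha>)"
    by auto
  let ?\<gamma> = "Poly_Mapping.single 0 (tdeg \<alpha>) + x_part \<alpha>"
  have g0: "Poly_Mapping.lookup ?\<gamma> 0 = tdeg \<alpha>" by (simp add: lookup_add lookup_x_part)
  have "coeff (chart_subst n a f) ?\<gamma> = (\<Sum>\<beta>\<in>{\<alpha>}. coeff f \<beta> * coeff (?G \<beta>) ?\<gamma>)"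
    unfolding coeff_chart_subst g0
  proof (rule sum.mono_neutral_right[OF finite_expos_tdeg_eq])
    show "\<forall>\<beta>\<in>{\<beta> \<in> ?E. tdeg \<beta> = tdeg \<alpha>} - {\<alpha>}. coeff f \<beta> * coeff (?G \<beta>) ?\<gamma> = 0"
    proof (intro ballI, rule ccontr)
      fix \<beta> assume b: "\<beta> \<in> {\<beta> \<in> ?E. tdeg \<beta> = tdeg \<alpha>} - {\<alpha>}" "coeff f \<beta> * coeff (?G \<beta>) ?\<gamma> \<noteq> 0"
      then have nz: "coeff f \<beta> \<noteq> 0" "coeff (?G \<beta>) ?\<gamma> \<noteq> 0" by auto
      have bE: "\<beta> \<in> ?E" "tdeg \<beta> = tdeg \<alpha>" "\<beta> \<noteq> \<alpha>" using b by auto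
      have "Poly_Mapping.lookup (x_part \<alpha>) k \<le> Poly_Mapping.lookup (x_part \<beta>) k" for k
        using chart_monom_props(2)[OF bE(1) nz(2), of k]
        by (cases "k = 0") (auto simp: lookup_x_part lookup_add lookup_single)
      then obtain \<delta> where d: "x_part \<beta> = x_part \<alpha> + \<delta>"
        using expo_le_iff[of "x_part \<beta>" UNIV "x_part \<alpha>"] by (auto simp: expos_def)
      have "tdeg (x_part \<beta>) \<le> tdeg (x_part \<alpha>)" using a bE nz by auto
      then have "\<delta> = 0" unfolding d by (simp add: tdeg_add tdeg_eq_0_iff)
      then have "x_part \<beta> = x_part \<alpha>" using d by simp
      then show False using expo_eq_of_x_part[of \<beta> \<alpha>] bE by simp
    qed
  qed (use a in auto)
  also have "\<dots> = coeff f \<alpha>"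
    using chart_shape_chart_monom[of \<alpha> n a] a(1) by (simp add: chart_shape_def)
  finally have "coeff (chart_subst n a f) ?\<gamma> \<noteq> 0" using a by simp
  then show False using t a0 a(1) g0 by (simp add: t_ord_ge_def)
qed

text \<open>At radius \<open>s\<close> the components \<open>t\<close> and
  \<open>t (a_k + X_k)\<close> of the chart have norms at most \<open>s\<close> and
  \<open>s (|a_k| + s)\<close>. When both are at most \<open>r\<close>, submultiplicativity gives
  the power of \<open>r\<close>.\<close>

lemma wnorm_le_chart_monom:
  fixes a :: "nat \<Rightarrow> 'a::real_normed_field"
  assumes \<alpha>: "\<alpha> \<in> expos {0..n}" and s: "0 \<le> s" "s \<le> r" "\<And>k. k \<in> {1..n} \<Longrightarrow> s * (norm (a k) + s) \<le> r"
  shows "wnorm_le s (chart_monom n a \<alpha>) (r ^ tdeg \<alpha>)"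
proof -
  have "wnorm_le s (blowup_chart a k) r" if "k \<in> {0..n}" for k
  proof (cases "k = 0")
    case True
    have "wnorm_le s (ms_monom (1::'a) (Poly_Mapping.single 0 1)) (norm (1::'a) * s ^ tdeg (Poly_Mapping.single 0 1))"
      using s(1) by (rule wnorm_le_monom)
    then have "wnorm_le s (blowup_chart a k) s" unfolding True by (simp add: blowup_chart_def ms_var_eq_monom)
    then show ?thesis using s(2) by (rule wnorm_le_mono)
  next
    case False
    have "wnorm_le s (blowup_chart a k) (norm (a k) * s ^ tdeg (Poly_Mapping.single 0 1) +
        norm (1::'a) * s ^ tdeg (Poly_Mapping.single 0 1 + Poly_Mapping.single k 1))"
      unfolding blowup_chart_eq[OF False] using s(1) by (intro wnorm_le_add wnorm_le_monom)
    moreover have "norm (a k) * s ^ tdeg (Poly_Mapping.single 0 1) +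
        norm (1::'a) * s ^ tdeg (Poly_Mapping.single 0 1 + Poly_Mapping.single k 1) \<le> r"
      using s(3)[of k] that False by (simp add: tdeg_add algebra_simps power2_eq_square)
    ultimately show ?thesis by (rule wnorm_le_mono)
  qed
  then have "wnorm_le s (chart_monom n a \<alpha>) (\<Prod>k\<in>{0..n}. r ^ Poly_Mapping.lookup \<alpha> k)"
    unfolding chart_monom_def using s(1) by (intro wnorm_le_prod wnorm_le_power) auto
  moreover have "(\<Prod>k\<in>{0..n}. r ^ Poly_Mapping.lookup \<alpha> k) = r ^ tdeg \<alpha>"
    using \<alpha> tdeg_alt[of "{0..n}" \<alpha>] by (simp add: power_sum expos_def)
  ultimately show ?thesis by simp
qed

lemma conv_series_chart_subst:
  fixes a :: "nat \<Rightarrow> 'a::real_normed_field"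
  assumes "f \<in> conv_series {0..n}"
  shows "chart_subst n a f \<in> conv_series {0..n}"
proof -
  let ?E = "expos {0..n}" and ?G = "chart_monom n a"
  obtain r M where r: "r > 0" "wnorm_le r f M" using assms by (auto simp: conv_series_iff_wnorm)
  define C where "C = (\<Sum>k\<in>{1..n}. norm (a k))"
  have C: "norm (a k) \<le> C" if "k \<in> {1..n}" for k
    unfolding C_def by (rule member_le_sum) (use that in auto)
  have "C \<ge> 0" by (simp add: C_def sum_nonneg)
  \<comment> \<open>With \<open>s \<le> 1\<close> and \<open>|a_k| \<le> C\<close> one gets
    \<open>s (|a_k| + s) \<le> s (C + 1) \<le> r\<close>, so the chart maps radius \<open>s\<close>
    into the radius \<open>r\<close> at which \<open>f\<close> is bounded.\<close>
  define s where "s = min 1 (r / (C + 1))"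
  have "s \<le> r / (C + 1)" by (simp add: s_def)
  then have "s * (C + 1) \<le> r" using \<open>C \<ge> 0\<close> by (simp add: pos_le_divide_eq)
  moreover have "s > 0" "s \<le> 1" using r(1) \<open>C \<ge> 0\<close> by (auto simp: s_def)
  ultimately have s: "s > 0" "s \<le> 1" "s * (C + 1) \<le> r" by auto
  have "s * 1 \<le> s * (C + 1)" using s(1) \<open>C \<ge> 0\<close> by (intro mult_left_mono) auto
  then have sr: "s \<le> r" using s(3) by simp
  have G: "wnorm_le s (?G \<alpha>) (r ^ tdeg \<alpha>)" if "\<alpha> \<in> ?E" for \<alpha>
  proof (rule wnorm_le_chart_monom[OF that _ sr])
    fix k assume "k \<in> {1..n}"
    then have "s * (norm (a k) + s) \<le> s * (C + 1)"
      using C s by (intro mult_left_mono add_mono) auto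
    then show "s * (norm (a k) + s) \<le> r" using s(3) by (rule order_trans)
  qed (use s in auto)
  have "wnorm_le s (chart_subst n a f) M" unfolding wnorm_le_def
  proof (intro allI impI)
    fix F :: "expo set" assume F: "finite F"
    define A where "A = (\<Union>\<gamma>\<in>F. {\<alpha> \<in> ?E. tdeg \<alpha> = Poly_Mapping.lookup \<gamma> 0})"
    have A: "finite A" "A \<subseteq> ?E" using F finite_expos_tdeg_eq unfolding A_def by auto
    have "(\<Sum>\<gamma>\<in>F. norm (coeff (chart_subst n a f) \<gamma>) * s ^ tdeg \<gamma>) \<le>
        (\<Sum>\<gamma>\<in>F. \<Sum>\<alpha>\<in>A. norm (coeff f \<alpha>) * (norm (coeff (?G \<alpha>) \<gamma>) * s ^ tdeg \<gamma>))"
    proof (rule sum_mono)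
      fix \<gamma> assume g: "\<gamma> \<in> F"
      have "norm (coeff (chart_subst n a f) \<gamma>) \<le>
          (\<Sum>\<alpha> | \<alpha> \<in> ?E \<and> tdeg \<alpha> = Poly_Mapping.lookup \<gamma> 0. norm (coeff f \<alpha>) * norm (coeff (?G \<alpha>) \<gamma>))"
        unfolding coeff_chart_subst by (rule order_trans[OF norm_sum]) (simp add: norm_mult)
      also have "\<dots> \<le> (\<Sum>\<alpha>\<in>A. norm (coeff f \<alpha>) * norm (coeff (?G \<alpha>) \<gamma>))"
        by (rule sum_mono2) (use A g in \<open>auto simp: A_def\<close>)
      finally have "norm (coeff (chart_subst n a f) \<gamma>) * s ^ tdeg \<gamma> \<le>
          (\<Sum>\<alpha>\<in>A. norm (coeff f \<alpha>) * norm (coeff (?G \<alpha>) \<gamma>)) * s ^ tdeg \<gamma>"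
        using s(1) by (intro mult_right_mono) auto
      then show "norm (coeff (chart_subst n a f) \<gamma>) * s ^ tdeg \<gamma> \<le>
          (\<Sum>\<alpha>\<in>A. norm (coeff f \<alpha>) * (norm (coeff (?G \<alpha>) \<gamma>) * s ^ tdeg \<gamma>))"
        by (simp add: sum_distrib_right mult.assoc)
    qed
    also have "\<dots> = (\<Sum>\<alpha>\<in>A. norm (coeff f \<alpha>) * (\<Sum>\<gamma>\<in>F. norm (coeff (?G \<alpha>) \<gamma>) * s ^ tdeg \<gamma>))"
      by (subst sum.swap) (simp add: sum_distrib_left)
    also have "\<dots> \<le> (\<Sum>\<alpha>\<in>A. norm (coeff f \<alpha>) * r ^ tdeg \<alpha>)"
      using G A F unfolding wnorm_le_def by (intro sum_mono mult_left_mono) auto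
    also have "\<dots> \<le> M" using r(2) A by (simp add: wnorm_le_def)
    finally show "(\<Sum>\<gamma>\<in>F. norm (coeff (chart_subst n a f) \<gamma>) * s ^ tdeg \<gamma>) \<le> M" .
  qed
  moreover have "supp_in {0..n} (chart_subst n a f)" unfolding supp_in_def
  proof (intro allI impI)
    fix \<gamma> assume "coeff (chart_subst n a f) \<gamma> \<noteq> 0"
    then obtain \<alpha> where "\<alpha> \<in> {\<alpha> \<in> ?E. tdeg \<alpha> = Poly_Mapping.lookup \<gamma> 0}"
      "coeff f \<alpha> * coeff (?G \<alpha>) \<gamma> \<noteq> 0"
      unfolding coeff_chart_subst by (rule sum.not_neutral_contains_not_neutral)
    then show "\<gamma> \<in> ?E" using chart_monom_props(3)[of \<alpha> n a \<gamma>] by auto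
  qed
  ultimately show ?thesis using s(1) by (auto simp: conv_series_iff_wnorm)
qed


subsection \<open>An effective Artin--Rees lemma\<close>

definition ms_at_t0 :: "'a::comm_ring_1 mseries \<Rightarrow> 'a mseries"
  where "ms_at_t0 f = MSeries (\<lambda>\<alpha>. if Poly_Mapping.lookup \<alpha> 0 = 0 then coeff f \<alpha> else 0)"

lemma coeff_at_t0 [simp]: "coeff (ms_at_t0 f) \<alpha> = (if Poly_Mapping.lookup \<alpha> 0 = 0 then coeff f \<alpha> else 0)"
  by (simp add: ms_at_t0_def)

lemma ms_at_t0_add: "ms_at_t0 (f + g) = ms_at_t0 f + ms_at_t0 g"
  by (rule mseries_eqI) simp

text \<open>The largest exponent, in contrast to \<open>initial_expo\<close>: on polynomials,
  cancelling largest terms terminates because ranks decrease, while cancelling smallest ones could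
  go on forever.\<close>

definition lead_at_t0 :: "'a::comm_ring_1 mseries \<Rightarrow> expo \<Rightarrow> bool"
  where "lead_at_t0 f \<alpha> \<longleftrightarrow> coeff f \<alpha> \<noteq> 0 \<and> Poly_Mapping.lookup \<alpha> 0 = 0 \<and>
    (\<forall>\<beta>. Poly_Mapping.lookup \<beta> 0 = 0 \<longrightarrow> coeff f \<beta> \<noteq> 0 \<longrightarrow> \<beta> = \<alpha> \<or> expo_less \<beta> \<alpha>)"

lemma ex_lead_at_t0:
  assumes "supp_in V f" "finite V" "finite {\<alpha>. coeff (ms_at_t0 f) \<alpha> \<noteq> 0}" "ms_at_t0 f \<noteq> 0"
  obtains \<alpha> where "lead_at_t0 f \<alpha>" "\<alpha> \<in> expos V"
proof -
  have "{\<alpha>. coeff (ms_at_t0 f) \<alpha> \<noteq> 0} \<noteq> {}"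
  proof
    assume "{\<alpha>. coeff (ms_at_t0 f) \<alpha> \<noteq> 0} = {}"
    then have "ms_at_t0 f = 0" by (intro mseries_eqI) (simp del: coeff_at_t0)
    then show False using assms(4) by simp
  qed
  moreover have s: "{\<alpha>. coeff (ms_at_t0 f) \<alpha> \<noteq> 0} \<subseteq> expos V"
    using assms(1) by (auto simp: supp_in_def)
  ultimately obtain \<alpha> where "\<alpha> \<in> {\<alpha>. coeff (ms_at_t0 f) \<alpha> \<noteq> 0}"
    "\<And>\<beta>. \<beta> \<in> {\<alpha>. coeff (ms_at_t0 f) \<alpha> \<noteq> 0} \<Longrightarrow> \<beta> = \<alpha> \<or> expo_less \<beta> \<alpha>"
    using ex_expo_max[OF s assms(2,3)] by blast
  then show ?thesis using that[of \<alpha>] s by (auto simp: lead_at_t0_def split: if_splits)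
qed

text \<open>Sums and monomial multiples make \<open>T\<close> stable under polynomial multipliers.
  Convergent multipliers may lead out of \<open>strict_elems\<close>, since they destroy
  polynomiality at \<open>t = 0\<close>.\<close>

definition monom_closed :: "nat set \<Rightarrow> 'a::comm_ring_1 mseries set \<Rightarrow> bool"
  where "monom_closed V T \<longleftrightarrow> (\<forall>f\<in>T. supp_in V f) \<and> (\<forall>f\<in>T. \<forall>g\<in>T. f + g \<in> T) \<and>
    (\<forall>f\<in>T. \<forall>\<gamma>\<in>expos V. \<forall>c. ms_monom c \<gamma> * f \<in> T)"

lemma monom_closedD:
  assumes "monom_closed V T"
  shows "f \<in> T \<Longrightarrow> supp_in V f" "f \<in> T \<Longrightarrow> g \<in> T \<Longrightarrow> f + g \<in> T"
    "f \<in> T \<Longrightarrow> \<gamma> \<in> expos V \<Longrightarrow> ms_monom c \<gamma> * f \<in> T"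
  using assms by (auto simp: monom_closed_def)

lemma monom_closed_diff:
  assumes "monom_closed V T" "f \<in> T" "g \<in> T"
  shows "f - g \<in> T"
proof -
  have "- g = ms_monom (- 1) 0 * g"
    by (simp add: ms_const_eq_monom[symmetric]) (rule mseries_eqI, simp)
  also have "\<dots> \<in> T" by (rule monom_closedD(3)[OF assms(1,3)]) simp
  finally show ?thesis using monom_closedD(2)[OF assms(1,2), of "- g"] by simp
qed

lemma ms_at_t0_monom_mult:
  assumes "Poly_Mapping.lookup \<gamma> 0 = 0"
  shows "ms_at_t0 (ms_monom c \<gamma> * f) = ms_monom c \<gamma> * ms_at_t0 f"
proof (rule mseries_eqI)
  fix \<alpha>
  show "coeff (ms_at_t0 (ms_monom c \<gamma> * f)) \<alpha> = coeff (ms_monom c \<gamma> * ms_at_t0 f) \<alpha>"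
  proof (cases "\<exists>\<beta>. \<alpha> = \<gamma> + \<beta>")
    case True
    then obtain \<beta> where b: "\<alpha> = \<gamma> + \<beta>" by blast
    show ?thesis unfolding b coeff_at_t0 coeff_monom_mult_add using assms by (simp add: lookup_add)
  qed (simp add: coeff_monom_mult)
qed

text \<open>A Groebner basis argument for the ideal \<open>T|\<^bsub>t=0\<^esub>\<close> of polynomials, which also keeps track of
  orders: Dickson's lemma is applied to the triples \<open>(k, |\<alpha>| - k, \<alpha>)\<close>, where \<open>\<alpha>\<close> is the leading
  exponent of an element of order at least \<open>k\<close>.\<close>

lemma artin_rees_at_t0:
  fixes T :: "'a::field mseries set"
  assumes V: "finite V" and T: "monom_closed V T"
    and fin: "\<And>h. h \<in> T \<Longrightarrow> finite {\<alpha>. coeff (ms_at_t0 h) \<alpha> \<noteq> 0}" and "0 \<in> T"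
  obtains c where "\<And>k h. h \<in> T \<Longrightarrow> ord_ge (ms_at_t0 h) (k + c) \<Longrightarrow>
    \<exists>v\<in>T. ord_ge v k \<and> ms_at_t0 v = ms_at_t0 h"
proof -
  define L where "L = {(k, \<alpha>, h). h \<in> T \<and> ord_ge (ms_at_t0 h) k \<and> lead_at_t0 h \<alpha>}"
  define w :: "nat \<times> expo \<times> 'a mseries \<Rightarrow> nat + bool \<Rightarrow> nat" where
    "w = (\<lambda>(k, \<alpha>, h) j. case j of Inl i \<Rightarrow> Poly_Mapping.lookup \<alpha> i | Inr b \<Rightarrow> if b then k else tdeg \<alpha> - k)"
  have finS: "finite (Inl ` V \<union> Inr ` UNIV :: (nat + bool) set)" using V by simp
  obtain B where B: "finite B" "B \<subseteq> L"
    and dick: "\<And>x. x \<in> L \<Longrightarrow> \<exists>b\<in>B. \<forall>j\<in>Inl ` V \<union> Inr ` UNIV. w b j \<le> w x j"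
    using dickson_finite_basis[OF finS, of L w] by blast
  \<comment> \<open>The sum bounds the order \<open>k'\<close> of every basis element at
    \<open>t = 0\<close>; this is the loss of order in the conclusion.\<close>
  define c where "c = (\<Sum>b\<in>B. fst b)"
  have cB: "fst b \<le> c" if "b \<in> B" for b
    unfolding c_def by (rule member_le_sum) (use that B in auto)
  \<comment> \<open>Hence the natural-number subtraction in \<open>w\<close> is not truncated on
    \<open>L\<close>.\<close>
  have lead_le: "k \<le> tdeg \<alpha>" if "ord_ge (ms_at_t0 h) k" "lead_at_t0 h \<alpha>" for h :: "'a mseries" and k \<alpha>
    using that by (metis coeff_at_t0 lead_at_t0_def not_less ord_ge_def)
  have main: "\<exists>v\<in>T. ord_ge v k \<and> ms_at_t0 v = ms_at_t0 h"
    if "h \<in> T" "ord_ge (ms_at_t0 h) (k + c)" "lead_at_t0 h \<alpha>" "\<alpha> \<in> expos V" for k h \<alpha>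
    using that
  proof (induction "expo_rank V \<alpha>" arbitrary: h \<alpha> rule: less_induct)
    case less
    have "(k + c, \<alpha>, h) \<in> L" using less.prems by (simp add: L_def)
    then obtain b where bB: "b \<in> B" and b: "\<forall>j\<in>Inl ` V \<union> Inr ` UNIV. w b j \<le> w (k + c, \<alpha>, h) j"
      using dick by blast
    obtain k' \<alpha>' h' where be: "b = (k', \<alpha>', h')" by (cases b)
    have h': "h' \<in> T" "ord_ge (ms_at_t0 h') k'" "lead_at_t0 h' \<alpha>'" using bB B be by (auto simp: L_def)
    have "\<alpha>' \<in> expos V" using monom_closedD(1)[OF T h'(1)] h'(3) by (auto simp: supp_in_def lead_at_t0_def)
    moreover have "\<forall>i\<in>V. Poly_Mapping.lookup \<alpha>' i \<le> Poly_Mapping.lookup \<alpha> i"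
    proof
      fix i assume "i \<in> V"
      then show "Poly_Mapping.lookup \<alpha>' i \<le> Poly_Mapping.lookup \<alpha> i"
        using b[THEN bspec, of "Inl i"] by (simp add: be w_def)
    qed
    ultimately obtain \<gamma> where g: "\<gamma> \<in> expos V" "\<alpha> = \<alpha>' + \<gamma>"
      using expo_le_iff_fin[of \<alpha>' V \<alpha>] less.prems(4) by blast
    \<comment> \<open>The purpose of the coordinate \<open>|\<alpha>| - k\<close> in the triples: a
      basis element with no larger excess of degree over order leaves a multiplier
      \<open>\<gamma>\<close> of degree at least \<open>k + c - k'\<close>, so at least
      \<open>k\<close>.\<close>
    have "tdeg \<alpha>' - k' \<le> tdeg \<alpha> - (k + c)"
      using b[THEN bspec, OF UnI2[OF rangeI[of Inr False]]] by (simp add: be w_def)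
    moreover have "k' \<le> tdeg \<alpha>'" by (rule lead_le[OF h'(2,3)])
    moreover have "k + c \<le> tdeg \<alpha>" by (rule lead_le[OF less.prems(2,3)])
    ultimately have deg: "k + c \<le> tdeg \<gamma> + k'" by (simp add: g(2) tdeg_add)
    have kg: "k \<le> tdeg \<gamma>" using deg cB[OF bB] by (simp add: be)
    have g0: "Poly_Mapping.lookup \<gamma> 0 = 0" using less.prems(3) unfolding lead_at_t0_def g(2) by (simp add: lookup_add)
    define q where "q = coeff h \<alpha> / coeff h' \<alpha>'"
    define u where "u = ms_monom q \<gamma> * h'"
    have u: "u \<in> T" unfolding u_def using monom_closedD(3)[OF T h'(1) g(1)] .
    have hu: "h - u \<in> T" using monom_closed_diff[OF T less.prems(1) u] .
    \<comment> \<open>The order of \<open>h'\<close> is controlled only at \<open>t = 0\<close>.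
      Away from it the order of \<open>u\<close> comes from \<open>\<gamma>\<close> alone, which is
      why the degree of \<open>\<gamma>\<close> had to be at least \<open>k\<close>.\<close>
    have "ord_ge u (tdeg \<gamma> + 0)" unfolding u_def by (rule ord_ge_mult[OF ord_ge_monom]) auto
    then have ou: "ord_ge u k" using kg ord_ge_mono by simp
    have at0u: "ms_at_t0 u = ms_monom q \<gamma> * ms_at_t0 h'"
      unfolding u_def by (rule ms_at_t0_monom_mult[OF g0])
    have "ord_ge (ms_at_t0 u) (tdeg \<gamma> + k')"
      unfolding at0u by (rule ord_ge_mult[OF ord_ge_monom h'(2)]) simp
    then have "ord_ge (ms_at_t0 u) (k + c)" using deg ord_ge_mono by blast
    moreover have at0hu: "ms_at_t0 (h - u) = ms_at_t0 h - ms_at_t0 u" by (rule mseries_eqI) simp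
    ultimately have ohu: "ord_ge (ms_at_t0 (h - u)) (k + c)"
      using ord_ge_diff[OF less.prems(2)] by simp
    have below: "expo_less \<beta> \<alpha>" if bt: "Poly_Mapping.lookup \<beta> 0 = 0" "coeff (h - u) \<beta> \<noteq> 0" for \<beta>
    proof -
      have "\<beta> \<noteq> \<alpha>"
      proof
        assume "\<beta> = \<alpha>"
        then have "\<beta> = \<gamma> + \<alpha>'" using g(2) by (simp add: add.commute)
        then have "coeff u \<beta> = q * coeff h' \<alpha>'" unfolding u_def by simp
        also have "\<dots> = coeff h \<beta>" using h'(3) \<open>\<beta> = \<alpha>\<close> by (simp add: q_def lead_at_t0_def)
        finally show False using bt(2) by simp
      qed
      moreover have "coeff h \<beta> \<noteq> 0 \<Longrightarrow> \<beta> = \<alpha> \<or> expo_less \<beta> \<alpha>"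
        using less.prems(3) bt(1) by (auto simp: lead_at_t0_def)
      moreover have "\<beta> = \<alpha> \<or> expo_less \<beta> \<alpha>" if nz: "coeff u \<beta> \<noteq> 0"
      proof -
        obtain \<delta> where d: "\<beta> = \<gamma> + \<delta>" using nz unfolding u_def coeff_monom_mult by (auto split: if_splits)
        then have "coeff h' \<delta> \<noteq> 0" "Poly_Mapping.lookup \<delta> 0 = 0" using nz bt(1) by (auto simp: u_def lookup_add)
        then have "\<delta> = \<alpha>' \<or> expo_less \<delta> \<alpha>'" using h'(3) by (auto simp: lead_at_t0_def)
        then show ?thesis using expo_less_add_left[of \<delta> \<alpha>' \<gamma>] unfolding d g(2) by (auto simp: add.commute)
      qed
      ultimately show ?thesis using bt(2) by fastforce
    qed
    show ?case
    proof (cases "ms_at_t0 (h - u) = 0")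
      case True
      then show ?thesis using u ou at0hu by (intro bexI[of _ u]) auto
    next
      case False
      obtain \<alpha>'' where a'': "lead_at_t0 (h - u) \<alpha>''" "\<alpha>'' \<in> expos V"
        using ex_lead_at_t0[OF monom_closedD(1)[OF T hu] V fin[OF hu] False] .
      then have "expo_less \<alpha>'' \<alpha>" using below by (auto simp: lead_at_t0_def)
      then have "expo_rank V \<alpha>'' < expo_rank V \<alpha>" using expo_rank_less[OF V a''(2)] by simp
      from less.hyps[OF this hu ohu a''] obtain v where
        v: "v \<in> T" "ord_ge v k" "ms_at_t0 v = ms_at_t0 (h - u)" by blast
      show ?thesis
      proof (intro bexI[of _ "v + u"] conjI)
        show "v + u \<in> T" by (rule monom_closedD(2)[OF T v(1) u])
        show "ord_ge (v + u) k" by (rule ord_ge_add[OF v(2) ou])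
        show "ms_at_t0 (v + u) = ms_at_t0 h" unfolding ms_at_t0_add v(3) at0hu by simp
      qed
    qed
  qed
  show ?thesis
  proof (rule that[of c])
    fix k h assume h: "h \<in> T" "ord_ge (ms_at_t0 h) (k + c)"
    show "\<exists>v\<in>T. ord_ge v k \<and> ms_at_t0 v = ms_at_t0 h"
    proof (cases "ms_at_t0 h = 0")
      case True
      moreover have "ms_at_t0 (0::'a mseries) = 0" by (rule mseries_eqI) simp
      ultimately show ?thesis using \<open>0 \<in> T\<close> by (intro bexI[of _ 0]) auto
    next
      case False
      obtain \<alpha> where "lead_at_t0 h \<alpha>" "\<alpha> \<in> expos V"
        using ex_lead_at_t0[OF monom_closedD(1)[OF T h(1)] V fin[OF h(1)] False] .
      then show ?thesis using main h by blast
    qed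
  qed
qed


subsection \<open>Generators of the strict transform\<close>

definition adic_closure :: "'a::comm_ring_1 mseries set \<Rightarrow> 'a mseries set"
  where "adic_closure T = {g. \<forall>k. \<exists>h\<in>T. ord_ge (g - h) k}"

text \<open>If \<open>u\<close> in \<open>T\<close> approximates \<open>t g\<close>, then
  \<open>u\<close> at \<open>t = 0\<close> has high order but need not vanish. Artin--Rees gives
  \<open>v\<close> in \<open>T\<close> of high order with the same restriction, so
  \<open>u - v\<close> still approximates \<open>t g\<close> and is divisible by \<open>t\<close>
  within \<open>T\<close>.\<close>

lemma adic_closure_divide_t:
  fixes T :: "'a::field mseries set"
  assumes V: "finite V" and T: "monom_closed V T"
    and fin: "\<And>h. h \<in> T \<Longrightarrow> finite {\<alpha>. coeff (ms_at_t0 h) \<alpha> \<noteq> 0}" and "0 \<in> T"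
    and sat: "\<And>h. h \<in> T \<Longrightarrow> t_ord_ge h 1 \<Longrightarrow> ms_divt 1 h \<in> T"
    and g: "ms_var 0 * g \<in> adic_closure T"
  shows "g \<in> adic_closure T"
proof -
  obtain c where c: "\<And>k h. h \<in> T \<Longrightarrow> ord_ge (ms_at_t0 h) (k + c) \<Longrightarrow>
    \<exists>v\<in>T. ord_ge v k \<and> ms_at_t0 v = ms_at_t0 h"
    using artin_rees_at_t0[OF V T fin \<open>0 \<in> T\<close>] by blast
  have coeff_t: "coeff (ms_var 0 * f) \<alpha> = 0" if "Poly_Mapping.lookup \<alpha> 0 = 0" for f :: "'a mseries" and \<alpha>
    using that by (auto simp: ms_var_eq_monom coeff_monom_mult lookup_add)
  have "\<exists>h\<in>T. ord_ge (g - h) k" for k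
  proof -
    \<comment> \<open>One extra order is lost in the division by \<open>t\<close>, and
      \<open>c\<close> of them in Artin--Rees.\<close>
    obtain u where u: "u \<in> T" "ord_ge (ms_var 0 * g - u) (Suc k + c)"
      using g unfolding adic_closure_def by blast
    have "ord_ge (ms_at_t0 u) (Suc k + c)" unfolding ord_ge_def
    proof (intro allI impI)
      fix \<alpha> assume "tdeg \<alpha> < Suc k + c"
      then have "coeff (ms_var 0 * g - u) \<alpha> = 0" using u(2) unfolding ord_ge_def by blast
      then show "coeff (ms_at_t0 u) \<alpha> = 0" using coeff_t[of \<alpha> g] by simp
    qed
    then obtain v where v: "v \<in> T" "ord_ge v (Suc k)" "ms_at_t0 v = ms_at_t0 u" using c[OF u(1)] by blast
    have uv: "u - v \<in> T" by (rule monom_closed_diff[OF T u(1) v(1)])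
    have tuv: "t_ord_ge (u - v) 1" unfolding t_ord_ge_def
    proof (intro allI impI)
      fix \<alpha> :: expo assume "Poly_Mapping.lookup \<alpha> 0 < 1"
      then show "coeff (u - v) \<alpha> = 0" using arg_cong[OF v(3), of "\<lambda>f. coeff f \<alpha>"] by simp
    qed
    define w where "w = ms_divt 1 (u - v)"
    have w: "w \<in> T" "ms_var 0 * w = u - v"
      using sat[OF uv tuv] t_power_mult_divt[OF tuv] by (auto simp: w_def)
    have "ms_var 0 * (g - w) = (ms_var 0 * g - u) + v" by (simp add: right_diff_distrib w(2))
    moreover have "ord_ge (ms_var 0 * g - u) (Suc k)" using u(2) by (rule ord_ge_mono) simp
    ultimately have o: "ord_ge (ms_var 0 * (g - w)) (Suc k)" using ord_ge_add v(2) by metis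
    have "ord_ge (g - w) k" unfolding ord_ge_def
    proof (intro allI impI)
      fix \<alpha> assume "tdeg \<alpha> < k"
      then have "coeff (ms_var 0 * (g - w)) (Poly_Mapping.single 0 1 + \<alpha>) = 0"
        using o unfolding ord_ge_def by (simp add: tdeg_add)
      then show "coeff (g - w) \<alpha> = 0" unfolding ms_var_eq_monom coeff_monom_mult_add by simp
    qed
    then show ?thesis using w(1) by blast
  qed
  then show ?thesis by (simp add: adic_closure_def)
qed

text \<open>Modulo terms of order \<open>k\<close> a convergent multiplier is a polynomial, and
  \<open>T\<close> is stable under polynomials.\<close>

lemma conv_ideal_adic_closure:
  fixes T :: "'a::real_normed_field mseries set"
  assumes V: "finite V" and T: "monom_closed V T" and "0 \<in> T"
  shows "conv_ideal V (adic_closure T \<inter> conv_series V)"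
  unfolding conv_ideal_def
proof (intro conjI ballI)
  have "0 \<in> adic_closure T" unfolding adic_closure_def using \<open>0 \<in> T\<close> by (auto intro!: bexI[of _ 0])
  then show "0 \<in> adic_closure T \<inter> conv_series V" by (simp add: conv_series_zero)
next
  fix f g :: "'a mseries" assume fg: "f \<in> adic_closure T \<inter> conv_series V" "g \<in> adic_closure T \<inter> conv_series V"
  have "\<exists>h\<in>T. ord_ge (f + g - h) k" for k
  proof -
    obtain h h' where h: "h \<in> T" "ord_ge (f - h) k" "h' \<in> T" "ord_ge (g - h') k"
      using fg unfolding adic_closure_def by blast
    have "f + g - (h + h') = (f - h) + (g - h')" by simp
    then have "ord_ge (f + g - (h + h')) k" using ord_ge_add[OF h(2,4)] by metis
    then show ?thesis using monom_closedD(2)[OF T h(1,3)] by blast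
  qed
  then show "f + g \<in> adic_closure T \<inter> conv_series V"
    using fg by (auto simp: adic_closure_def conv_series_add)
next
  fix f h :: "'a mseries" assume f: "f \<in> adic_closure T \<inter> conv_series V" and h: "h \<in> conv_series V"
  have "\<exists>u\<in>T. ord_ge (h * f - u) k" for k
  proof -
    obtain u where u: "u \<in> T" "ord_ge (f - u) k" using f unfolding adic_closure_def by blast
    define A where "A = {\<gamma> \<in> expos V. tdeg \<gamma> \<le> k}"
    have A: "finite A" unfolding A_def by (rule finite_expos_tdeg[OF V])
    define h' where "h' = (\<Sum>\<gamma>\<in>A. ms_monom (coeff h \<gamma>) \<gamma>)"
    have "(\<Sum>\<gamma>\<in>A'. ms_monom (coeff h \<gamma>) \<gamma> * u) \<in> T" if "finite A'" "A' \<subseteq> A" for A'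
      using that
    proof (induction A' rule: finite_induct)
      case (insert \<gamma> A')
      then show ?case using monom_closedD(2,3)[OF T] u(1) by (auto simp: A_def)
    qed (simp add: \<open>0 \<in> T\<close>)
    then have hu: "h' * u \<in> T" unfolding h'_def sum_distrib_right using A by blast
    have "ord_ge (h - h') k" unfolding ord_ge_def
    proof (intro allI impI)
      fix \<alpha> assume a: "tdeg \<alpha> < k"
      have "coeff h' \<alpha> = (if \<alpha> \<in> A then coeff h \<alpha> else 0)"
        unfolding h'_def coeff_sum coeff_monom using A by simp
      then show "coeff (h - h') \<alpha> = 0"
        using a supp_in_conv[OF h] by (auto simp: A_def supp_in_def)
    qed
    then have "ord_ge ((h - h') * u) k" using ord_ge_mult[of "h - h'" k u 0] by simp
    moreover have "ord_ge (h * (f - u)) k" by (rule ord_ge_mult_right[OF u(2)])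
    moreover have "h * f - h' * u = h * (f - u) + (h - h') * u" by (simp add: algebra_simps)
    ultimately have "ord_ge (h * f - h' * u) k" using ord_ge_add by metis
    then show ?thesis using hu by blast
  qed
  then show "h * f \<in> adic_closure T \<inter> conv_series V"
    using f h by (auto simp: adic_closure_def conv_series_mult)
qed auto

text \<open>Every \<open>d\<close> up to the order of \<open>f\<close> is allowed, not just the
  order itself. So multiplying \<open>f\<close> by \<open>t\<close> while keeping \<open>d\<close>
  stays inside the set, which gives stability under \<open>t\<close>.\<close>

definition strict_elems ::
    "nat \<Rightarrow> (nat \<Rightarrow> 'a::comm_ring_1) \<Rightarrow> 'a mseries set \<Rightarrow> 'a mseries set"
  where "strict_elems n a J = {ms_divt d (chart_subst n a f) | d f. f \<in> J \<and> ord_ge f d}"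

lemma strict_elemsI: "f \<in> J \<Longrightarrow> ord_ge f d \<Longrightarrow> ms_divt d (chart_subst n a f) \<in> strict_elems n a J"
  by (auto simp: strict_elems_def)

lemma strict_elemsE:
  assumes "h \<in> strict_elems n a J"
  obtains d f where "h = ms_divt d (chart_subst n a f)" "f \<in> J" "ord_ge f d"
  using assms by (auto simp: strict_elems_def)

context
  fixes n :: nat and a :: "nat \<Rightarrow> 'a::real_normed_field" and J :: "'a mseries set"
  assumes J: "conv_ideal {0..n} J"
begin

lemma strict_elems_conv: "h \<in> strict_elems n a J \<Longrightarrow> h \<in> conv_series {0..n}"
  by (erule strict_elemsE) (simp add: conv_series_divt conv_series_chart_subst conv_idealD(1)[OF J])

lemma ord_ge_t_power_mult:
  assumes "ord_ge (f :: 'a mseries) d"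
  shows "ord_ge (ms_var 0 ^ e * f) (d + e)"
  using ord_ge_mult[OF ord_ge_monom assms, of e "Poly_Mapping.single 0 e" 1]
  by (simp add: ms_var_power add.commute)

lemma t_power_conv: "ms_var 0 ^ e \<in> conv_series {0..n}"
  by (simp add: ms_var_power conv_series_monom single_in_expos)

text \<open>Extending the fraction by \<open>t^e\<close>, in order to bring two elements to a common
  denominator before adding them.\<close>

lemma strict_elems_raise:
  assumes "f \<in> J" "ord_ge f d"
  shows "ms_divt d (chart_subst n a f) = ms_divt (d + e) (chart_subst n a (ms_var 0 ^ e * f))"
    "ms_var 0 ^ e * f \<in> J" "ord_ge (ms_var 0 ^ e * f) (d + e)"
  using assms by (simp_all add: chart_subst_t_mult ms_divt_var_mult ord_ge_t_power_mult
    conv_idealD(4)[OF J] t_power_conv)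

lemma strict_elems_add:
  assumes "g \<in> strict_elems n a J" "h \<in> strict_elems n a J"
  shows "g + h \<in> strict_elems n a J"
proof -
  obtain d f where f: "g = ms_divt d (chart_subst n a f)" "f \<in> J" "ord_ge f d"
    using assms(1) by (rule strict_elemsE)
  obtain e f' where f': "h = ms_divt e (chart_subst n a f')" "f' \<in> J" "ord_ge f' e"
    using assms(2) by (rule strict_elemsE)
  let ?F = "ms_var 0 ^ e * f + ms_var 0 ^ d * f'"
  note r = strict_elems_raise[OF f(2,3), of e] strict_elems_raise[OF f'(2,3), of d, unfolded add.commute[of e d]]
  have "g + h = ms_divt (d + e) (chart_subst n a ?F)"
    unfolding f(1) f'(1) chart_subst_add ms_divt_add r(1) r(4) ..
  moreover have "?F \<in> J" using r by (intro conv_idealD(3)[OF J])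
  moreover have "ord_ge ?F (d + e)" using r by (intro ord_ge_add)
  ultimately show ?thesis by (simp add: strict_elemsI)
qed

lemma strict_elems_const_mult:
  assumes "h \<in> strict_elems n a J"
  shows "ms_const c * h \<in> strict_elems n a J"
proof -
  obtain d f where f: "h = ms_divt d (chart_subst n a f)" "f \<in> J" "ord_ge f d"
    using assms by (rule strict_elemsE)
  have "ms_const c * h = ms_divt d (chart_subst n a (ms_const c * f))"
    unfolding f(1) chart_subst_const_mult by (rule mseries_eqI) simp
  then show ?thesis
    using strict_elemsI[OF conv_ideal_const[OF J f(2), of c], of d n a] f(3) by (simp add: ord_ge_def)
qed

lemma strict_elems_t_mult:
  assumes "h \<in> strict_elems n a J"
  shows "ms_var 0 * h \<in> strict_elems n a J"
proof -
  obtain d f where f: "h = ms_divt d (chart_subst n a f)" "f \<in> J" "ord_ge f d"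
    using assms by (rule strict_elemsE)
  have t: "ms_var 0 * f \<in> J" "ord_ge (ms_var 0 * f) d"
    using f conv_idealD(4)[OF J f(2) t_power_conv[of 1]] ord_ge_mult_right by auto
  have "ms_var 0 * h = ms_divt d (chart_subst n a (ms_var 0 * f))"
  proof -
    have "ms_var 0 ^ d * ms_divt d (chart_subst n a f) = chart_subst n a f"
      by (rule t_power_mult_divt[OF t_ord_ge_chart_subst[OF f(3)]])
    then have "chart_subst n a (ms_var 0 * f) = ms_var 0 ^ d * (ms_var 0 * h)"
      using chart_subst_t_mult[of n a 1 f] unfolding f(1) by (simp add: mult.left_commute)
    then show ?thesis using ms_divt_var_mult[of 0 d "ms_var 0 * h"]
      by (simp add: mseries_eqI[of "ms_divt 0 _"])
  qed
  then show ?thesis using t strict_elemsI by metis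
qed

lemma strict_elems_x_mult:
  assumes "h \<in> strict_elems n a J" "1 \<le> l" "l \<le> n"
  shows "ms_var l * h \<in> strict_elems n a J"
proof -
  obtain d f where f: "h = ms_divt d (chart_subst n a f)" "f \<in> J" "ord_ge f d"
    using assms(1) by (rule strict_elemsE)
  \<comment> \<open>This multiplier has order one, so the allowed power of \<open>t\<close> grows by
    one. That cancels the factor \<open>t\<close> in its pull-back \<open>t X_l\<close>.\<close>
  let ?m = "ms_var l - ms_const (a l) * ms_var 0"
  have "ord_ge ?m 1" unfolding ms_var_eq_monom ms_const_eq_monom ms_monom_mult
    by (intro ord_ge_diff ord_ge_monom) (auto simp: tdeg_add)
  then have "ord_ge (?m * f) (1 + d)" by (rule ord_ge_mult[OF _ f(3)])
  moreover have "?m * f \<in> J"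
    unfolding left_diff_distrib ms_var_eq_monom ms_const_eq_monom ms_monom_mult using assms(2,3)
    by (intro conv_ideal_diff[OF J] conv_ideal_monom[OF J f(2)]) (auto simp: single_in_expos)
  ultimately have "ms_divt (1 + d) (chart_subst n a (?m * f)) \<in> strict_elems n a J"
    by (intro strict_elemsI)
  moreover have "ms_divt (1 + d) (chart_subst n a (?m * f)) = ms_divt d (ms_var l * chart_subst n a f)"
    unfolding chart_subst_x_mult[OF assms(2,3)]
    using ms_divt_var_mult[of d 1 "ms_var l * chart_subst n a f"] by (simp add: add.commute)
  moreover have "\<dots> = ms_var l * h"
    unfolding ms_var_eq_monom f(1) using assms(2) by (intro ms_divt_monom_mult) (simp add: lookup_single)
  ultimately show ?thesis by simp
qed

lemma strict_elems_monom_mult: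
  assumes "h \<in> strict_elems n a J" "\<gamma> \<in> expos {0..n}"
  shows "ms_monom c \<gamma> * h \<in> strict_elems n a J"
  using assms(2)
proof (induction "tdeg \<gamma>" arbitrary: \<gamma> rule: less_induct)
  case less
  show ?case
  proof (cases "\<gamma> = 0")
    case True
    then show ?thesis using strict_elems_const_mult[OF assms(1)] by (simp add: ms_const_eq_monom)
  next
    case False
    then obtain k where k: "Poly_Mapping.lookup \<gamma> k \<noteq> 0" by (metis poly_mapping_eqI lookup_zero)
    then have kn: "k \<le> n" using less.prems by (auto simp: expos_def in_keys_iff subset_iff)
    define \<delta> where "\<delta> = \<gamma> - Poly_Mapping.single k 1"
    have g: "\<gamma> = Poly_Mapping.single k 1 + \<delta>"
      by (rule poly_mapping_eqI) (use k in \<open>auto simp: \<delta>_def lookup_add lookup_minus lookup_single when_def\<close>)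
    have "\<delta> \<in> expos {0..n}" using less.prems unfolding g expos_add_iff by simp
    moreover have "tdeg \<delta> < tdeg \<gamma>" unfolding g tdeg_add by simp
    ultimately have d: "ms_monom c \<delta> * h \<in> strict_elems n a J" using less.hyps by blast
    have "ms_monom c \<gamma> * h = ms_var k * (ms_monom c \<delta> * h)"
      unfolding ms_var_eq_monom mult.assoc[symmetric] ms_monom_mult g by simp
    then show ?thesis using strict_elems_t_mult[OF d] strict_elems_x_mult[OF d, of k] kn
      by (cases "k = 0") auto
  qed
qed

lemma zero_in_strict_elems: "0 \<in> strict_elems n a J"
proof -
  have "ms_divt 0 (chart_subst n a 0) = 0"
    by (rule mseries_eqI) (simp add: coeff_chart_subst)
  then show ?thesis using strict_elemsI[OF conv_idealD(2)[OF J], of 0 n a] by simp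
qed

lemma monom_closed_strict_elems: "monom_closed {0..n} (strict_elems n a J)"
  unfolding monom_closed_def
  using strict_elems_add strict_elems_monom_mult supp_in_conv[OF strict_elems_conv] by blast

text \<open>Here the order of \<open>f\<close> can be read off from its pull-back, so no saturation of \<open>J\<close> is needed.\<close>

lemma strict_elems_divide_t:
  assumes "h \<in> strict_elems n a J" "t_ord_ge h 1"
  shows "ms_divt 1 h \<in> strict_elems n a J"
proof -
  obtain d f where f: "h = ms_divt d (chart_subst n a f)" "f \<in> J" "ord_ge f d"
    using assms(1) by (rule strict_elemsE)
  \<comment> \<open>Powers below \<open>t^d\<close> are absent by the order of \<open>f\<close>. The
    coefficient of \<open>t^d\<close> itself is \<open>h\<close> at \<open>t = 0\<close>, which
    vanishes by assumption.\<close>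
  have "t_ord_ge (chart_subst n a f) (Suc d)" unfolding t_ord_ge_def
  proof (intro allI impI)
    fix \<gamma> :: expo assume g: "Poly_Mapping.lookup \<gamma> 0 < Suc d"
    show "coeff (chart_subst n a f) \<gamma> = 0"
    proof (cases "Poly_Mapping.lookup \<gamma> 0 < d")
      case True
      then show ?thesis using t_ord_ge_chart_subst[OF f(3), of n a] unfolding t_ord_ge_def by blast
    next
      case False
      have x: "Poly_Mapping.lookup (x_part \<gamma>) 0 < 1" by (simp add: lookup_x_part)
      have "\<gamma> = x_part \<gamma> + Poly_Mapping.single 0 d"
        by (rule poly_mapping_eqI) (use g False in \<open>auto simp: lookup_x_part lookup_add lookup_single when_def\<close>)
      then have "coeff (chart_subst n a f) \<gamma> = coeff h (x_part \<gamma>)" unfolding f(1) by simp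
      also have "\<dots> = 0" using assms(2) x unfolding t_ord_ge_def by blast
      finally show ?thesis .
    qed
  qed
  then have "ord_ge f (1 + d)"
    using ord_ge_of_chart_subst[OF supp_in_conv[OF conv_idealD(1)[OF J f(2)]]] by simp
  then show ?thesis unfolding f(1) ms_divt_divt by (intro strict_elemsI f(2))
qed

text \<open>At \<open>t = 0\<close> only the form of degree \<open>d\<close> of \<open>f\<close>
  survives, evaluated at \<open>(1, a + X)\<close>: a polynomial of degree at most
  \<open>d\<close>.\<close>

lemma finite_strict_elems_at_t0:
  assumes "h \<in> strict_elems n a J"
  shows "finite {\<gamma>. coeff (ms_at_t0 h) \<gamma> \<noteq> 0}"
proof -
  obtain d f where f: "h = ms_divt d (chart_subst n a f)" "f \<in> J" "ord_ge f d"
    using assms by (rule strict_elemsE)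
  have "{\<gamma>. coeff (ms_at_t0 h) \<gamma> \<noteq> 0} \<subseteq> {\<gamma> \<in> expos {0..n}. tdeg \<gamma> \<le> d}"
  proof
    fix \<gamma> assume "\<gamma> \<in> {\<gamma>. coeff (ms_at_t0 h) \<gamma> \<noteq> 0}"
    then have g: "Poly_Mapping.lookup \<gamma> 0 = 0" "coeff h \<gamma> \<noteq> 0" by (auto split: if_splits)
    let ?\<delta> = "\<gamma> + Poly_Mapping.single 0 d"
    have d0: "Poly_Mapping.lookup ?\<delta> 0 = d" using g(1) by (simp add: lookup_add)
    have "coeff (chart_subst n a f) ?\<delta> \<noteq> 0" using g(2) unfolding f(1) by simp
    then obtain \<alpha> where a: "\<alpha> \<in> {\<alpha> \<in> expos {0..n}. tdeg \<alpha> = d}"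
      "coeff f \<alpha> * coeff (chart_monom n a \<alpha>) ?\<delta> \<noteq> 0"
      unfolding coeff_chart_subst d0 by (rule sum.not_neutral_contains_not_neutral)
    then have nz: "coeff (chart_monom n a \<alpha>) ?\<delta> \<noteq> 0" and aE: "\<alpha> \<in> expos {0..n}" "tdeg \<alpha> = d" by auto
    have "Poly_Mapping.lookup \<gamma> k \<le> Poly_Mapping.lookup \<alpha> k" for k
      using chart_monom_props(2)[OF aE(1) nz, of k] g(1) by (cases "k = 0") (auto simp: lookup_add lookup_single)
    then obtain \<epsilon> where "\<alpha> = \<gamma> + \<epsilon>" using expo_le_iff[of \<alpha> UNIV \<gamma>] by (auto simp: expos_def)
    then show "\<gamma> \<in> {\<gamma> \<in> expos {0..n}. tdeg \<gamma> \<le> d}" using aE by (auto simp: tdeg_add expos_add_iff)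
  qed
  then show ?thesis by (rule finite_subset) (rule finite_expos_tdeg, simp)
qed

section \<open>Comparison with the strict transform\<close>

lemma chart_subst_image_conv: "chart_subst n a ` J \<subseteq> conv_series {0..n}"
  using conv_series_chart_subst conv_idealD(1)[OF J] by blast

text \<open>The convergent elements of the closure form an ideal containing the pull-backs (the case
  \<open>d = 0\<close>), hence the ideal they generate. The power \<open>t^m\<close> is then
  cancelled one factor at a time by \<open>adic_closure_divide_t\<close>.\<close>

lemma strict_transform_subset_closure: "strict_transform n a J \<subseteq> adic_closure (strict_elems n a J)"
proof
  let ?T = "strict_elems n a J"
  fix g assume "g \<in> strict_transform n a J"
  then obtain m where m: "ms_var 0 ^ m * g \<in> Idl\<^bsub>conv_ring {0..n}\<^esub> (chart_subst n a ` J)"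
    by (auto simp: strict_transform_def)
  have id: "conv_ideal {0..n} (adic_closure ?T \<inter> conv_series {0..n})"
    by (rule conv_ideal_adic_closure[OF _ monom_closed_strict_elems zero_in_strict_elems]) simp
  have "chart_subst n a f \<in> adic_closure ?T" if "f \<in> J" for f
  proof -
    have "ms_divt 0 (chart_subst n a f) = chart_subst n a f" by (rule mseries_eqI) simp
    then have "chart_subst n a f \<in> ?T" using strict_elemsI[OF that, of 0 n a] by simp
    then show ?thesis unfolding adic_closure_def by (auto intro!: bexI[of _ "chart_subst n a f"])
  qed
  then have "chart_subst n a ` J \<subseteq> adic_closure ?T \<inter> conv_series {0..n}"
    using chart_subst_image_conv by blast
  from Idl_minimal[OF id this] m have "ms_var 0 ^ m * g \<in> adic_closure ?T" by blast
  then show "g \<in> adic_closure ?T"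
  proof (induction m)
    case (Suc m)
    then have "ms_var 0 * (ms_var 0 ^ m * g) \<in> adic_closure ?T" by (simp add: mult.assoc)
    from adic_closure_divide_t[OF _ monom_closed_strict_elems finite_strict_elems_at_t0
        zero_in_strict_elems strict_elems_divide_t this]
    show ?case using Suc.IH by simp
  qed simp
qed

lemma strict_elems_subset_strict_transform: "strict_elems n a J \<subseteq> strict_transform n a J"
proof
  fix h assume h: "h \<in> strict_elems n a J"
  then obtain d f where f: "h = ms_divt d (chart_subst n a f)" "f \<in> J" "ord_ge f d"
    by (rule strict_elemsE)
  have "ms_var 0 ^ d * h = chart_subst n a f"
    unfolding f(1) by (rule t_power_mult_divt[OF t_ord_ge_chart_subst[OF f(3)]])
  then have "ms_var 0 ^ d * h \<in> Idl\<^bsub>conv_ring {0..n}\<^esub> (chart_subst n a ` J)"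
    using Idl_self[OF chart_subst_image_conv] f(2) by auto
  then show "h \<in> strict_transform n a J"
    using strict_elems_conv[OF h] by (auto simp: strict_transform_def)
qed

lemma conv_ideal_strict_transform: "conv_ideal {0..n} (strict_transform n a J)"
proof -
  let ?I = "Idl\<^bsub>conv_ring {0..n}\<^esub> (chart_subst n a ` J)"
  have I: "conv_ideal {0..n} ?I" by (rule conv_ideal_Idl[OF chart_subst_image_conv])
  show ?thesis unfolding conv_ideal_def
  proof (intro conjI ballI)
    show "strict_transform n a J \<subseteq> conv_series {0..n}" by (auto simp: strict_transform_def)
    show "0 \<in> strict_transform n a J"
      using conv_idealD(2)[OF I] by (simp add: strict_transform_def conv_series_zero)
  next
    fix f g assume fg: "f \<in> strict_transform n a J" "g \<in> strict_transform n a J"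
    then obtain l m where l: "ms_var 0 ^ l * f \<in> ?I" and m: "ms_var 0 ^ m * g \<in> ?I"
      by (auto simp: strict_transform_def)
    have "ms_var 0 ^ m * (ms_var 0 ^ l * f) + ms_var 0 ^ l * (ms_var 0 ^ m * g) \<in> ?I"
      by (intro conv_idealD(3,4)[OF I] l m t_power_conv)
    then have "ms_var 0 ^ (l + m) * (f + g) \<in> ?I"
      by (simp add: power_add distrib_left distrib_right mult_ac)
    then show "f + g \<in> strict_transform n a J"
      using fg by (auto simp: strict_transform_def conv_series_add)
  next
    fix f h :: "'a mseries" assume fh: "f \<in> strict_transform n a J" "h \<in> conv_series {0..n}"
    then obtain l where l: "ms_var 0 ^ l * f \<in> ?I" by (auto simp: strict_transform_def)
    have "h * (ms_var 0 ^ l * f) \<in> ?I" by (rule conv_idealD(4)[OF I l fh(2)])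
    then have "ms_var 0 ^ l * (h * f) \<in> ?I" by (simp add: mult.left_commute)
    then show "h * f \<in> strict_transform n a J"
      using fh by (auto simp: strict_transform_def conv_series_mult)
  qed
qed

end


subsection \<open>Polynomial functions\<close>

lemma poly_eval_superset:
  assumes "finite M" "Poly_Mapping.keys p \<subseteq> M"
  shows "poly_eval p x = (\<Sum>m\<in>M. Poly_Mapping.lookup p m *
    (\<Prod>v\<in>Poly_Mapping.keys m. x v ^ Poly_Mapping.lookup m v))"
  unfolding poly_eval_def by (rule sum.mono_neutral_left) (use assms in \<open>auto simp: in_keys_iff\<close>)

lemma poly_eval_add: "poly_eval (p + q) x = poly_eval p x + poly_eval q x"
proof -
  let ?M = "Poly_Mapping.keys p \<union> Poly_Mapping.keys q"
  show ?thesis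
    using poly_eval_superset[of ?M p x] poly_eval_superset[of ?M q x]
      poly_eval_superset[of ?M "p + q" x] Poly_Mapping.keys_add[of p q]
    by (simp add: lookup_add distrib_right sum.distrib)
qed

lemma poly_eval_zero [simp]: "poly_eval 0 x = 0"
  by (simp add: poly_eval_def)

lemma poly_eval_sum: "poly_eval (\<Sum>i\<in>A. p i) x = (\<Sum>i\<in>A. poly_eval (p i) x)"
  by (induction A rule: infinite_finite_induct) (auto simp: poly_eval_add)

lemma poly_eval_single:
  "poly_eval (Poly_Mapping.single m c) x =
    c * (\<Prod>v\<in>Poly_Mapping.keys m. x v ^ Poly_Mapping.lookup m v)"
  by (subst poly_eval_superset[of "{m}"]) auto

lemma monom_eval_add:
  fixes x :: "'v \<Rightarrow> 'a::comm_ring_1" and m m' :: "'v \<Rightarrow>\<^sub>0 nat"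
  shows "(\<Prod>v\<in>Poly_Mapping.keys (m + m'). x v ^ Poly_Mapping.lookup (m + m') v) =
    (\<Prod>v\<in>Poly_Mapping.keys m. x v ^ Poly_Mapping.lookup m v) *
    (\<Prod>v\<in>Poly_Mapping.keys m'. x v ^ Poly_Mapping.lookup m' v)"
proof -
  let ?M = "Poly_Mapping.keys m \<union> Poly_Mapping.keys m'"
  have *: "(\<Prod>v\<in>Poly_Mapping.keys k. x v ^ Poly_Mapping.lookup k v) =
      (\<Prod>v\<in>?M. x v ^ Poly_Mapping.lookup k v)" if "Poly_Mapping.keys k \<subseteq> ?M" for k :: "'v \<Rightarrow>\<^sub>0 nat"
    by (rule prod.mono_neutral_left) (use that in \<open>auto simp: in_keys_iff\<close>)
  have "Poly_Mapping.keys (m + m') \<subseteq> ?M" by (rule Poly_Mapping.keys_add)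
  from *[OF this] *[of m] *[of m'] show ?thesis
    by (simp add: lookup_add power_add prod.distrib)
qed

lemma poly_mapping_eq_sum_single:
  "p = (\<Sum>m\<in>Poly_Mapping.keys p. Poly_Mapping.single m (Poly_Mapping.lookup p m))"
  by (rule poly_mapping_eqI) (auto simp: lookup_sum lookup_single when_def in_keys_iff)

lemma poly_eval_mult:
  fixes p q :: "('v \<Rightarrow>\<^sub>0 nat) \<Rightarrow>\<^sub>0 'a::comm_ring_1"
  shows "poly_eval (p * q) x = poly_eval p x * poly_eval q x"
proof -
  have "p * q = (\<Sum>m\<in>Poly_Mapping.keys p. \<Sum>m'\<in>Poly_Mapping.keys q.
      Poly_Mapping.single (m + m') (Poly_Mapping.lookup p m * Poly_Mapping.lookup q m'))"
    by (subst poly_mapping_eq_sum_single[of p], subst poly_mapping_eq_sum_single[of q])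
      (simp add: sum_product mult_single)
  then have "poly_eval (p * q) x = (\<Sum>m\<in>Poly_Mapping.keys p. \<Sum>m'\<in>Poly_Mapping.keys q.
      Poly_Mapping.lookup p m * Poly_Mapping.lookup q m' *
      (\<Prod>v\<in>Poly_Mapping.keys (m + m'). x v ^ Poly_Mapping.lookup (m + m') v))"
    by (simp add: poly_eval_sum poly_eval_single)
  also have "\<dots> = poly_eval p x * poly_eval q x"
    unfolding poly_eval_def sum_product monom_eval_add by (simp add: mult_ac)
  finally show ?thesis .
qed

text \<open>Functions in place of polynomials: sections can then be written as plain lambda terms,
  with closure rules that work by introduction.\<close>

definition polyfun :: "'v set \<Rightarrow> (('v \<Rightarrow> 'a::comm_ring_1) \<Rightarrow> 'a) \<Rightarrow> bool"
  where "polyfun S h \<longleftrightarrow> (\<exists>p\<in>polys S. \<forall>x. h x = poly_eval p x)"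

lemma polyfun_const: "polyfun S (\<lambda>x. c)"
  unfolding polyfun_def
  by (rule bexI[of _ "Poly_Mapping.single 0 c"]) (auto simp: poly_eval_single polys_def)

lemma polyfun_var:
  assumes "v \<in> S"
  shows "polyfun S (\<lambda>x. x v)"
  unfolding polyfun_def
  by (rule bexI[of _ "Poly_Mapping.single (Poly_Mapping.single v 1) 1"])
    (use assms in \<open>auto simp: poly_eval_single polys_def\<close>)

lemma polyfun_add: "polyfun S g \<Longrightarrow> polyfun S h \<Longrightarrow> polyfun S (\<lambda>x. g x + h x)"
proof -
  assume "polyfun S g" "polyfun S h"
  then obtain p q where p: "p \<in> polys S" "\<forall>x. g x = poly_eval p x"
    and q: "q \<in> polys S" "\<forall>x. h x = poly_eval q x" by (auto simp: polyfun_def)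
  have "p + q \<in> polys S" using p(1) q(1) Poly_Mapping.keys_add[of p q] unfolding polys_def by blast
  then show ?thesis using p(2) q(2) unfolding polyfun_def
    by (intro bexI[of _ "p + q"]) (auto simp: poly_eval_add)
qed

lemma polyfun_mult: "polyfun S g \<Longrightarrow> polyfun S h \<Longrightarrow> polyfun S (\<lambda>x. g x * h x)"
proof -
  assume "polyfun S g" "polyfun S h"
  then obtain p q where p: "p \<in> polys S" "\<forall>x. g x = poly_eval p x"
    and q: "q \<in> polys S" "\<forall>x. h x = poly_eval q x" by (auto simp: polyfun_def)
  have "p * q \<in> polys S" unfolding polys_def
  proof (intro CollectI ballI)
    fix m assume "m \<in> Poly_Mapping.keys (p * q)"
    then obtain a b where "m = a + b" "a \<in> Poly_Mapping.keys p" "b \<in> Poly_Mapping.keys q"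
      using Poly_Mapping.keys_mult[of p q] by blast
    then show "Poly_Mapping.keys m \<subseteq> S"
      using p(1) q(1) Poly_Mapping.keys_add[of a b] unfolding polys_def by blast
  qed
  then show ?thesis using p(2) q(2) unfolding polyfun_def
    by (intro bexI[of _ "p * q"]) (auto simp: poly_eval_mult)
qed

lemma polyfun_diff: "polyfun S g \<Longrightarrow> polyfun S h \<Longrightarrow> polyfun S (\<lambda>x. g x - h x)"
  using polyfun_add[of S g "\<lambda>x. - 1 * h x"] polyfun_mult[OF polyfun_const[of S "- 1"], of h] by simp

lemma polyfun_sum: "(\<And>i. i \<in> A \<Longrightarrow> polyfun S (h i)) \<Longrightarrow> polyfun S (\<lambda>x. \<Sum>i\<in>A. h i x)"
  by (induction A rule: infinite_finite_induct) (auto simp: polyfun_const polyfun_add)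

lemma polyfun_prod: "(\<And>i. i \<in> A \<Longrightarrow> polyfun S (h i)) \<Longrightarrow> polyfun S (\<lambda>x. \<Prod>i\<in>A. h i x)"
  by (induction A rule: infinite_finite_induct) (auto simp: polyfun_const polyfun_mult)


subsection \<open>Polynomial families of power series\<close>

text \<open>The degrees in the arc may grow with \<open>\<alpha>\<close>. Each application inspects
  finitely many coefficients.\<close>

definition poly_family :: "'v set \<Rightarrow> (('v \<Rightarrow> 'a::comm_ring_1) \<Rightarrow> 'a mseries) \<Rightarrow> bool"
  where "poly_family S p \<longleftrightarrow> (\<forall>\<alpha>. polyfun S (\<lambda>x. coeff (p x) \<alpha>))"

lemma poly_family_coeff: "poly_family S p \<Longrightarrow> polyfun S (\<lambda>x. coeff (p x) \<alpha>)"
  by (simp add: poly_family_def)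

lemma poly_family_const: "poly_family S (\<lambda>x. f)"
  by (simp add: poly_family_def polyfun_const)

lemma poly_family_add: "poly_family S p \<Longrightarrow> poly_family S q \<Longrightarrow> poly_family S (\<lambda>x. p x + q x)"
  by (simp add: poly_family_def polyfun_add)

lemma poly_family_diff: "poly_family S p \<Longrightarrow> poly_family S q \<Longrightarrow> poly_family S (\<lambda>x. p x - q x)"
  by (simp add: poly_family_def polyfun_diff)

lemma poly_family_scale: "polyfun S c \<Longrightarrow> poly_family S p \<Longrightarrow> poly_family S (\<lambda>x. ms_const (c x) * p x)"
  by (simp add: poly_family_def polyfun_mult)

lemma poly_family_sum:
  "(\<And>i. i \<in> A \<Longrightarrow> poly_family S (p i)) \<Longrightarrow> poly_family S (\<lambda>x. \<Sum>i\<in>A. p i x)"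
  by (simp add: poly_family_def polyfun_sum)

lemma poly_family_mult:
  assumes "poly_family S p" "poly_family S q"
  shows "poly_family S (\<lambda>x. p x * q x)"
  unfolding poly_family_def coeff_mult split_def
  by (intro allI polyfun_sum polyfun_mult poly_family_coeff assms)

lemma poly_family_power: "poly_family S p \<Longrightarrow> poly_family S (\<lambda>x. p x ^ m)"
  by (induction m) (auto simp: poly_family_const poly_family_mult)

lemma poly_family_prod:
  "(\<And>i. i \<in> A \<Longrightarrow> poly_family S (p i)) \<Longrightarrow> poly_family S (\<lambda>x. \<Prod>i\<in>A. p i x)"
  by (induction A rule: infinite_finite_induct) (auto simp: poly_family_const poly_family_mult)

lemma poly_family_ms_const:
  assumes "polyfun S c"
  shows "poly_family S (\<lambda>x. ms_const (c x))"
  using poly_family_scale[OF assms poly_family_const[of S 1]] by simp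

lemma poly_family_chart_monom:
  assumes "\<And>l. l \<in> {1..n} \<Longrightarrow> polyfun S (\<lambda>x. a x l)"
  shows "poly_family S (\<lambda>x. chart_monom n (a x) \<alpha>)"
  unfolding chart_monom_def
proof (intro poly_family_prod poly_family_power)
  fix k assume k: "k \<in> {0..n}"
  show "poly_family S (\<lambda>x. blowup_chart (a x) k)"
  proof (cases "k = 0")
    case True
    then show ?thesis by (simp add: blowup_chart_def poly_family_const)
  next
    case False
    then show ?thesis using k unfolding blowup_chart_def
      by (auto intro!: poly_family_mult poly_family_add poly_family_const poly_family_ms_const assms)
  qed
qed

lemma poly_family_chart_subst:
  assumes "\<And>l. l \<in> {1..n} \<Longrightarrow> polyfun S (\<lambda>x. a x l)" "poly_family S q"
  shows "poly_family S (\<lambda>x. chart_subst n (a x) (q x))"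
  unfolding poly_family_def coeff_chart_subst
  by (intro allI polyfun_sum polyfun_mult poly_family_coeff assms(2) poly_family_chart_monom assms(1))

lemma poly_family_divt: "poly_family S q \<Longrightarrow> poly_family S (\<lambda>x. ms_divt d (q x))"
  by (simp add: poly_family_def)


subsection \<open>Families of ideals spanned by polynomial sections\<close>

definition ideal_section ::
    "'v set \<Rightarrow> ('v \<Rightarrow> 'a) set \<Rightarrow> (('v \<Rightarrow> 'a) \<Rightarrow> 'a::comm_ring_1 mseries set) \<Rightarrow>
      (('v \<Rightarrow> 'a) \<Rightarrow> 'a mseries) \<Rightarrow> bool"
  where "ideal_section S U J p \<longleftrightarrow> poly_family S p \<and> (\<forall>x\<in>U. p x \<in> J x)"

text \<open>The approximation at the single point \<open>x\<close> is by one section valid on all of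
  \<open>U\<close>. Approximation replaces equality because the strict transform is reached only
  through a closure.\<close>

definition poly_spanned ::
    "'v set \<Rightarrow> ('v \<Rightarrow> 'a) set \<Rightarrow> (('v \<Rightarrow> 'a) \<Rightarrow> 'a::comm_ring_1 mseries set) \<Rightarrow> bool"
  where "poly_spanned S U J \<longleftrightarrow>
    (\<forall>x\<in>U. \<forall>f\<in>J x. \<forall>k. \<exists>p. ideal_section S U J p \<and> ord_ge (p x - f) k)"

lemma poly_spanned_subset:
  assumes "poly_spanned S U J" "U' \<subseteq> U"
  shows "poly_spanned S U' J"
  unfolding poly_spanned_def
proof (intro ballI allI)
  fix x f k assume "x \<in> U'" "f \<in> J x"
  then obtain p where "ideal_section S U J p" "ord_ge (p x - f) k"
    using assms unfolding poly_spanned_def by blast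
  then show "\<exists>p. ideal_section S U' J p \<and> ord_ge (p x - f) k"
    using assms(2) unfolding ideal_section_def by blast
qed

lemma ord_ge_initial_expo:
  assumes "supp_in V f" "finite V" "f \<noteq> 0" "d \<le> tdeg (initial_expo f)"
  shows "ord_ge f d"
  unfolding ord_ge_def
proof (intro allI impI, rule ccontr)
  fix \<alpha> assume "tdeg \<alpha> < d" "coeff f \<alpha> \<noteq> 0"
  then show False
    using initial_expo_props(2)[OF assms(1-3), of \<alpha>] expo_less_tdeg[of "initial_expo f" \<alpha>] assms(4) by auto
qed

context
  fixes n :: nat and S :: "'v set" and U :: "('v \<Rightarrow> 'a::real_normed_field) set"
    and J :: "('v \<Rightarrow> 'a) \<Rightarrow> 'a mseries set"
  assumes J: "\<And>x. x \<in> U \<Longrightarrow> conv_ideal {0..n} (J x)" and span: "poly_spanned S U J"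
begin

lemma ideal_section_scale:
  "polyfun S c \<Longrightarrow> ideal_section S U J p \<Longrightarrow> ideal_section S U J (\<lambda>x. ms_const (c x) * p x)"
  unfolding ideal_section_def using conv_ideal_const[OF J] poly_family_scale by blast

lemma ideal_section_diff:
  "ideal_section S U J p \<Longrightarrow> ideal_section S U J q \<Longrightarrow> ideal_section S U J (\<lambda>x. p x - q x)"
  unfolding ideal_section_def using conv_ideal_diff[OF J] poly_family_diff by blast

lemma ideal_section_sum:
  assumes "\<And>i. i \<in> A \<Longrightarrow> ideal_section S U J (p i)"
  shows "ideal_section S U J (\<lambda>x. \<Sum>i\<in>A. p i x)"
  using assms unfolding ideal_section_def by (auto intro!: poly_family_sum conv_ideal_sum[OF J])

lemma J_supp: "x \<in> U \<Longrightarrow> f \<in> J x \<Longrightarrow> supp_in {0..n} f"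
  using supp_in_conv conv_idealD(1)[OF J] by blast

text \<open>Gaussian elimination, fraction-free so that the sections stay polynomial.\<close>

lemma eliminated_sections:
  assumes x0: "x0 \<in> U" and "finite F" "F \<subseteq> diagram (J x0)"
  shows "\<exists>q. \<forall>\<alpha>\<in>F. ideal_section S U J (q \<alpha>) \<and> coeff (q \<alpha> x0) \<alpha> \<noteq> 0 \<and>
    (\<forall>x\<in>U. \<forall>\<beta>\<in>F. \<beta> \<noteq> \<alpha> \<longrightarrow> coeff (q \<alpha> x) \<beta> = 0)"
  using assms(2,3)
proof (induction F rule: finite_ranking_induct[where f = "expo_rank {0..n}"])
  case empty
  show ?case by simp
next
  case (insert \<gamma> F)
  show ?case
  proof (cases "\<gamma> \<in> F")
    case True
    then show ?thesis using insert by (simp add: insert_absorb)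
  next
    case False
    let ?V = "{0..n}"
    have E: "insert \<gamma> F \<subseteq> expos ?V"
      using insert.prems up_closed_diagram[OF J[OF x0]] by (auto simp: up_closed_def)
    \<comment> \<open>The ranking induction inserts exponents in increasing order, so the new
      \<open>\<gamma>\<close> comes after all of \<open>F\<close>.\<close>
    have less: "expo_less \<alpha> \<gamma>" if "\<alpha> \<in> F" for \<alpha>
    proof -
      have "\<alpha> \<noteq> \<gamma>" "\<not> expo_less \<gamma> \<alpha>"
        using that False insert.hyps(2)[OF that] expo_rank_less[of ?V \<gamma> \<alpha>] E by auto
      then show ?thesis using expo_less_linear[of \<alpha> \<gamma>] by blast
    qed
    obtain q where q: "\<And>\<alpha>. \<alpha> \<in> F \<Longrightarrow> ideal_section S U J (q \<alpha>)"
      "\<And>\<alpha>. \<alpha> \<in> F \<Longrightarrow> coeff (q \<alpha> x0) \<alpha> \<noteq> 0"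
      "\<And>\<alpha> \<beta> x. \<alpha> \<in> F \<Longrightarrow> x \<in> U \<Longrightarrow> \<beta> \<in> F \<Longrightarrow> \<beta> \<noteq> \<alpha> \<Longrightarrow> coeff (q \<alpha> x) \<beta> = 0"
      using insert.IH insert.prems by auto
    obtain f where f: "f \<in> J x0" "f \<noteq> 0" "\<gamma> = initial_expo f"
      using insert.prems by (auto simp: diagram_def)
    note fp = initial_expo_props[OF J_supp[OF x0 f(1)] _ f(2), folded f(3), simplified]
    \<comment> \<open>Precision beyond the degree of \<open>\<gamma>\<close>: at \<open>x0\<close>
      the coefficients of \<open>p\<close> agree with those of \<open>f\<close> up to
      \<open>\<gamma>\<close>, in particular they vanish on \<open>F\<close>.\<close>
    obtain p where p: "ideal_section S U J p" "ord_ge (p x0 - f) (Suc (tdeg \<gamma>))"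
      using span x0 f(1) unfolding poly_spanned_def by blast
    have px0: "coeff (p x0) \<alpha> = coeff f \<alpha>" if "tdeg \<alpha> \<le> tdeg \<gamma>" for \<alpha>
      using p(2) that by (simp add: ord_ge_def)
    define c where "c \<alpha> x = coeff (q \<alpha> x) \<alpha>" for \<alpha> x
    \<comment> \<open>\<open>D\<close> is the product of the old pivots \<open>c \<alpha>\<close>,
      and \<open>e \<alpha>\<close> is chosen so that
      \<open>e \<alpha> * c \<alpha> = D * coeff p \<alpha>\<close>. So
      \<open>D p - \<Sum> e q\<close> vanishes on \<open>F\<close> without any division.\<close>
    define D where "D x = (\<Prod>\<alpha>\<in>F. c \<alpha> x)" for x
    define e where "e \<alpha> x = coeff (p x) \<alpha> * (\<Prod>\<beta>\<in>F - {\<alpha>}. c \<beta> x)" for \<alpha> x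
    have pc: "polyfun S (c \<alpha>)" if "\<alpha> \<in> F" for \<alpha>
      unfolding c_def using q(1)[OF that] by (simp add: ideal_section_def poly_family_coeff)
    have pD: "polyfun S D" unfolding D_def by (rule polyfun_prod[OF pc])
    have pe: "polyfun S (e \<alpha>)" for \<alpha>
      unfolding e_def using p(1)
      by (intro polyfun_mult polyfun_prod pc) (auto simp: ideal_section_def poly_family_coeff)
    define p' where "p' x = ms_const (D x) * p x - (\<Sum>\<alpha>\<in>F. ms_const (e \<alpha> x) * q \<alpha> x)" for x
    have sp': "ideal_section S U J p'"
      unfolding p'_def by (intro ideal_section_diff ideal_section_sum ideal_section_scale pD pe p(1) q(1))
    have p'F: "coeff (p' x) \<beta> = 0" if "x \<in> U" "\<beta> \<in> F" for x \<beta>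
    proof -
      have "(\<Sum>\<alpha>\<in>F. e \<alpha> x * coeff (q \<alpha> x) \<beta>) = (\<Sum>\<alpha>\<in>F. if \<alpha> = \<beta> then e \<beta> x * c \<beta> x else 0)"
        by (rule sum.cong) (use q(3) that in \<open>auto simp: c_def\<close>)
      also have "\<dots> = e \<beta> x * c \<beta> x" using that(2) insert.hyps(1) by simp
      also have "\<dots> = D x * coeff (p x) \<beta>"
        unfolding e_def D_def prod.remove[OF insert.hyps(1) that(2)] by (simp add: mult_ac)
      finally show ?thesis by (simp add: p'_def)
    qed
    have p'x0: "coeff (p' x0) \<gamma> \<noteq> 0"
    proof -
      have "e \<alpha> x0 = 0" if "\<alpha> \<in> F" for \<alpha>
      proof -
        have "coeff f \<alpha> = 0"
          using fp(2)[of \<alpha>] less[OF that] expo_less_trans[of \<gamma> \<alpha> \<gamma>] by auto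
        then show ?thesis using px0[OF expo_less_tdeg[OF less[OF that]]] by (simp add: e_def)
      qed
      then have "coeff (p' x0) \<gamma> = D x0 * coeff f \<gamma>" using px0[of \<gamma>] by (simp add: p'_def)
      moreover have "D x0 \<noteq> 0" using q(2) insert.hyps(1) by (simp add: D_def c_def)
      ultimately show ?thesis using fp(1) by simp
    qed
    \<comment> \<open>Cross-multiplication clears the coefficient at \<open>\<gamma>\<close> from
      the old sections. Since \<open>p'\<close> vanishes on \<open>F\<close>, each old pivot is only
      multiplied by the new one, which is nonzero at \<open>x0\<close>.\<close>
    define q' where "q' \<alpha> = (if \<alpha> = \<gamma> then p' else
        (\<lambda>x. ms_const (coeff (p' x) \<gamma>) * q \<alpha> x - ms_const (coeff (q \<alpha> x) \<gamma>) * p' x))" for \<alpha>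
    show ?thesis
    proof (intro exI[of _ q'] ballI conjI impI)
      fix \<alpha> assume a: "\<alpha> \<in> insert \<gamma> F"
      show "ideal_section S U J (q' \<alpha>)"
      proof (cases "\<alpha> = \<gamma>")
        case True
        then show ?thesis using sp' by (simp add: q'_def)
      next
        case ne: False
        then have "ideal_section S U J (q \<alpha>)" using a q(1) by simp
        then have "ideal_section S U J
            (\<lambda>x. ms_const (coeff (p' x) \<gamma>) * q \<alpha> x - ms_const (coeff (q \<alpha> x) \<gamma>) * p' x)"
          using sp' by (intro ideal_section_diff ideal_section_scale)
            (auto simp: ideal_section_def poly_family_coeff)
        then show ?thesis using ne by (simp add: q'_def)
      qed
      show "coeff (q' \<alpha> x0) \<alpha> \<noteq> 0"
        using a p'x0 q(2)[of \<alpha>] p'F[OF x0, of \<alpha>] by (auto simp: q'_def)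
      fix x \<beta> assume "x \<in> U" "\<beta> \<in> insert \<gamma> F" "\<beta> \<noteq> \<alpha>"
      then show "coeff (q' \<alpha> x) \<beta> = 0"
        using a q(3)[of \<alpha> x \<beta>] p'F[of x \<beta>] by (auto simp: q'_def)
    qed
  qed
qed

text \<open>\<open>D\<close> is the product of the pivots. Where it is nonzero, suppose the first
  exponent \<open>\<alpha>\<close> of \<open>N\<close> missing from the diagram exists. It is a
  vertex of \<open>N\<close>, so some section has pivot \<open>\<alpha>\<close>. The initial
  exponent of that section lies in the diagram, so it precedes \<open>\<alpha>\<close> strictly and
  belongs to \<open>N\<close>. There the section was made to vanish, a contradiction.\<close>

lemma min_diagram_open:
  assumes x0: "x0 \<in> U" and N: "diagram (J x0) = N"
    and min: "\<forall>x\<in>U. diagram (J x) \<noteq> N \<longrightarrow> first_diff_less N (diagram (J x))"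
  obtains D where "polyfun S D" "D x0 \<noteq> 0" "\<forall>x\<in>U. D x \<noteq> 0 \<longrightarrow> diagram (J x) = N"
proof -
  let ?V = "{0..n}"
  have up: "up_closed ?V N" using up_closed_diagram[OF J[OF x0]] N by simp
  \<comment> \<open>The largest degree of a vertex, so that \<open>F\<close> contains all vertices
    and everything of \<open>N\<close> before them.\<close>
  define d where "d = Max (insert 0 (tdeg ` min_expos ?V N))"
  define F where "F = {\<alpha> \<in> N. tdeg \<alpha> \<le> d}"
  have "F \<subseteq> {\<alpha> \<in> expos ?V. tdeg \<alpha> \<le> d}" using up by (auto simp: F_def up_closed_def)
  then have F: "finite F" by (rule finite_subset) (rule finite_expos_tdeg, simp)
  obtain q where q: "\<And>\<alpha>. \<alpha> \<in> F \<Longrightarrow> ideal_section S U J (q \<alpha>)"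
    "\<And>\<alpha>. \<alpha> \<in> F \<Longrightarrow> coeff (q \<alpha> x0) \<alpha> \<noteq> 0"
    "\<And>\<alpha> \<beta> x. \<alpha> \<in> F \<Longrightarrow> x \<in> U \<Longrightarrow> \<beta> \<in> F \<Longrightarrow> \<beta> \<noteq> \<alpha> \<Longrightarrow> coeff (q \<alpha> x) \<beta> = 0"
    using eliminated_sections[OF x0 F] N by (auto simp: F_def)
  show ?thesis
  proof (rule that[of "\<lambda>x. \<Prod>\<alpha>\<in>F. coeff (q \<alpha> x) \<alpha>"])
    show "polyfun S (\<lambda>x. \<Prod>\<alpha>\<in>F. coeff (q \<alpha> x) \<alpha>)"
      using q(1) by (intro polyfun_prod) (auto simp: ideal_section_def poly_family_coeff)
    show "(\<Prod>\<alpha>\<in>F. coeff (q \<alpha> x0) \<alpha>) \<noteq> 0" using q(2) F by simp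
    show "\<forall>x\<in>U. (\<Prod>\<alpha>\<in>F. coeff (q \<alpha> x) \<alpha>) \<noteq> 0 \<longrightarrow> diagram (J x) = N"
    proof (intro ballI impI, rule ccontr)
      fix x assume x: "x \<in> U" "(\<Prod>\<alpha>\<in>F. coeff (q \<alpha> x) \<alpha>) \<noteq> 0"
      assume "diagram (J x) \<noteq> N"
      with min x(1) have "first_diff_less N (diagram (J x))" by simp
      then obtain \<alpha> where a: "\<alpha> \<in> N" "\<alpha> \<notin> diagram (J x)"
        "\<And>\<beta>. expo_less \<beta> \<alpha> \<Longrightarrow> \<beta> \<in> N \<longleftrightarrow> \<beta> \<in> diagram (J x)"
        unfolding first_diff_less_def by blast
      obtain \<beta> \<gamma> where b: "\<beta> \<in> min_expos ?V N" "\<gamma> \<in> expos ?V" "\<alpha> = \<beta> + \<gamma>"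
        using up_closed_generated[OF up a(1)] by blast
      have "\<gamma> = 0"
      proof (rule ccontr)
        assume "\<gamma> \<noteq> 0"
        then have "\<beta> \<in> diagram (J x)"
          using a(3)[of \<beta>] b expo_less_add_pos[of \<gamma> \<beta>] by (auto simp: min_expos_def)
        then show False using up_closed_diagram[OF J[OF x(1)]] a(2) b unfolding up_closed_def by blast
      qed
      then have "tdeg \<alpha> \<le> d"
        unfolding d_def using b finite_min_expos[OF up] by (intro Max_ge) auto
      then have aF: "\<alpha> \<in> F" using a(1) by (simp add: F_def)
      let ?g = "q \<alpha> x"
      have g: "?g \<in> J x" using q(1)[OF aF] x(1) by (simp add: ideal_section_def)
      have ga: "coeff ?g \<alpha> \<noteq> 0" using x(2) F aF by auto
      then have g0: "?g \<noteq> 0" by auto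
      note gp = initial_expo_props[OF J_supp[OF x(1) g] _ g0, simplified]
      have "initial_expo ?g \<in> diagram (J x)" by (rule diagram_memI[OF g g0])
      then have lt: "expo_less (initial_expo ?g) \<alpha>" "initial_expo ?g \<in> N"
        using gp(2)[OF ga] a by auto
      then have "initial_expo ?g \<in> F"
        using expo_less_tdeg[OF lt(1)] \<open>tdeg \<alpha> \<le> d\<close> by (simp add: F_def)
      then have "coeff ?g (initial_expo ?g) = 0" using q(3)[OF aF x(1)] lt(1) by force
      then show False using gp(1) by simp
    qed
  qed
qed

text \<open>Over a constant diagram, initial exponents of sections stay in \<open>N\<close>. An
  eliminated section vanishes at the exponents of \<open>F\<close> other than its pivot, so its
  order is at least the smaller of \<open>K\<close> and the degree of the pivot, at every point.
  Using pivots of degree at least \<open>d\<close> keeps order \<open>d\<close>, and weighting them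
  by the coefficients of \<open>f\<close> matches \<open>f\<close> on \<open>F\<close>; the
  difference lies in the ideal and has order at least \<open>K\<close>.\<close>

lemma section_of_order:
  assumes const: "\<forall>x\<in>U. diagram (J x) = N" and x0: "x0 \<in> U"
    and f: "f \<in> J x0" "ord_ge f d"
  obtains q where "ideal_section S U J q" "\<forall>x\<in>U. ord_ge (q x) d" "ord_ge (q x0 - f) k"
proof -
  let ?V = "{0..n}"
  \<comment> \<open>Degrees below \<open>d\<close> are eliminated to force order \<open>d\<close>,
    and degrees below \<open>k\<close> to get the approximation.\<close>
  define K where "K = max k d"
  have up: "up_closed ?V N" using up_closed_diagram[OF J[OF x0]] bspec[OF const x0] by simp
  define F where "F = {\<alpha> \<in> N. tdeg \<alpha> < K}"
  have "F \<subseteq> {\<alpha> \<in> expos ?V. tdeg \<alpha> \<le> K}" using up by (auto simp: F_def up_closed_def)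
  then have F: "finite F" by (rule finite_subset) (rule finite_expos_tdeg, simp)
  obtain q where q: "\<And>\<alpha>. \<alpha> \<in> F \<Longrightarrow> ideal_section S U J (q \<alpha>)"
    "\<And>\<alpha>. \<alpha> \<in> F \<Longrightarrow> coeff (q \<alpha> x0) \<alpha> \<noteq> 0"
    "\<And>\<alpha> \<beta> x. \<alpha> \<in> F \<Longrightarrow> x \<in> U \<Longrightarrow> \<beta> \<in> F \<Longrightarrow> \<beta> \<noteq> \<alpha> \<Longrightarrow> coeff (q \<alpha> x) \<beta> = 0"
    using eliminated_sections[OF x0 F] bspec[OF const x0] by (auto simp: F_def)
  define G where "G = {\<alpha> \<in> F. d \<le> tdeg \<alpha>}"
  have G: "finite G" "G \<subseteq> F" using F by (auto simp: G_def)
  define r where "r x = (\<Sum>\<alpha>\<in>G. ms_const (coeff f \<alpha> / coeff (q \<alpha> x0) \<alpha>) * q \<alpha> x)" for x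
  show ?thesis
  proof (rule that[of r])
    show r: "ideal_section S U J r"
      unfolding r_def using G by (intro ideal_section_sum ideal_section_scale polyfun_const q(1)) auto
    show "\<forall>x\<in>U. ord_ge (r x) d"
    proof
      fix x assume x: "x \<in> U"
      have "ord_ge (q \<alpha> x) d" if a: "\<alpha> \<in> G" for \<alpha>
      proof (cases "q \<alpha> x = 0")
        case False
        have aF: "\<alpha> \<in> F" using a G by auto
        have m: "q \<alpha> x \<in> J x" using q(1)[OF aF] x by (simp add: ideal_section_def)
        note supp = J_supp[OF x m]
        note ip = initial_expo_props[OF supp _ False, simplified]
        have "initial_expo (q \<alpha> x) \<in> N" using diagram_memI[OF m False] bspec[OF const x] by simp
        then have "tdeg (initial_expo (q \<alpha> x)) < K \<Longrightarrow> initial_expo (q \<alpha> x) = \<alpha>"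
          using q(3)[OF aF x, of "initial_expo (q \<alpha> x)"] ip(1) by (auto simp: F_def)
        moreover have "d \<le> tdeg \<alpha>" "d \<le> K" using a by (auto simp: G_def K_def)
        ultimately have "d \<le> tdeg (initial_expo (q \<alpha> x))" by (metis not_less order_trans)
        then show ?thesis using ord_ge_initial_expo[OF supp _ False] by simp
      qed simp
      then show "ord_ge (r x) d" by (simp add: r_def ord_ge_def)
    qed
    have fr: "r x0 - f \<in> J x0"
      using r f(1) x0 by (intro conv_ideal_diff[OF J[OF x0]]) (auto simp: ideal_section_def)
    have zero: "coeff (r x0 - f) \<beta> = 0" if b: "\<beta> \<in> F" for \<beta>
    proof -
      have "coeff (r x0) \<beta> = (\<Sum>\<alpha>\<in>G. if \<alpha> = \<beta> then coeff f \<beta> else 0)"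
        unfolding r_def coeff_sum
        by (rule sum.cong) (use q(2,3) x0 G b in auto)
      also have "\<dots> = coeff f \<beta>"
        using G f(2) b by (auto simp: G_def ord_ge_def)
      finally show ?thesis by simp
    qed
    show "ord_ge (r x0 - f) k"
    proof (cases "r x0 - f = 0")
      case False
      note supp = J_supp[OF x0 fr]
      have "coeff (r x0 - f) (initial_expo (r x0 - f)) \<noteq> 0"
        by (rule initial_expo_props(1)[OF supp _ False]) simp
      then have "initial_expo (r x0 - f) \<notin> F" using zero by blast
      moreover have "initial_expo (r x0 - f) \<in> N" using diagram_memI[OF fr False] bspec[OF const x0] by simp
      ultimately have "k \<le> tdeg (initial_expo (r x0 - f))" by (auto simp: F_def K_def)
      then show ?thesis using ord_ge_initial_expo[OF supp _ False] by simp
    qed simp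
  qed
qed

text \<open>An element is approximated by a quotient \<open>f(t, t(a + X)) / t^d\<close>. Extending
  \<open>f\<close> to a section of order \<open>d\<close> over all of \<open>U\<close> makes the
  same division legitimate at every point, and the result polynomial in the arc.\<close>

lemma poly_spanned_strict_transform:
  assumes const: "\<forall>x\<in>U. diagram (J x) = N"
    and a: "\<And>l. l \<in> {1..n} \<Longrightarrow> polyfun S (\<lambda>x. a x l)"
  shows "poly_spanned S U (\<lambda>x. strict_transform n (a x) (J x))"
  unfolding poly_spanned_def
proof (intro ballI allI)
  fix x0 g k assume x0: "x0 \<in> U" and g: "g \<in> strict_transform n (a x0) (J x0)"
  obtain h where h: "h \<in> strict_elems n (a x0) (J x0)" "ord_ge (g - h) k"
    using strict_transform_subset_closure[OF J[OF x0]] g unfolding adic_closure_def by blast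
  obtain d f where f: "h = ms_divt d (chart_subst n (a x0) f)" "f \<in> J x0" "ord_ge f d"
    using h(1) by (rule strict_elemsE)
  \<comment> \<open>Precision \<open>k + d\<close>, because division by \<open>t^d\<close> costs
    \<open>d\<close> orders.\<close>
  obtain q where q: "ideal_section S U J q" "\<forall>x\<in>U. ord_ge (q x) d" "ord_ge (q x0 - f) (k + d)"
    by (rule section_of_order[OF const x0 f(2,3)])
  let ?p = "\<lambda>x. ms_divt d (chart_subst n (a x) (q x))"
  have "poly_family S ?p"
    using q(1) a by (intro poly_family_divt poly_family_chart_subst) (auto simp: ideal_section_def)
  moreover have "?p x \<in> strict_transform n (a x) (J x)" if x: "x \<in> U" for x
  proof -
    have "?p x \<in> strict_elems n (a x) (J x)"
      using q(1,2) x by (intro strict_elemsI) (auto simp: ideal_section_def)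
    then show ?thesis using strict_elems_subset_strict_transform[OF J[OF x], of "a x"] by blast
  qed
  moreover have "ord_ge (?p x0 - g) k"
  proof -
    have "?p x0 - h = ms_divt d (chart_subst n (a x0) (q x0 - f))"
      unfolding f(1) chart_subst_diff ms_divt_diff ..
    moreover have "ord_ge \<dots> k" unfolding ord_ge_def
    proof (intro allI impI)
      fix \<alpha> assume "tdeg \<alpha> < k"
      then have "Poly_Mapping.lookup (\<alpha> + Poly_Mapping.single 0 d) 0 < k + d"
        using lookup_le_tdeg[of \<alpha> 0] by (simp add: lookup_add)
      then show "coeff (ms_divt d (chart_subst n (a x0) (q x0 - f))) \<alpha> = 0"
        using t_ord_ge_chart_subst[OF q(3), of n "a x0"] unfolding t_ord_ge_def coeff_divt by blast
    qed
    ultimately have "ord_ge (?p x0 - h) k" by simp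
    moreover have "?p x0 - g = (?p x0 - h) - (g - h)" by simp
    ultimately show ?thesis using ord_ge_diff h(2) by metis
  qed
  ultimately show "\<exists>p. ideal_section S U (\<lambda>x. strict_transform n (a x) (J x)) p \<and> ord_ge (p x0 - g) k"
    unfolding ideal_section_def by (intro exI[of _ ?p]) auto
qed

end


subsection \<open>The Nash sequence of diagrams\<close>

lemma conv_ideal_nash_ideal:
  fixes I :: "'a::real_normed_field mseries set"
  assumes "I \<subseteq> conv_series {0..n}"
  shows "conv_ideal {0..n} (nash_ideal n I x j)"
  by (induction j) (simp_all add: conv_ideal_Idl assms conv_ideal_strict_transform)

text \<open>The generic values of the first \<open>j\<close> diagrams are the minimal ones. The last clause says that the
  generic locus is open in \<open>V\<close>.\<close>

definition generic_locus ::
    "'v set \<Rightarrow> (('v \<Rightarrow> 'a::real_normed_field) \<Rightarrow> nat \<Rightarrow> expo set) \<Rightarrow> ('v \<Rightarrow> 'a) set \<Rightarrow> nat \<Rightarrow>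
      ('v \<Rightarrow> 'a) set \<Rightarrow> (nat \<Rightarrow> expo set) \<Rightarrow> bool"
  where "generic_locus S D V j U N \<longleftrightarrow> U \<subseteq> V \<and> U \<noteq> {} \<and> (\<forall>x\<in>U. \<forall>l<j. D x l = N l) \<and>
    (\<forall>x\<in>V - U. \<exists>l<j. (\<forall>m<l. D x m = N m) \<and> first_diff_less (N l) (D x l)) \<and>
    (\<forall>x\<in>U. \<exists>h. polyfun S h \<and> h x \<noteq> 0 \<and> (\<forall>y\<in>V. h y \<noteq> 0 \<longrightarrow> y \<in> U))"

lemma generic_locusD:
  assumes "generic_locus S D V j U N"
  shows "U \<subseteq> V" "U \<noteq> {}" "x \<in> U \<Longrightarrow> l < j \<Longrightarrow> D x l = N l"
    "x \<in> V - U \<Longrightarrow> \<exists>l<j. (\<forall>m<l. D x m = N m) \<and> first_diff_less (N l) (D x l)"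
    "\<forall>x\<in>U. \<exists>h. polyfun S h \<and> h x \<noteq> 0 \<and> (\<forall>y\<in>V. h y \<noteq> 0 \<longrightarrow> y \<in> U)"
  using assms unfolding generic_locus_def by blast+

text \<open>\<open>M\<close> is the minimum of the \<open>j\<close>-th diagrams over
  \<open>U\<close>. Around a point where it is attained, the polynomial that keeps one in
  \<open>U\<close> times the pivots of \<open>min_diagram_open\<close> gives the new neighbourhood
  in \<open>V\<close>.\<close>

lemma generic_locus_refine:
  fixes I :: "'a::real_normed_field mseries set" and n :: nat
  defines "D \<equiv> \<lambda>x l. diagram (nash_ideal n I x l)"
  assumes I: "I \<subseteq> conv_series {0..n}"
    and gen: "generic_locus S D V j U N" and span: "poly_spanned S U (\<lambda>x. nash_ideal n I x j)"
  obtains U' N' where "generic_locus S D V (Suc j) U' N'" "U' \<subseteq> U"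
proof -
  let ?J = "\<lambda>x. nash_ideal n I x j"
  note cJ = conv_ideal_nash_ideal[OF I]
  note genD = generic_locusD[OF gen]
  have "(\<lambda>x. D x j) ` U \<noteq> {}" using genD(2) by simp
  moreover have "\<And>M. M \<in> (\<lambda>x. D x j) ` U \<Longrightarrow> up_closed {0..n} M"
    unfolding D_def using up_closed_diagram[OF cJ] by auto
  ultimately have "\<exists>M\<in>(\<lambda>x. D x j) ` U. \<forall>M'\<in>(\<lambda>x. D x j) ` U. M' \<noteq> M \<longrightarrow> first_diff_less M M'"
    by (intro ex_min_diagram[of "{0..n}"]) simp_all
  then obtain M where M: "M \<in> (\<lambda>x. D x j) ` U"
    "\<And>M'. M' \<in> (\<lambda>x. D x j) ` U \<Longrightarrow> M' \<noteq> M \<Longrightarrow> first_diff_less M M'"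
    by auto
  define U' where "U' = {x \<in> U. D x j = M}"
  define N' where "N' = N(j := M)"
  have "generic_locus S D V (Suc j) U' N'"
    unfolding generic_locus_def
  proof (intro conjI ballI)
    show "U' \<subseteq> V" "U' \<noteq> {}" using genD(1) M(1) by (auto simp: U'_def)
    show "\<forall>l<Suc j. D x l = N' l" if "x \<in> U'" for x
      using genD(3)[of x] that by (auto simp: U'_def N'_def less_Suc_eq)
  next
    fix x assume x: "x \<in> V - U'"
    show "\<exists>l<Suc j. (\<forall>m<l. D x m = N' m) \<and> first_diff_less (N' l) (D x l)"
    proof (cases "x \<in> U")
      case True
      then have "D x j \<noteq> M" using x by (auto simp: U'_def)
      then have "first_diff_less M (D x j)" using M(2) True by blast
      moreover have "\<forall>m<j. D x m = N m" using genD(3)[OF True] by simp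
      ultimately show ?thesis by (intro exI[of _ j]) (auto simp: N'_def)
    next
      case False
      then obtain l where "l < j" "\<forall>m<l. D x m = N m" "first_diff_less (N l) (D x l)"
        using genD(4)[of x] x by blast
      then show ?thesis by (intro exI[of _ l]) (auto simp: N'_def)
    qed
  next
    fix x assume x: "x \<in> U'"
    then have xU: "x \<in> U" "diagram (?J x) = M" by (auto simp: U'_def D_def)
    obtain h where h: "polyfun S h" "h x \<noteq> 0" "\<And>y. y \<in> V \<Longrightarrow> h y \<noteq> 0 \<Longrightarrow> y \<in> U"
      using bspec[OF genD(5) xU(1)] by blast
    have "\<forall>y\<in>U. diagram (?J y) \<noteq> M \<longrightarrow> first_diff_less M (diagram (?J y))"
      using M(2) unfolding D_def by blast
    then obtain h' where h': "polyfun S h'" "h' x \<noteq> 0" "\<forall>y\<in>U. h' y \<noteq> 0 \<longrightarrow> diagram (?J y) = M"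
      by (rule min_diagram_open[OF cJ span xU])
    have "y \<in> U'" if "y \<in> V" "h y * h' y \<noteq> 0" for y
    proof -
      have "y \<in> U" using h(3)[OF that(1)] that(2) by auto
      then show ?thesis using h'(3) that(2) by (simp add: U'_def D_def)
    qed
    then show "\<exists>h. polyfun S h \<and> h x \<noteq> 0 \<and> (\<forall>y\<in>V. h y \<noteq> 0 \<longrightarrow> y \<in> U')"
      using polyfun_mult[OF h(1) h'(1)] h(2) h'(2) by (intro exI[of _ "\<lambda>x. h x * h' x"]) simp
  qed
  then show ?thesis by (rule that) (simp add: U'_def)
qed

text \<open>The locus of stage \<open>j\<close> concerns the diagrams of index below
  \<open>j\<close>, while spanning is claimed for the ideal of index \<open>j\<close>. Refining once
  makes the \<open>j\<close>-th diagram constant, as the passage to the next strict transform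
  demands. Initially the ideal does not depend on the arc, so constant sections span it over all of
  \<open>V\<close>.\<close>

lemma ex_generic_locus:
  fixes I :: "'a::real_normed_field mseries set" and V :: "(nat \<times> nat \<Rightarrow> 'a) set" and n i :: nat
  defines "D \<equiv> \<lambda>x l. diagram (nash_ideal n I x l)"
  assumes I: "I \<subseteq> conv_series {0..n}" and V: "V \<noteq> {}"
  shows "j \<le> i \<Longrightarrow> \<exists>U N. generic_locus ({1..i} \<times> {1..n}) D V j U N \<and>
    poly_spanned ({1..i} \<times> {1..n}) U (\<lambda>x. nash_ideal n I x j)"
proof (induction j)
  case 0
  let ?S = "{1..i} \<times> {1..n}"
  have "poly_spanned ?S V (\<lambda>x. nash_ideal n I x 0)"
    unfolding poly_spanned_def ideal_section_def
  proof (intro ballI allI)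
    fix x f k assume "x \<in> V" "f \<in> nash_ideal n I x 0"
    then show "\<exists>p. (poly_family ?S p \<and> (\<forall>x\<in>V. p x \<in> nash_ideal n I x 0)) \<and> ord_ge (p x - f) k"
      by (intro exI[of _ "\<lambda>_. f"]) (auto simp: poly_family_const)
  qed
  moreover have "\<exists>h. polyfun ?S h \<and> h x \<noteq> 0 \<and> (\<forall>y\<in>V. h y \<noteq> 0 \<longrightarrow> y \<in> V)" for x :: "nat \<times> nat \<Rightarrow> 'a"
    by (rule exI[of _ "\<lambda>_. 1"]) (simp add: polyfun_const)
  then have "generic_locus ?S D V 0 V (\<lambda>_. {})"
    unfolding generic_locus_def using V by simp
  ultimately show ?case by blast
next
  case (Suc j)
  let ?S = "{1..i} \<times> {1..n}"
  obtain U N where U: "generic_locus ?S D V j U N" "poly_spanned ?S U (\<lambda>x. nash_ideal n I x j)"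
    using Suc by auto
  obtain U' N' where U': "generic_locus ?S D V (Suc j) U' N'" "U' \<subseteq> U"
    unfolding D_def by (rule generic_locus_refine[OF I U[unfolded D_def]])
  have "poly_spanned ?S U' (\<lambda>x. strict_transform n (\<lambda>l. x (Suc j, l)) (nash_ideal n I x j))"
  proof (rule poly_spanned_strict_transform[where N = "N' j"])
    show "conv_ideal {0..n} (nash_ideal n I x j)" for x by (rule conv_ideal_nash_ideal[OF I])
    show "poly_spanned ?S U' (\<lambda>x. nash_ideal n I x j)" by (rule poly_spanned_subset[OF U(2) U'(2)])
    show "\<forall>x\<in>U'. diagram (nash_ideal n I x j) = N' j"
      using generic_locusD(3)[OF U'(1)] by (simp add: D_def)
    show "polyfun ?S (\<lambda>x. x (Suc j, l))" if "l \<in> {1..n}" for l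
      using Suc.prems that by (intro polyfun_var) auto
  qed
  then show ?case using U'(1) by auto
qed

text \<open>To the equations of \<open>V\<close>, add every polynomial vanishing on
  \<open>V - U\<close>. For a point of \<open>U\<close>, its \<open>h\<close> is one of them and is
  nonzero there.\<close>

lemma algebraic_set_diff_open:
  assumes V: "algebraic_set S V"
    and op: "\<forall>x\<in>U. \<exists>h. polyfun S h \<and> h x \<noteq> 0 \<and> (\<forall>y\<in>V. h y \<noteq> 0 \<longrightarrow> y \<in> U)"
  shows "algebraic_set S (V - U)"
proof -
  obtain P where P: "P \<subseteq> polys S" "V = {x \<in> affine_space S. \<forall>p\<in>P. poly_eval p x = 0}"
    using V by (auto simp: algebraic_set_def)
  let ?Q = "{p \<in> polys S. \<forall>y\<in>V - U. poly_eval p y = 0}"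
  have "V - U = {x \<in> affine_space S. \<forall>p\<in>P \<union> ?Q. poly_eval p x = 0}" (is "_ = ?R")
  proof
    show "V - U \<subseteq> ?R" using P(2) by auto
    show "?R \<subseteq> V - U"
    proof
      fix x assume x: "x \<in> ?R"
      then have "x \<in> V" using P(2) by blast
      moreover have "x \<notin> U"
      proof
        assume "x \<in> U"
        then obtain p where p: "p \<in> polys S" "poly_eval p x \<noteq> 0" "\<forall>y\<in>V. poly_eval p y \<noteq> 0 \<longrightarrow> y \<in> U"
          using op unfolding polyfun_def by metis
        then have "p \<in> ?Q" by auto
        then show False using x p(2) by blast
      qed
      ultimately show "x \<in> V - U" by simp
    qed
  qed
  then show ?thesis unfolding algebraic_set_def using P(1) by (intro exI[of _ "P \<union> ?Q"]) auto
qed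

lemma zariski_usc_nash_seq:
  fixes I :: "'a::real_normed_field mseries set"
  assumes I: "germ_ideal n I"
  shows "zariski_usc ({1..i} \<times> {1..n}) (nash_seq_less n) (nash_seq n I i)"
  unfolding zariski_usc_def
proof (intro allI impI)
  let ?S = "{1..i} \<times> {1..n}"
  fix V :: "(nat \<times> nat \<Rightarrow> 'a) set"
  assume irr: "irreducible_algebraic_set ?S V"
  then have V: "algebraic_set ?S V" "V \<noteq> {}" by (auto simp: irreducible_algebraic_set_def)
  define D where "D = (\<lambda>x l. diagram (nash_ideal n I x l))"
  have "I \<subseteq> conv_series {1..n}" using I conv_idealD(1) by (auto simp: germ_ideal_def ideal_iff_conv_ideal)
  also have "\<dots> \<subseteq> conv_series {0..n}" by (rule conv_series_mono) auto
  finally have I0: "I \<subseteq> conv_series {0..n}" .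
  obtain U0 N0 where U0: "generic_locus ?S D V i U0 N0" "poly_spanned ?S U0 (\<lambda>x. nash_ideal n I x i)"
    using ex_generic_locus[OF I0 V(2) order_refl, of i] unfolding D_def by blast
  \<comment> \<open>Stage \<open>i\<close> settles the indices below \<open>i\<close>. The truncated
    sequence has \<open>i + 1\<close> entries, so the last one calls for a further
    refinement.\<close>
  obtain U N where gen: "generic_locus ?S D V (Suc i) U N"
    unfolding D_def by (rule generic_locus_refine[OF I0 U0[unfolded D_def]])
  have seq: "nash_seq n I i x = map (D x) [0..<Suc i]" for x by (simp add: nash_seq_def D_def)
  have eq: "nash_seq n I i x = map N [0..<Suc i]" if "x \<in> U" for x
    unfolding seq using generic_locusD(3)[OF gen that] by (simp del: upt_Suc)
  have up: "up_closed {0..n} (D x l)" for x l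
    unfolding D_def by (rule up_closed_diagram[OF conv_ideal_nash_ideal[OF I0]]) simp
  obtain x1 where x1: "x1 \<in> U" using generic_locusD(2)[OF gen] by blast
  have less: "nash_seq_less n (map N [0..<Suc i]) (nash_seq n I i x)" if x: "x \<in> V - U" for x
  proof -
    obtain l where l: "l < Suc i" "\<forall>m<l. D x m = N m" "first_diff_less (N l) (D x l)"
      using generic_locusD(4)[OF gen x] by blast
    \<comment> \<open>Identifies \<open>N l\<close> as an actual diagram, hence up-closed, as the
      comparison of vertex sequences demands.\<close>
    have "N l = D x1 l" using generic_locusD(3)[OF gen x1 l(1)] by simp
    then have "diagram_less n (N l) (D x l)" using diagram_less_first_diff l(3) up by metis
    moreover have "take l (map N [0..<Suc i]) = take l (map (D x) [0..<Suc i])"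
      using l by (intro nth_equalityI) (auto simp del: upt_Suc)
    ultimately show ?thesis unfolding nash_seq_less_def seq lexord_take_index_conv
      using l(1) by (intro disjI2 exI[of _ l]) (simp del: upt_Suc)
  qed
  show "\<exists>V'. algebraic_set ?S V' \<and> V' \<subset> V \<and>
      (\<forall>\<phi>\<in>V - V'. \<forall>\<theta>\<in>V - V'. nash_seq n I i \<phi> = nash_seq n I i \<theta>) \<and>
      (\<forall>\<phi>\<in>V - V'. \<forall>\<theta>\<in>V'. nash_seq_less n (nash_seq n I i \<phi>) (nash_seq n I i \<theta>))"
  proof (intro exI[of _ "V - U"] conjI ballI)
    show "algebraic_set ?S (V - U)"
      by (rule algebraic_set_diff_open[OF V(1) generic_locusD(5)[OF gen]])
    show "V - U \<subset> V" using x1 generic_locusD(1)[OF gen] by blast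
    fix \<phi> assume "\<phi> \<in> V - (V - U)"
    then have \<phi>: "\<phi> \<in> U" by auto
    show "nash_seq n I i \<phi> = nash_seq n I i \<theta>" if "\<theta> \<in> V - (V - U)" for \<theta>
      using eq[OF \<phi>] eq[of \<theta>] that by auto
    show "nash_seq_less n (nash_seq n I i \<phi>) (nash_seq n I i \<theta>)" if "\<theta> \<in> V - U" for \<theta>
      using less[OF that] unfolding eq[OF \<phi>] .
  qed
qed

theorem mainTheorem4:
  fixes n i :: nat
  assumes "i \<ge> 1"
  shows "(\<forall>I :: real mseries set. germ_ideal n I \<longrightarrow>
            zariski_usc ({1..i} \<times> {1..n}) (nash_seq_less n) (nash_seq n I i)) \<and>
         (\<forall>I :: complex mseries set. germ_ideal n I \<longrightarrow>
            zariski_usc ({1..i} \<times> {1..n}) (nash_seq_less n) (nash_seq n I i))"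
  by (intro conjI allI impI zariski_usc_nash_seq)

end
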